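(* Let $\mathfrak{a},\mathfrak{b}\in\mathbb{R}$ and suppose that $a$ and $q\geq 1$ are coprime integers satisfying $\left|\mathfrak{a}-\frac{a}{q}\right|<\frac{1}{q^2}$. Let $0<\delta<\frac12$, let $N$ be a positive integer and put $\mathscr{L}=\log(Nq/\delta)$. Let $\epsilon>0$ and let $M_{\frac54\epsilon}>0$ be a constant such that $d(x)\leq M_{\frac54\epsilon}x^{\frac54\epsilon}$ for all positive integers $x$. Then $$ \biggl|\sum_{n\leq N}\Lambda(n)\bigl(\chi_\delta(\mathfrak{a}n-\mathfrak{b})-2\delta\bigr)\biggr| \leq 10^3\mathscr{L}^8\Bigl(3422\,Nq^{-\frac12}+251\,N^{\frac34}+38\,(\delta Nq)^{\frac12} +\bigl(11+17^{-3}M_{\frac54\epsilon}\bigr)(Nq\delta^{-1})^{\frac34\epsilon}\delta^{\frac25}N^{\frac45+\epsilon}\Bigr). $$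
   Context: $\Lambda$ is the von Mangoldt function and $d(x)$ is the number of positive divisors of $x$. For $0<\delta<\frac12$, $\chi_\delta:\mathbb{R}\to\{0,1\}$ is the function of period $1$ defined on $[-\frac12,\frac12]$ by $\chi_\delta(\theta)=1$ if $-\delta<\theta\leq\delta$, and $\chi_\delta(\theta)=0$ if $-\frac12\leq\theta\leq-\delta$ or $\delta<\theta\leq\frac12$. *)

theory Defs
  imports "HOL-Analysis.Analysis" "HOL-Number_Theory.Prime_Powers"
begin

definition num_divisors :: "nat \<Rightarrow> nat"
  where "num_divisors x = card {d. d dvd x}"

text \<open>
  The number \<open>\<theta> - \<lceil>\<theta> - 1/2\<rceil>\<close> is the representative of \<open>\<theta>\<close> modulo 1
  in the half-open interval \<open>(-1/2, 1/2]\<close>. The two lemmas below characterise the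
  function: its period, and its values on the closed interval \<open>[-1/2, 1/2]\<close>.
\<close>

definition chi :: "real \<Rightarrow> real \<Rightarrow> real"
  where "chi \<delta> \<theta> =
    (let t = \<theta> - of_int \<lceil>\<theta> - 1/2\<rceil> in if -\<delta> < t \<and> t \<le> \<delta> then 1 else 0)"

lemma chi_periodic: "chi \<delta> (\<theta> + 1) = chi \<delta> \<theta>"
proof -
  have "\<lceil>\<theta> + 1 - 1/2\<rceil> = \<lceil>\<theta> - 1/2\<rceil> + 1"
    by (simp add: ceiling_eq_iff) linarith
  then show ?thesis by (simp add: chi_def)
qed

lemma chi_eq:
  assumes "0 < \<delta>" "\<delta> < 1/2" "-1/2 \<le> \<theta>" "\<theta> \<le> 1/2"
  shows "chi \<delta> \<theta> = (if -\<delta> < \<theta> \<and> \<theta> \<le> \<delta> then 1 else 0)"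
proof (cases "\<theta> = -1/2")
  case True
  then show ?thesis using assms by (simp add: chi_def)
next
  case False
  then have "\<lceil>\<theta> - 1/2\<rceil> = 0" using assms by (simp add: ceiling_eq_iff)
  then show ?thesis by (simp add: chi_def)
qed

end

theory Submission
  imports Defs "HOL-Computational_Algebra.Squarefree"
begin

text \<open>
  The indicator \<open>chi\<close> is sandwiched between two convolutions of indicators with the Fejer kernel, which
  reduces the problem to sums over \<open>h \<le> H\<close> of \<open>|\<Sum>n\<le>N. \<Lambda>(n) e(\<alpha>hn)|\<close> for \<open>H \<ge> 1/\<delta>\<close>.
  These are treated by Vaughan's identity with both cut-offs equal to \<open>V\<close>, where
  \<open>V = N\<^sup>2\<^sup>/\<^sup>5 H\<^sup>-\<^sup>1\<^sup>/\<^sup>5\<close> if \<open>H < N\<^sup>1\<^sup>/\<^sup>4\<close> and \<open>V = N\<^sup>1\<^sup>/\<^sup>4\<close> otherwise. The divisor function that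
  arises in the type I sums is removed by Cauchy's inequality, unless the number \<open>H V\<^sup>2\<close> of
  terms dominates; only then is the bound with \<open>M\<close> used. For the type II sums, the sum over \<open>h\<close> is kept
  inside the square in Cauchy's inequality. If \<open>L < 36\<close>, the trivial bound \<open>N log N\<close> suffices.
\<close>

section \<open>Exponential sums over intervals\<close>

text \<open>The smoothed indicator has Fourier coefficients of size at most
  \<open>min (8 * \<delta>) (1 / h)\<close>, so a dyadic range up to \<open>H\<close> is harmless if
  its sum is at most \<open>H\<close> times a quantity that does not grow with \<open>H\<close>. The
  terms to be balanced are \<open>H * V^2\<close>, the number of products in the type I sums, and
  \<open>sqrt (H * N * N / V)\<close> from type II. They agree when \<open>V^5 = N^2 / H\<close>,
  and their common value H^(3/5) N^(4/5) becomes \<delta>^(2/5) N^(4/5) after division by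
  \<open>H \<ge> 1 / \<delta>\<close>. At integers of that size the divisor bound with exponent 5/4
  \<epsilon> costs H^(3/4 \<epsilon>) N^\<epsilon>, hence the 5/4. Once \<open>H\<close> reaches
  N^(1/4), the simpler choice of \<open>V\<close> makes every term depending on it at most H N^(3/4)
  up to logarithms, which is present anyway. Of the eight logarithms, Cauchy's inequality in the
  type II sums gives 11/2, the dyadic blocks there one, the dyadic ranges of \<open>h\<close> one;
  the remaining half pays for numerical constants, which is why logarithms are assumed to be
  large.\<close>

definition ee :: "real \<Rightarrow> complex" where "ee x = cis (2 * pi * x)"

definition int_dist :: "real \<Rightarrow> real" where "int_dist x = \<bar>x - of_int (round x)\<bar>"

text \<open>The case distinction is needed because \<open>1 / 0 = 0\<close>.\<close>

definition geo_bound :: "real \<Rightarrow> real \<Rightarrow> real"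
  where "geo_bound X \<theta> = (if int_dist \<theta> = 0 then X else min X (1 / int_dist \<theta>))"

lemma norm_ee [simp]: "norm (ee x) = 1"
  by (simp add: ee_def)

lemma ee_add: "ee (x + y) = ee x * ee y"
  by (simp add: ee_def cis_mult distrib_left)

lemma ee_minus: "ee (- x) = cnj (ee x)"
  by (simp add: ee_def cis_cnj)

lemma ee_int [simp]: "ee (of_int n) = 1"
  by (simp add: ee_def)

lemma int_dist_nonneg: "int_dist x \<ge> 0"
  by (simp add: int_dist_def)

lemma int_dist_le_half: "int_dist x \<le> 1/2"
  using of_int_round_abs_le[of x] by (simp add: int_dist_def abs_minus_commute)

lemma geo_bound_nonneg: "X \<ge> 0 \<Longrightarrow> geo_bound X \<theta> \<ge> 0"
  by (simp add: geo_bound_def int_dist_nonneg)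

lemma geo_bound_le: "geo_bound X \<theta> \<le> X"
  by (simp add: geo_bound_def)

lemma geo_bound_le_inverse: "int_dist \<theta> > 0 \<Longrightarrow> geo_bound X \<theta> \<le> 1 / int_dist \<theta>"
  by (simp add: geo_bound_def)

lemma geo_bound_mono: "X \<le> Y \<Longrightarrow> geo_bound X \<theta> \<le> geo_bound Y \<theta>"
  by (auto simp: geo_bound_def min_def)

text \<open>Half of the concavity bound \<open>2 * x\<close>, which is enough here. Up to 1/3 the
  difference increases because \<open>pi * cos (pi * y) \<ge> 2 * (1/2)\<close>; from there on the
  sine is at least 1/2.\<close>

lemma sin_pi_ge:
  assumes "0 \<le> x" "x \<le> 1/2" shows "x \<le> sin (pi * x)"
proof (cases "x \<le> 1/3")
  case True
  have "sin (pi * 0) - 0 \<le> sin (pi * x) - x"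
  proof (rule DERIV_nonneg_imp_nondecreasing[OF assms(1)])
    fix y :: real assume y: "0 \<le> y" "y \<le> x"
    have "cos (pi * y) \<ge> cos (pi / 3)"
      using y True by (intro cos_monotone_0_pi_le) (auto simp: field_simps)
    then have "cos (pi * y) \<ge> 1/2" by (simp add: cos_60)
    then have "pi * cos (pi * y) \<ge> 2 * (1/2)"
      using pi_ge_two by (intro mult_mono) auto
    then show "\<exists>D. ((\<lambda>x. sin (pi * x) - x) has_real_derivative D) (at y) \<and> 0 \<le> D"
      by (intro exI[of _ "cos (pi * y) * pi - 1"] conjI)
         (auto intro!: derivative_eq_intros simp: mult.commute)
  qed
  then show ?thesis by simp
next
  case False
  have "sin (pi / 6) \<le> sin (pi * x)"
    using False assms by (intro sin_monotone_2pi_le) (auto simp: field_simps)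
  then show ?thesis using assms by (simp add: sin_30)
qed

text \<open>The chord \<open>norm (1 - ee f)\<close> equals
  \<open>2 * sin (pi * \<bar>f\<bar>)\<close>, where \<open>f\<close> is the signed distance of
  \<open>x\<close> to the nearest integer.\<close>

lemma norm_one_minus_ee: "norm (1 - ee x) \<ge> 2 * int_dist x"
proof -
  define f where "f = x - of_int (round x)"
  have "ee x = ee f"
    using ee_add[of f "of_int (round x)"] by (simp add: f_def)
  have f: "\<bar>f\<bar> = int_dist x" by (simp add: f_def int_dist_def)
  have "norm (1 - ee f)^2 = (1 - cos (2*pi*f))^2 + (sin (2*pi*f))^2"
    by (simp add: ee_def cmod_power2)
  also have "\<dots> = 2 - 2 * cos (2 * (pi*f))"
    using sin_cos_squared_add[of "2*pi*f"] by (simp add: power2_eq_square algebra_simps)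
  also have "\<dots> = (2 * sin (pi * \<bar>f\<bar>))^2"
    by (cases "f \<ge> 0") (simp_all add: cos_double_sin power_mult_distrib)
  finally have eq: "norm (1 - ee f)^2 = (2 * sin (pi * \<bar>f\<bar>))^2" .
  have "2 * int_dist x \<le> 2 * sin (pi * \<bar>f\<bar>)"
    using sin_pi_ge[of "\<bar>f\<bar>"] int_dist_le_half[of x] int_dist_nonneg[of x] by (simp add: f)
  moreover have "norm (1 - ee f) = \<bar>2 * sin (pi * \<bar>f\<bar>)\<bar>"
    using eq by (metis abs_norm_cancel power2_eq_iff_nonneg abs_ge_zero power2_abs)
  ultimately show ?thesis using \<open>ee x = ee f\<close> by simp
qed

lemma norm_sum_ee:
  "norm (\<Sum>m\<in>{m1<..m2}. ee (\<theta> * real m)) \<le> geo_bound (real (m2 - m1)) \<theta>"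
proof (cases "int_dist \<theta> = 0")
  case True
  then show ?thesis using norm_sum[of "\<lambda>m. ee (\<theta> * real m)" "{m1<..m2}"] by (simp add: geo_bound_def)
next
  case False
  have triv: "norm (\<Sum>m\<in>{m1<..m2}. ee (\<theta> * real m)) \<le> real (m2 - m1)"
    using norm_sum[of "\<lambda>m. ee (\<theta> * real m)" "{m1<..m2}"] by simp
  \<comment> \<open>Multiplication by \<open>1 - ee \<theta>\<close> telescopes the geometric sum.
    The exponents are successors because the range is open on the left and closed on the
    right.\<close>
  have tel: "(1 - ee \<theta>) * (\<Sum>m\<in>{m1<..m2}. ee (\<theta> * real m)) = ee (\<theta> * real (Suc m1)) - ee (\<theta> * real (Suc m2))"
    if "m1 \<le> m2"
    using that
  proof (induction m2 rule: dec_induct)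
    case base then show ?case by simp
  next
    case (step n)
    have "{m1<..Suc n} = insert (Suc n) {m1<..n}" using step by auto
    then have "(1 - ee \<theta>) * (\<Sum>m\<in>{m1<..Suc n}. ee (\<theta> * real m))
        = (1 - ee \<theta>) * ee (\<theta> * real (Suc n)) + (1 - ee \<theta>) * (\<Sum>m\<in>{m1<..n}. ee (\<theta> * real m))"
      by (simp add: distrib_left)
    also have "\<dots> = ee (\<theta> * real (Suc m1)) - ee \<theta> * ee (\<theta> * real (Suc n))"
      unfolding step.IH by (simp add: left_diff_distrib)
    also have "ee \<theta> * ee (\<theta> * real (Suc n)) = ee (\<theta> * real (Suc (Suc n)))"
      by (simp add: ee_add[symmetric] algebra_simps)
    finally show ?case .
  qed
  have pos: "int_dist \<theta> > 0" using False int_dist_nonneg[of \<theta>] by simp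
  have "2 * int_dist \<theta> * norm (\<Sum>m\<in>{m1<..m2}. ee (\<theta> * real m)) \<le> 2"
  proof (cases "m1 \<le> m2")
    case True
    have "2 * int_dist \<theta> * norm (\<Sum>m\<in>{m1<..m2}. ee (\<theta> * real m)) 
       \<le> norm (1 - ee \<theta>) * norm (\<Sum>m\<in>{m1<..m2}. ee (\<theta> * real m))"
      by (intro mult_right_mono norm_one_minus_ee) simp
    also have "\<dots> = norm (ee (\<theta> * real (Suc m1)) - ee (\<theta> * real (Suc m2)))"
      by (simp only: norm_mult[symmetric] tel[OF True])
    also have "\<dots> \<le> 2"
      using norm_triangle_ineq4[of "ee (\<theta> * real (Suc m1))" "ee (\<theta> * real (Suc m2))"] by simp
    finally show ?thesis .
  qed simp
  then have "norm (\<Sum>m\<in>{m1<..m2}. ee (\<theta> * real m)) \<le> 1 / int_dist \<theta>"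
    using pos by (simp add: field_simps)
  with triv show ?thesis using False by (simp add: geo_bound_def)
qed

section \<open>Sums over rational approximations\<close>

text \<open>The left side is the distance from \<open>w\<close> to the nearest multiple of
  \<open>q\<close>, and 0 is one of these multiples.\<close>

lemma min_mod_le_abs:
  fixes w q :: int
  assumes "q > 0"
  shows "min (w mod q) (q - w mod q) \<le> \<bar>w\<bar>"
proof (cases "w \<ge> 0")
  case True
  then show ?thesis using zmod_le_nonneg_dividend[of w q] by linarith
next
  case False
  then have "w div q < 0" using assms by (intro div_neg_pos_less0) auto
  then have "w div q \<le> -1" by simp
  then have "q * (w div q) \<le> q * (-1)" using assms by (intro mult_left_mono) auto
  moreover have "w = q * (w div q) + w mod q" by simp
  ultimately show ?thesis using False by linarith
qed

lemma sum_inverse_le_harm: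
  assumes "\<And>u. u \<in> S \<Longrightarrow> c < u \<and> u \<le> c + int n" "finite S"
  shows "(\<Sum>u\<in>S. 1 / of_int (u - c)) \<le> (harm n :: real)"
  unfolding harm_def
proof (rule sum_le_included[where i = "\<lambda>k. int k + c"])
  show "\<forall>s\<in>S. \<exists>k\<in>{1..n}. int k + c = s \<and> 1 / of_int (s - c) \<le> (inverse (of_nat k) :: real)"
  proof
    fix s assume "s \<in> S"
    then have "c < s \<and> s \<le> c + int n" using assms by blast
    then show "\<exists>k\<in>{1..n}. int k + c = s \<and> 1 / of_int (s - c) \<le> (inverse (of_nat k) :: real)"
      by (intro bexI[of _ "nat (s - c)"]) (auto simp: inverse_eq_divide)
  qed
qed (use assms in auto)

locale rational_approx =
  fixes \<alpha> :: real and a q :: int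
  assumes q_pos: "q \<ge> 1"
    and coprime_a_q: "coprime a q"
    and approx: "\<bar>\<alpha> - of_int a / of_int q\<bar> < 1 / (of_int q)^2"
begin

definition hq :: real where "hq = harm (nat q)"

lemma hq_nonneg: "hq \<ge> 0"
  by (simp add: hq_def harm_nonneg)

lemma approx': "\<bar>of_int q * \<alpha> - of_int a\<bar> \<le> 1 / of_int q"
proof -
  have "\<bar>of_int q * \<alpha> - of_int a\<bar> = of_int q * \<bar>\<alpha> - of_int a / of_int q\<bar>"
  proof -
    have "of_int q * \<alpha> - of_int a = of_int q * (\<alpha> - of_int a / of_int q)"
      using q_pos by (simp add: right_diff_distrib)
    then show ?thesis using q_pos by (simp add: abs_mult)
  qed
  also have "\<dots> \<le> of_int q * (1 / (of_int q)^2)"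
    using q_pos approx by (intro mult_left_mono less_imp_le) simp_all
  finally show ?thesis using q_pos by (simp add: power2_eq_square)
qed

text \<open>\<open>a\<close> is invertible modulo \<open>q\<close>, so indices that are less than
  \<open>q\<close> apart have different residues.\<close>

lemma inj_on_residue:
  assumes "\<And>i j. i \<in> S \<Longrightarrow> j \<in> S \<Longrightarrow> \<bar>i - j\<bar> < q"
  shows "inj_on (\<lambda>i. (b + a * i) mod q) S"
proof (rule inj_onI)
  fix i j assume ij: "i \<in> S" "j \<in> S" and eq: "(b + a * i) mod q = (b + a * j) mod q"
  then have "q dvd (b + a * i) - (b + a * j)" by (simp add: mod_eq_dvd_iff)
  then have "q dvd a * (i - j)" by (simp add: algebra_simps)
  then have "q dvd i - j" using coprime_a_q by (simp add: coprime_dvd_mult_right_iff coprime_commute)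
  with assms[OF ij] show "i = j" using zdvd_not_zless[of "\<bar>i - j\<bar>" q] by force
qed

text \<open>Multiply \<open>\<alpha> * (B + i)\<close> by \<open>q\<close>: rounding
  \<open>\<alpha> * B * q\<close> down costs less than 1, and replacing \<open>q * \<alpha>\<close>
  by \<open>a\<close> over \<open>i \<le> q\<close> steps costs at most 1. What remains is an
  integer congruent to \<open>t\<close>, which explains the 2.\<close>

lemma min_residue_le:
  fixes B i :: int
  assumes "0 \<le> i" "i \<le> q"
  defines "t \<equiv> (\<lfloor>\<alpha> * of_int B * of_int q\<rfloor> + a * i) mod q"
  shows "of_int (min t (q - t)) \<le> of_int q * int_dist (\<alpha> * of_int (B + i)) + 2"
proof -
  define b where "b = \<lfloor>\<alpha> * of_int B * of_int q\<rfloor>"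
  define n where "n = round (\<alpha> * of_int (B + i))"
  define w where "w = b + a * i - n * q"
  define er where "er = (of_int q * \<alpha> - of_int a) * of_int i"
  define fr where "fr = \<alpha> * of_int B * of_int q - of_int b"
  have fr: "0 \<le> fr" "fr < 1" unfolding fr_def b_def by linarith+
  have "\<bar>er\<bar> = \<bar>of_int q * \<alpha> - of_int a\<bar> * of_int i" using assms by (simp add: er_def abs_mult)
  also have "\<dots> \<le> 1 / of_int q * of_int q" using assms q_pos by (intro mult_mono approx') auto
  finally have er: "\<bar>er\<bar> \<le> 1" using q_pos by simp
  have "of_int q * (\<alpha> * of_int (B + i) - of_int n) = of_int w + fr + er"
    by (simp add: w_def fr_def er_def algebra_simps)
  moreover have "of_int q * int_dist (\<alpha> * of_int (B + i)) = \<bar>of_int q * (\<alpha> * of_int (B + i) - of_int n)\<bar>"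
    using q_pos by (simp add: int_dist_def n_def abs_mult)
  ultimately have "\<bar>of_int w :: real\<bar> \<le> of_int q * int_dist (\<alpha> * of_int (B + i)) + 2" using fr er by linarith
  moreover have "t = w mod q"
    using mod_mult_self1[of "b + a * i" "- n" q] by (simp add: t_def w_def b_def)
  then have "min t (q - t) \<le> \<bar>w\<bar>" using min_mod_le_abs q_pos by auto
  then have "of_int (min t (q - t)) \<le> (of_int \<bar>w\<bar> :: real)" by (simp only: of_int_le_iff)
  ultimately show ?thesis by linarith
qed

text \<open>
  In a block of \<open>q\<close> consecutive integers \<open>s\<close>, the fractional parts of \<open>\<alpha> * s\<close> are within
  \<open>2/q\<close> of the distinct fractions with denominator \<open>q\<close>, so all but six of them
  contribute a harmonic sum.
\<close>

lemma block_sum: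
  fixes B :: int
  assumes X: "X \<ge> 0"
  shows "(\<Sum>s\<in>{B<..B+q}. geo_bound X (\<alpha> * of_int s)) \<le> 6 * X + 2 * of_int q * hq"
proof -
  \<comment> \<open>Majorant in terms of the distance \<open>u\<close> of the residue from the
    multiples of \<open>q\<close>. For \<open>u \<le> 2\<close> the error may swallow the distance,
    and only the trivial bound \<open>X\<close> is left.\<close>
  define \<phi> :: "int \<Rightarrow> real" where "\<phi> u = (if u \<le> 2 then X else of_int q / of_int (u - 2))" for u
  define t where "t i = (\<lfloor>\<alpha> * of_int B * of_int q\<rfloor> + a * i) mod q" for i
  have phi0: "\<phi> u \<ge> 0" for u using X q_pos by (simp add: \<phi>_def)
  have "(\<Sum>s\<in>{B<..B+q}. geo_bound X (\<alpha> * of_int s)) = (\<Sum>i\<in>{1..q}. geo_bound X (\<alpha> * of_int (B + i)))"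
    by (rule sum.reindex_bij_witness[of _ "\<lambda>i. B + i" "\<lambda>s. s - B"]) auto
  also have "\<dots> \<le> (\<Sum>i\<in>{1..q}. \<phi> (min (t i) (q - t i)))"
  proof (rule sum_mono)
    fix i assume i: "i \<in> {1..q}"
    define u where "u = min (t i) (q - t i)"
    have u: "of_int u \<le> of_int q * int_dist (\<alpha> * of_int (B + i)) + 2"
      unfolding u_def t_def using i by (intro min_residue_le) auto
    show "geo_bound X (\<alpha> * of_int (B + i)) \<le> \<phi> (min (t i) (q - t i))"
    proof (cases "u \<le> 2")
      case True then show ?thesis by (simp add: \<phi>_def u_def[symmetric] geo_bound_le)
    next
      case False
      have *: "of_int (u - 2) / of_int q \<le> int_dist (\<alpha> * of_int (B + i))"
        using u q_pos by (simp add: field_simps)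
      have pos: "0 < of_int (u - 2) / (of_int q :: real)" using False q_pos by simp
      have "geo_bound X (\<alpha> * of_int (B + i)) \<le> 1 / int_dist (\<alpha> * of_int (B + i))"
        using * pos by (intro geo_bound_le_inverse) linarith
      also have "\<dots> \<le> 1 / (of_int (u - 2) / of_int q)" by (rule frac_le[OF _ _ pos *]) simp_all
      finally show ?thesis using False by (simp add: \<phi>_def u_def[symmetric])
    qed
  qed
  also have "\<dots> = (\<Sum>u\<in>t ` {1..q}. \<phi> (min u (q - u)))"
    unfolding t_def by (subst sum.reindex[OF inj_on_residue]) auto
  also have "\<dots> \<le> (\<Sum>u\<in>{0..<q}. \<phi> (min u (q - u)))"
    using q_pos phi0 by (intro sum_mono2) (auto simp: t_def)
  \<comment> \<open>Both ends of the residue range are counted separately; each yields the values 0,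
    1, 2 with the trivial bound, hence \<open>6 * X\<close>, and one harmonic sum.\<close>
  also have "\<dots> \<le> (\<Sum>u\<in>{0..<q}. \<phi> u + \<phi> (q - u))"
    using phi0 by (intro sum_mono) (auto simp: min_def add_nonneg_nonneg)
  also have "\<dots> = (\<Sum>u\<in>{0..<q}. \<phi> u) + (\<Sum>u\<in>{1..q}. \<phi> u)"
    unfolding sum.distrib
    by (intro arg_cong2[of _ _ _ _ "(+)"] refl sum.reindex_bij_witness[of _ "\<lambda>u. q - u" "\<lambda>u. q - u"]) auto
  also have "\<dots> \<le> (\<Sum>u\<in>{0..q}. \<phi> u) + (\<Sum>u\<in>{0..q}. \<phi> u)"
    using phi0 by (intro add_mono sum_mono2) auto
  also have "(\<Sum>u\<in>{0..q}. \<phi> u) \<le> 3 * X + of_int q * hq"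
  proof -
    have "(\<Sum>u\<in>{0..q}. \<phi> u) \<le> (\<Sum>u\<in>{0,1,2} \<union> {3..q}. \<phi> u)"
      using phi0 by (intro sum_mono2) auto
    also have "\<dots> = 3 * X + (\<Sum>u\<in>{3..q}. \<phi> u)"
      by (subst sum.union_disjoint) (auto simp: \<phi>_def)
    also have "(\<Sum>u\<in>{3..q}. \<phi> u) = of_int q * (\<Sum>u\<in>{3..q}. 1 / of_int (u - 2))"
      unfolding sum_distrib_left by (intro sum.cong) (auto simp: \<phi>_def)
    also have "\<dots> \<le> of_int q * hq"
      unfolding hq_def using q_pos by (intro mult_left_mono sum_inverse_le_harm) auto
    finally show ?thesis by simp
  qed
  finally show ?thesis by simp
qed

text \<open>The interval is covered by \<open>R div q + 1\<close> blocks of \<open>q\<close>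
  integers; nonnegativity lets the last block overshoot.\<close>

lemma interval_sum:
  fixes A :: int
  assumes X: "X \<ge> 0"
  shows "(\<Sum>s\<in>{A<..A + int R}. geo_bound X (\<alpha> * of_int s)) \<le> (real R / of_int q + 1) * (6 * X + 2 * of_int q * hq)"
proof -
  have *: "(\<Sum>s\<in>{A<..A + int k * q}. geo_bound X (\<alpha> * of_int s)) \<le> real k * (6 * X + 2 * of_int q * hq)" for k
  proof (induction k)
    case (Suc k)
    have k0: "int k * q \<ge> 0" using q_pos by simp
    have c: "int (Suc k) * q = int k * q + q" by (simp add: algebra_simps)
    have "{A<..A + int (Suc k) * q} = {A<..A + int k * q} \<union> {A + int k * q<..(A + int k * q) + q}"
      using k0 q_pos ivl_disj_un_two(6)[of A "A + int k * q" "A + int k * q + q"] by (simp add: c add.assoc del: of_nat_Suc)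
    then have "(\<Sum>s\<in>{A<..A + int (Suc k) * q}. geo_bound X (\<alpha> * of_int s)) =
      (\<Sum>s\<in>{A<..A + int k * q}. geo_bound X (\<alpha> * of_int s)) + (\<Sum>s\<in>{A + int k * q<..(A + int k * q) + q}. geo_bound X (\<alpha> * of_int s))"
      by (simp add: sum.union_disjoint)
    also have "\<dots> \<le> real k * (6 * X + 2 * of_int q * hq) + (6 * X + 2 * of_int q * hq)"
      by (intro add_mono Suc.IH block_sum X)
    finally show ?case by (simp add: algebra_simps)
  qed simp
  define k where "k = R div nat q + 1"
  have "R < k * nat q" unfolding k_def using q_pos dividend_less_div_times[of "nat q" R]
    by (simp add: algebra_simps)
  then have "int R < int (k * nat q)" by (simp only: of_nat_less_iff)
  then have "int R \<le> int k * q" using q_pos by simp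
  then have "(\<Sum>s\<in>{A<..A + int R}. geo_bound X (\<alpha> * of_int s)) \<le> (\<Sum>s\<in>{A<..A + int k * q}. geo_bound X (\<alpha> * of_int s))"
    using X by (intro sum_mono2) (auto intro: geo_bound_nonneg)
  also note *[of k]
  also have "real k * (6 * X + 2 * of_int q * hq) \<le> (real R / of_int q + 1) * (6 * X + 2 * of_int q * hq)"
  proof (intro mult_right_mono)
    have "real (R div nat q) \<le> real R / real (nat q)" by (rule of_nat_div_le_of_nat)
    then show "real k \<le> real R / of_int q + 1" using q_pos by (simp add: k_def)
  qed (use X q_pos hq_nonneg in auto)
  finally show ?thesis .
qed

text \<open>For \<open>s \<le> q / 2\<close> the error in \<open>q * \<alpha> * s\<close> is at most
  1/2, and \<open>q\<close> does not divide \<open>a * s\<close>, so no term needs the trivial bound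
  and the sizes \<open>Z s\<close> do not enter. This controls the start of the range in
  \<open>hyper_sum\<close>, where \<open>Z / s\<close> is largest.\<close>

lemma first_half_sum:
  "(\<Sum>s\<in>{1..q div 2}. geo_bound (Z s) (\<alpha> * of_int s)) \<le> 4 * of_int q * hq"
proof -
  define t where "t i = (0 + a * i) mod q" for i
  have t: "0 < t s" "t s < q" "geo_bound (Z s) (\<alpha> * of_int s) \<le> 2 * of_int q * (1 / of_int (t s) + 1 / of_int (q - t s))"
    if "s \<in> {1..q div 2}" for s
  proof -
    have s: "1 \<le> s" "2 * s \<le> q" using that by auto
    show "t s < q" using q_pos by (simp add: t_def)
    have "\<not> q dvd a * s"
    proof
      assume "q dvd a * s"
      then have "q dvd s" using coprime_a_q by (simp add: coprime_dvd_mult_right_iff coprime_commute)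
      then show False using s zdvd_not_zless[of s q] by linarith
    qed
    then have "t s \<noteq> 0" by (auto simp: t_def)
    moreover have "t s \<ge> 0" using q_pos by (simp add: t_def)
    ultimately show t0: "0 < t s" by simp
    define n where "n = round (\<alpha> * of_int s)"
    define w where "w = a * s - n * q"
    define er where "er = (of_int q * \<alpha> - of_int a) * of_int s"
    have "\<bar>er\<bar> = \<bar>of_int q * \<alpha> - of_int a\<bar> * of_int s" using s by (simp add: er_def abs_mult)
    also have "\<dots> \<le> 1 / of_int q * (of_int q / 2)" using s q_pos by (intro mult_mono approx') auto
    finally have er: "\<bar>er\<bar> \<le> 1/2" using q_pos by simp
    have "of_int q * (\<alpha> * of_int s - of_int n) = of_int w + er"
      by (simp add: w_def er_def algebra_simps)
    moreover have "of_int q * int_dist (\<alpha> * of_int s) = \<bar>of_int q * (\<alpha> * of_int s - of_int n)\<bar>"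
      using q_pos by (simp add: int_dist_def n_def abs_mult)
    ultimately have int_dist: "of_int q * int_dist (\<alpha> * of_int s) = \<bar>of_int w + er\<bar>" by simp
    define u where "u = min (t s) (q - t s)"
    have u1: "u \<ge> 1" using t0 \<open>t s < q\<close> by (simp add: u_def)
    have "t s = w mod q"
      using mod_mult_self1[of "a * s" "- n" q] by (simp add: t_def w_def)
    then have uw: "u \<le> \<bar>w\<bar>" unfolding u_def using min_mod_le_abs[of q w] q_pos by auto
    then have "real_of_int u \<le> \<bar>of_int w\<bar>" "real_of_int u \<ge> 1" using u1 by linarith+
    \<comment> \<open>An error of at most 1/2 takes away at most half of an integer distance
      \<open>u \<ge> 1\<close>.\<close>
    then have "of_int q * int_dist (\<alpha> * of_int s) \<ge> of_int u / 2" unfolding int_dist using er by linarith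
    then have *: "int_dist (\<alpha> * of_int s) \<ge> of_int u / (2 * of_int q)" using q_pos by (simp add: field_simps)
    have pos: "0 < of_int u / (2 * of_int q :: real)" using u1 q_pos by simp
    have "geo_bound (Z s) (\<alpha> * of_int s) \<le> 1 / int_dist (\<alpha> * of_int s)"
      using * pos by (intro geo_bound_le_inverse) linarith
    also have "\<dots> \<le> 1 / (of_int u / (2 * of_int q))" by (rule frac_le[OF _ _ pos *]) simp_all
    also have "\<dots> = 2 * of_int q * (1 / of_int u)" by simp
    also have "\<dots> \<le> 2 * of_int q * (1 / of_int (t s) + 1 / of_int (q - t s))"
      using q_pos t0 \<open>t s < q\<close> by (intro mult_left_mono) (auto simp: u_def min_def)
    finally show "geo_bound (Z s) (\<alpha> * of_int s) \<le> 2 * of_int q * (1 / of_int (t s) + 1 / of_int (q - t s))" .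
  qed
  have "(\<Sum>s\<in>{1..q div 2}. geo_bound (Z s) (\<alpha> * of_int s)) \<le> (\<Sum>s\<in>{1..q div 2}. 2 * of_int q * (1 / of_int (t s) + 1 / of_int (q - t s)))"
    by (intro sum_mono t)
  also have "\<dots> = (\<Sum>u\<in>t ` {1..q div 2}. 2 * of_int q * (1 / of_int u + 1 / of_int (q - u)))"
    unfolding t_def using q_pos by (subst sum.reindex[OF inj_on_residue]) auto
  also have "\<dots> \<le> (\<Sum>u\<in>{1..<q}. 2 * of_int q * (1 / of_int u + 1 / of_int (q - u)))"
    using q_pos t by (intro sum_mono2) (auto simp: Suc_le_eq int_one_le_iff_zero_less)
  also have "\<dots> = 2 * of_int q * ((\<Sum>u\<in>{1..<q}. 1 / of_int u) + (\<Sum>u\<in>{1..<q}. 1 / of_int (q - u)))"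
    by (simp only: sum_distrib_left sum.distrib distrib_left)
  also have "(\<Sum>u\<in>{1..<q}. 1 / of_int (q - u)) = (\<Sum>u\<in>{1..<q}. 1 / (of_int u :: real))"
    by (rule sum.reindex_bij_witness[of _ "\<lambda>u. q - u" "\<lambda>u. q - u"]) auto
  also have "(\<Sum>u\<in>{1..<q}. 1 / (of_int u :: real)) \<le> hq"
    using sum_inverse_le_harm[of "{1..<q}" 0 "nat q"] by (simp add: hq_def)
  finally show ?thesis using q_pos by (simp add: algebra_simps)
qed

text \<open>The range up to \<open>q div 2\<close> is left to \<open>first_half_sum\<close>. In the
  block with index \<open>k\<close> after it, counted from 0,
  \<open>s \<ge> q * (k + 1) / 2\<close>, so \<open>block_sum\<close> applies with
  \<open>X = 2 * Z / (q * (k + 1))\<close>, and the trivial terms add up to a harmonic sum in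
  \<open>k\<close>.\<close>

lemma hyper_sum:
  assumes Z: "Z \<ge> 0"
  shows "(\<Sum>s\<in>{1..int R}. geo_bound (Z / of_int s) (\<alpha> * of_int s))
     \<le> 12 * Z / of_int q * harm (R div nat q + 1) + (2 * real R + 6 * of_int q) * hq"
proof -
  define q0 where "q0 = q div 2"
  define J where "J = R div nat q + 1"
  let ?f = "\<lambda>s. geo_bound (Z / of_int s) (\<alpha> * of_int s)"
  have q0: "q0 \<ge> 0" "2 * q0 + 1 \<ge> q" using q_pos by (auto simp: q0_def)
  have *: "(\<Sum>s\<in>{q0<..q0 + int k * q}. ?f s) \<le> 12 * Z / of_int q * harm k + real k * (2 * of_int q * hq)" for k
  proof (induction k)
    case (Suc k)
    have k0: "int k * q \<ge> 0" using q_pos by simp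
    have c: "int (Suc k) * q = int k * q + q" by (simp add: algebra_simps)
    have "{q0<..q0 + int (Suc k) * q} = {q0<..q0 + int k * q} \<union> {q0 + int k * q<..(q0 + int k * q) + q}"
      using k0 q_pos ivl_disj_un_two(6)[of q0 "q0 + int k * q" "q0 + int k * q + q"] by (simp add: c add.assoc del: of_nat_Suc)
    then have "(\<Sum>s\<in>{q0<..q0 + int (Suc k) * q}. ?f s) =
      (\<Sum>s\<in>{q0<..q0 + int k * q}. ?f s) + (\<Sum>s\<in>{q0 + int k * q<..(q0 + int k * q) + q}. ?f s)"
      by (simp add: sum.union_disjoint)
    also have "(\<Sum>s\<in>{q0 + int k * q<..(q0 + int k * q) + q}. ?f s) \<le>
       (\<Sum>s\<in>{q0 + int k * q<..(q0 + int k * q) + q}. geo_bound (2 * Z / (of_int q * real (Suc k))) (\<alpha> * of_int s))"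
    proof (intro sum_mono geo_bound_mono)
      fix s assume s: "s \<in> {q0 + int k * q<..(q0 + int k * q) + q}"
      then have "2 * s \<ge> q + 2 * (int k * q)" using q0 by auto
      then have "2 * s \<ge> q * int (Suc k)" using k0 c unfolding mult.commute[of q] by linarith
      then have "real_of_int (q * int (Suc k)) \<le> real_of_int (2 * s)" by (simp only: of_int_le_iff)
      then have "of_int q * real (Suc k) \<le> 2 * of_int s" by simp
      moreover have "s > 0" using s q0 k0 unfolding greaterThanAtMost_iff by linarith
      then have "real_of_int s > 0" by simp
      ultimately have "2 * Z / (2 * of_int s) \<le> 2 * Z / (of_int q * real (Suc k))"
        using Z q_pos by (intro divide_left_mono) auto
      then show "Z / of_int s \<le> 2 * Z / (of_int q * real (Suc k))" by simp
    qed
    also have "\<dots> \<le> 6 * (2 * Z / (of_int q * real (Suc k))) + 2 * of_int q * hq"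
      using Z q_pos by (intro block_sum) auto
    also have "6 * (2 * Z / (of_int q * real (Suc k))) = 12 * Z / of_int q * inverse (real (Suc k))"
      by (simp add: field_simps)
    also note Suc.IH
    finally show ?case by (simp add: harm_Suc algebra_simps add_divide_distrib)
  qed (simp add: harm_def)
  have "R < J * nat q" unfolding J_def using q_pos dividend_less_div_times[of "nat q" R]
    by (simp add: algebra_simps)
  then have "int R < int (J * nat q)" by (simp only: of_nat_less_iff)
  then have RJ: "int R \<le> int J * q" using q_pos by simp
  have "(\<Sum>s\<in>{1..int R}. ?f s) \<le> (\<Sum>s\<in>{1..q0} \<union> {q0<..q0 + int J * q}. ?f s)"
    using Z RJ q0 by (intro sum_mono2) (auto intro!: geo_bound_nonneg)
  also have "\<dots> = (\<Sum>s\<in>{1..q0}. ?f s) + (\<Sum>s\<in>{q0<..q0 + int J * q}. ?f s)"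
    by (rule sum.union_disjoint) auto
  also have "\<dots> \<le> 4 * of_int q * hq + (12 * Z / of_int q * harm J + real J * (2 * of_int q * hq))"
    unfolding q0_def by (intro add_mono first_half_sum *[unfolded q0_def])
  also have "real J * (2 * of_int q * hq) \<le> (real R / of_int q + 1) * (2 * of_int q * hq)"
  proof (intro mult_right_mono)
    have "real (R div nat q) \<le> real R / real (nat q)" by (rule of_nat_div_le_of_nat)
    then show "real J \<le> real R / of_int q + 1" using q_pos by (simp add: J_def)
  qed (use q_pos hq_nonneg in auto)
  finally show ?thesis using q_pos by (simp add: J_def field_simps)
qed

end

section \<open>Mean values of divisor sums\<close>

abbreviation divsum :: "(nat \<Rightarrow> real) \<Rightarrow> nat \<Rightarrow> real"
  where "divsum f n \<equiv> (\<Sum>k | k dvd n. f k)"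

section \<open>Interchanging sums over divisors and multiples\<close>

lemma sum_if_filter:
  "(\<Sum>n\<in>{1..R::nat}. if P n then g n else 0) = (\<Sum>n | n \<in> {1..R} \<and> P n. g n)"
  by (rule sum.inter_filter[symmetric]) simp

lemma divsum_one: "divsum (\<lambda>_. 1) n = real (num_divisors n)"
  by (simp add: num_divisors_def)

lemma sum_multiples_one:
  assumes "t \<ge> 1"
  shows "(\<Sum>n | n \<in> {1..R} \<and> t dvd n. 1) \<le> real R / real t"
proof -
  have "{n. n \<in> {1..R} \<and> t dvd n} \<subseteq> (\<lambda>j. t * j) ` {1..R div t}"
  proof
    fix n assume "n \<in> {n. n \<in> {1..R} \<and> t dvd n}"
    then obtain j where j: "n = t * j" "1 \<le> n" "n \<le> R" by auto
    then have "j \<le> R div t" using assms by (simp add: less_eq_div_iff_mult_less_eq mult.commute)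
    then show "n \<in> (\<lambda>j. t * j) ` {1..R div t}" using j by (intro image_eqI[of _ _ j]) (auto simp: Suc_le_eq)
  qed
  then have "card {n. n \<in> {1..R} \<and> t dvd n} \<le> card ((\<lambda>j. t * j) ` {1..R div t})"
    by (intro card_mono) auto
  also have "\<dots> \<le> R div t" using card_image_le[of "{1..R div t}" "\<lambda>j. t * j"] by simp
  finally have "real (card {n. n \<in> {1..R} \<and> t dvd n}) \<le> real (R div t)" by simp
  also have "\<dots> \<le> real R / real t" by (rule of_nat_div_le_of_nat)
  finally show ?thesis by simp
qed

lemma sum_multiples_inverse:
  assumes "t \<ge> 1"
  shows "(\<Sum>n | n \<in> {1..R} \<and> t dvd n. 1 / real n) \<le> harm R / real t"
proof -
  have "(\<Sum>n | n \<in> {1..R} \<and> t dvd n. 1 / real n) \<le> (\<Sum>j\<in>{1..R}. 1 / real (t * j))"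
  proof (rule sum_le_included[where i = "\<lambda>j. t * j"])
    show "\<forall>s\<in>{n. n \<in> {1..R} \<and> t dvd n}. \<exists>j\<in>{1..R}. t * j = s \<and> 1 / real s \<le> 1 / real (t * j)"
    proof
      fix s assume "s \<in> {n. n \<in> {1..R} \<and> t dvd n}"
      then obtain j where j: "s = t * j" "1 \<le> s" "s \<le> R" by auto
      then have j1: "1 \<le> j" "j \<le> t * j" using assms by (auto simp: Suc_le_eq)
      have "j \<in> {1..R}" using j j1(1) order.trans[OF j1(2), of R] by simp
      then show "\<exists>j\<in>{1..R}. t * j = s \<and> 1 / real s \<le> 1 / real (t * j)" using j by auto
    qed
  qed auto
  also have "\<dots> = harm R / real t"
    by (simp add: harm_def sum_divide_distrib inverse_eq_divide mult.commute)
  finally show ?thesis .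
qed

text \<open>All divisors of \<open>n\<close> lie in a range that does not depend on
  \<open>n\<close>, which allows the order of summation to be changed.\<close>

lemma divsum_eq:
  fixes n :: nat
  assumes "n \<in> {1..R}"
  shows "(\<Sum>k | k dvd n. g k) = (\<Sum>k\<in>{1..R}. if k dvd n then g k else 0)"
proof -
  have "{k. k dvd n} = {k. k \<in> {1..R} \<and> k dvd n}"
  proof -
    have "1 \<le> k \<and> k \<le> R" if "k dvd n" for k
      using that assms dvd_pos_nat[of n k] dvd_imp_le[of k n] by auto
    then show ?thesis by auto
  qed
  then show ?thesis by (simp only: sum_if_filter)
qed

text \<open>Write \<open>k = g * x\<close> and \<open>l = g * y\<close> with \<open>g\<close> the
  gcd. Then \<open>lcm k l = g * x * y\<close>, and submultiplicativity bounds the numerator by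
  \<open>f g ^ 2 * f x * f y\<close>. Dropping the coprimality of \<open>x\<close> and
  \<open>y\<close> only enlarges the sum, which then factors.\<close>

lemma sum_lcm_le:
  fixes f :: "nat \<Rightarrow> real"
  assumes f0: "\<And>k. f k \<ge> 0" and fm: "\<And>m n. m \<ge> 1 \<Longrightarrow> n \<ge> 1 \<Longrightarrow> f (m * n) \<le> f m * f n"
  shows "(\<Sum>k\<in>{1..R}. \<Sum>l\<in>{1..R}. f k * f l / real (lcm k l))
     \<le> (\<Sum>g\<in>{1..R}. f g ^ 2 / real g) * (\<Sum>k\<in>{1..R}. f k / real k) ^ 2"
proof -
  have "(\<Sum>k\<in>{1..R}. \<Sum>l\<in>{1..R}. f k * f l / real (lcm k l))
      = (\<Sum>(k,l)\<in>{1..R} \<times> {1..R}. f k * f l / real (lcm k l))"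
    by (simp add: sum.cartesian_product)
  also have "\<dots> \<le> (\<Sum>(g,x,y)\<in>{1..R} \<times> {1..R} \<times> {1..R}. f g ^ 2 / real g * (f x / real x * (f y / real y)))"
  proof (rule sum_le_included[where i = "\<lambda>(g,x,y). (g * x, g * y)"])
    show "\<forall>p\<in>{1..R} \<times> {1..R}. \<exists>z\<in>{1..R} \<times> {1..R} \<times> {1..R}. (case z of (g,x,y) \<Rightarrow> (g * x, g * y)) = p \<and>
      (case p of (k,l) \<Rightarrow> f k * f l / real (lcm k l)) \<le>
      (case z of (g,x,y) \<Rightarrow> f g ^ 2 / real g * (f x / real x * (f y / real y)))"
    proof (clarify)
      fix k l :: nat assume k: "k \<in> {1..R}" and l: "l \<in> {1..R}"
      define g where "g = gcd k l"
      obtain x y where xy: "k = g * x" "l = g * y" unfolding g_def by (meson dvdE gcd_dvd1 gcd_dvd2)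
      have pos: "g \<ge> 1" "x \<ge> 1" "y \<ge> 1" using k l xy by (auto simp: Suc_le_eq)
      have "g * (g * x * y) = k * l" by (simp add: xy)
      also have "\<dots> = g * lcm k l" unfolding g_def by (rule prod_gcd_lcm_nat)
      finally have lcm: "lcm k l = g * x * y" using pos by simp
      have "f k * f l \<le> (f g * f x) * (f g * f y)"
        unfolding xy using pos by (intro mult_mono fm f0 mult_nonneg_nonneg)
      then have "f k * f l / real (lcm k l) \<le> ((f g * f x) * (f g * f y)) / real (lcm k l)"
        by (rule divide_right_mono) simp
      also have "\<dots> = f g ^ 2 / real g * (f x / real x * (f y / real y))"
        by (simp add: lcm power2_eq_square mult_ac)
      finally have "f k * f l / real (lcm k l) \<le> f g ^ 2 / real g * (f x / real x * (f y / real y))" .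
      moreover have "g \<le> R" "x \<le> R" "y \<le> R"
      proof -
        have R: "g * x \<le> R" "g * y \<le> R" using k l by (simp_all add: xy)
        have "g \<le> g * x" "x \<le> g * x" "y \<le> g * y" using pos by auto
        then show "g \<le> R" "x \<le> R" "y \<le> R" using R by linarith+
      qed
      ultimately show "\<exists>z\<in>{1..R} \<times> {1..R} \<times> {1..R}. (case z of (g,x,y) \<Rightarrow> (g * x, g * y)) = (k, l) \<and>
        f k * f l / real (lcm k l) \<le>
        (case z of (g,x,y) \<Rightarrow> f g ^ 2 / real g * (f x / real x * (f y / real y)))"
        using pos xy by (intro bexI[of _ "(g,x,y)"]) auto
    qed
  qed (auto intro!: mult_nonneg_nonneg divide_nonneg_nonneg f0)
  also have "\<dots> = (\<Sum>g\<in>{1..R}. f g ^ 2 / real g) * ((\<Sum>k\<in>{1..R}. f k / real k) * (\<Sum>k\<in>{1..R}. f k / real k))"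
    unfolding sum_product sum.cartesian_product by (simp add: case_prod_unfold)
  finally show ?thesis by (simp add: power2_eq_square)
qed

text \<open>\<open>k\<close> and \<open>l\<close> both divide \<open>n\<close> exactly when
  \<open>lcm k l\<close> does, so squaring out reduces the claim to \<open>sum_lcm_le\<close>. The
  hypothesis on \<open>w\<close> covers the weights 1 and \<open>1 / n\<close>.\<close>

lemma sum_divsum_sq:
  fixes f w :: "nat \<Rightarrow> real"
  assumes f0: "\<And>k. f k \<ge> 0" and fm: "\<And>m n. m \<ge> 1 \<Longrightarrow> n \<ge> 1 \<Longrightarrow> f (m * n) \<le> f m * f n"
    and w: "\<And>t. t \<ge> 1 \<Longrightarrow> (\<Sum>n | n \<in> {1..R} \<and> t dvd n. w n) \<le> W / real t" and W: "W \<ge> 0"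
  shows "(\<Sum>n\<in>{1..R}. w n * divsum f n ^ 2)
     \<le> W * ((\<Sum>g\<in>{1..R}. f g ^ 2 / real g) * (\<Sum>k\<in>{1..R}. f k / real k) ^ 2)"
proof -
  have "(\<Sum>n\<in>{1..R}. w n * divsum f n ^ 2)
    = (\<Sum>n\<in>{1..R}. \<Sum>k\<in>{1..R}. \<Sum>l\<in>{1..R}. if lcm k l dvd n then f k * f l * w n else 0)"
  proof (intro sum.cong refl)
    fix n assume n: "n \<in> {1..R}"
    have "w n * divsum f n ^ 2 = (\<Sum>k\<in>{1..R}. \<Sum>l\<in>{1..R}.
        w n * ((if k dvd n then f k else 0) * (if l dvd n then f l else 0)))"
      unfolding divsum_eq[OF n] power2_eq_square sum_product by (simp only: sum_distrib_left)
    then show "w n * divsum f n ^ 2 = (\<Sum>k\<in>{1..R}. \<Sum>l\<in>{1..R}. if lcm k l dvd n then f k * f l * w n else 0)"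
      by (auto intro!: sum.cong)
  qed
  also have "\<dots> = (\<Sum>k\<in>{1..R}. \<Sum>l\<in>{1..R}. \<Sum>n\<in>{1..R}. if lcm k l dvd n then f k * f l * w n else 0)"
    by (subst sum.swap) (intro sum.cong refl sum.swap)
  also have "\<dots> = (\<Sum>k\<in>{1..R}. \<Sum>l\<in>{1..R}. f k * f l * (\<Sum>n | n \<in> {1..R} \<and> lcm k l dvd n. w n))"
    by (simp only: sum_distrib_left sum_if_filter)
  also have "\<dots> \<le> (\<Sum>k\<in>{1..R}. \<Sum>l\<in>{1..R}. f k * f l * (W / real (lcm k l)))"
    using f0 by (intro sum_mono mult_left_mono w mult_nonneg_nonneg) (auto simp: Suc_le_eq lcm_pos_nat)
  also have "\<dots> = W * (\<Sum>k\<in>{1..R}. \<Sum>l\<in>{1..R}. f k * f l / real (lcm k l))"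
    by (simp add: sum_distrib_left mult_ac)
  also have "\<dots> \<le> W * ((\<Sum>g\<in>{1..R}. f g ^ 2 / real g) * (\<Sum>k\<in>{1..R}. f k / real k) ^ 2)"
    by (intro mult_left_mono sum_lcm_le f0 fm W)
  finally show ?thesis .
qed

section \<open>Moments of the divisor function\<close>

lemma num_divisors_mult_le: "m \<ge> 1 \<Longrightarrow> n \<ge> 1 \<Longrightarrow> num_divisors (m * n) \<le> num_divisors m * num_divisors n"
proof -
  assume mn: "m \<ge> 1" "n \<ge> 1"
  \<comment> \<open>Every divisor of \<open>m * n\<close> is a product of a divisor of
    \<open>m\<close> and a divisor of \<open>n\<close>.\<close>
  have "{d. d dvd m * n} \<subseteq> (\<lambda>(x,y). x * y) ` ({d. d dvd m} \<times> {d. d dvd n})"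
    by (force elim: division_decomp[THEN exE] dest!: division_decomp)
  then have "card {d. d dvd m * n} \<le> card ({d. d dvd m} \<times> {d. d dvd n})"
    using mn by (intro surj_card_le) (auto intro!: finite_cartesian_product)
  then show ?thesis by (simp add: num_divisors_def card_cartesian_product)
qed

lemma sum_inverse_harm: "(\<Sum>k\<in>{1..R}. 1 / real k) = harm R"
  by (simp add: harm_def inverse_eq_divide)

lemma sum_num_divisors_div: "(\<Sum>n\<in>{1..R}. real (num_divisors n) / real n) \<le> harm R ^ 2"
proof -
  have "(\<Sum>n\<in>{1..R}. real (num_divisors n) / real n) = (\<Sum>n\<in>{1..R}. \<Sum>k\<in>{1..R}. if k dvd n then 1 / real n else 0)"
    unfolding divsum_one[symmetric]
    by (intro sum.cong refl, subst divsum_eq[where R = R], simp)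
       (auto simp only: sum_divide_distrib div_0 intro!: sum.cong split: if_splits)
  also have "\<dots> = (\<Sum>k\<in>{1..R}. \<Sum>n | n \<in> {1..R} \<and> k dvd n. 1 / real n)"
    by (subst sum.swap) (simp only: sum_if_filter)
  also have "\<dots> \<le> (\<Sum>k\<in>{1..R}. harm R / real k)"
    by (intro sum_mono sum_multiples_inverse) auto
  also have "\<dots> = harm R * (\<Sum>k\<in>{1..R}. 1 / real k)" by (simp add: sum_distrib_left)
  finally show ?thesis unfolding sum_inverse_harm by (simp only: power2_eq_square)
qed

lemma sum_num_divisors_sq_div: "(\<Sum>n\<in>{1..R}. real (num_divisors n) ^ 2 / real n) \<le> harm R ^ 4"
proof -
  have "(\<Sum>n\<in>{1..R}. 1 / real n * divsum (\<lambda>_. 1) n ^ 2)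
     \<le> harm R * ((\<Sum>g\<in>{1..R}. 1 ^ 2 / real g) * (\<Sum>k\<in>{1..R}. 1 / real k) ^ 2)"
    by (intro sum_divsum_sq sum_multiples_inverse harm_nonneg) auto
  then show ?thesis unfolding divsum_one one_power2 sum_inverse_harm
    by (simp add: power2_eq_square power4_eq_xxxx)
qed

lemma sum_num_divisors_sq: "(\<Sum>n\<in>{1..R}. real (num_divisors n) ^ 2) \<le> real R * harm R ^ 3"
proof -
  have "(\<Sum>n\<in>{1..R}. 1 * divsum (\<lambda>_. 1) n ^ 2)
     \<le> real R * ((\<Sum>g\<in>{1..R}. 1 ^ 2 / real g) * (\<Sum>k\<in>{1..R}. 1 / real k) ^ 2)"
    by (intro sum_divsum_sq sum_multiples_one) auto
  then show ?thesis unfolding divsum_one one_power2 sum_inverse_harm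
    by (simp add: power2_eq_square power3_eq_cube)
qed

text \<open>The inner sum is the ternary divisor function. With \<open>f = num_divisors\<close>, the
  gcd sum gives four harmonic factors and the two remaining sums give two each.\<close>

lemma sum_divsum_num_divisors_sq:
  "(\<Sum>n\<in>{1..R}. divsum (\<lambda>k. real (num_divisors k)) n ^ 2) \<le> real R * harm R ^ 8"
proof -
  let ?f = "\<lambda>k. real (num_divisors k)"
  have "(\<Sum>n\<in>{1..R}. 1 * divsum ?f n ^ 2)
     \<le> real R * ((\<Sum>g\<in>{1..R}. ?f g ^ 2 / real g) * (\<Sum>k\<in>{1..R}. ?f k / real k) ^ 2)"
    using num_divisors_mult_le
    by (intro sum_divsum_sq sum_multiples_one) (auto simp: num_divisors_mult_le simp flip: of_nat_mult)
  also have "\<dots> \<le> real R * (harm R ^ 4 * (harm R ^ 2) ^ 2)"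
    by (intro mult_left_mono mult_mono power_mono sum_num_divisors_sq_div sum_num_divisors_div)
       (auto intro!: sum_nonneg harm_nonneg)
  finally show ?thesis by (simp flip: power_add power_mult)
qed

section \<open>Vaughan's identity\<close>

definition moebius_mu :: "nat \<Rightarrow> real"
  where "moebius_mu n = (if squarefree n then (-1) ^ card (prime_factors n) else 0)"

lemma abs_moebius_mu_le: "\<bar>moebius_mu n\<bar> \<le> 1"
  by (simp add: moebius_mu_def power_abs)

lemma moebius_mu_Suc_0 [simp]: "moebius_mu (Suc 0) = 1"
  by (simp add: moebius_mu_def)

lemma moebius_mu_mult_prime:
  assumes p: "prime p" and "\<not> p dvd d" "d > 0"
  shows "moebius_mu (p * d) = - moebius_mu d"
proof -
  have cop: "coprime p d" using assms prime_imp_coprime by blast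
  have sq: "squarefree (p * d) \<longleftrightarrow> squarefree d"
    using cop squarefree_mult_coprime squarefree_multD squarefree_prime[OF p] by blast
  have "prime_factors (p * d) = insert p (prime_factors d)"
    using assms by (auto simp: prime_factors_product prime_prime_factors)
  moreover have "p \<notin> prime_factors d" using assms by auto
  ultimately show ?thesis using sq by (simp add: moebius_mu_def)
qed

lemma moebius_mu_mult_prime_dvd:
  assumes p: "prime p" and "p dvd d"
  shows "moebius_mu (p * d) = 0"
proof -
  have "p ^ 2 dvd p * d" using assms by (simp add: power2_eq_square)
  then have "\<not> squarefree (p * d)" using p not_squarefreeI[of p "p * d"] not_prime_unit by blast
  then show ?thesis by (simp add: moebius_mu_def)
qed

text \<open>Fix a prime \<open>p\<close> dividing \<open>n\<close>. Divisors \<open>d\<close> prime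
  to \<open>p\<close> cancel against \<open>p * d\<close>, and every other divisor is a multiple of
  \<open>p ^ 2\<close>, where the function vanishes.\<close>

lemma sum_moebius_mu:
  assumes "n \<ge> 1"
  shows "(\<Sum>d | d dvd n. moebius_mu d) = (if n = 1 then 1 else 0)"
proof (cases "n = 1")
  case False
  then obtain p where p: "prime p" "p dvd n" using prime_factor_nat by blast
  define A where "A = {d. d dvd n \<and> \<not> p dvd d}"
  have fin: "finite {d. d dvd n}" using assms by simp
  have pos: "d > 0" if "d dvd n" for d using that assms by (auto intro: Nat.gr0I)
  have eq: "{d. d dvd n} = A \<union> {d. d dvd n \<and> p dvd d}" by (auto simp: A_def)
  have "(\<Sum>d | d dvd n. moebius_mu d) = (\<Sum>d\<in>A. moebius_mu d) + (\<Sum>d | d dvd n \<and> p dvd d. moebius_mu d)"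
    by (subst eq, rule sum.union_disjoint) (use fin in \<open>auto simp: A_def\<close>)
  also have "(\<Sum>d | d dvd n \<and> p dvd d. moebius_mu d) = (\<Sum>d\<in>(\<lambda>d. p * d) ` A. moebius_mu d)"
  proof (rule sum.mono_neutral_right)
    show "(\<lambda>d. p * d) ` A \<subseteq> {d. d dvd n \<and> p dvd d}"
    proof clarify
      fix d assume "d \<in> A"
      then have "coprime p d" using p prime_imp_coprime by (auto simp: A_def)
      then show "p * d dvd n \<and> p dvd p * d" using \<open>d \<in> A\<close> p divides_mult by (auto simp: A_def)
    qed
    show "\<forall>d\<in>{d. d dvd n \<and> p dvd d} - (\<lambda>d. p * d) ` A. moebius_mu d = 0"
    proof
      fix d assume d: "d \<in> {d. d dvd n \<and> p dvd d} - (\<lambda>d. p * d) ` A"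
      then obtain e where e: "d = p * e" by auto
      with d have "p dvd e" unfolding A_def by (auto dest: dvd_mult_right)
      then show "moebius_mu d = 0" using p e moebius_mu_mult_prime_dvd by simp
    qed
  qed (use fin in auto)
  also have "\<dots> = (\<Sum>d\<in>A. moebius_mu (p * d))"
    using p by (subst sum.reindex) (auto simp: inj_on_def prime_gt_0_nat)
  also have "\<dots> = (\<Sum>d\<in>A. - moebius_mu d)"
    using p pos by (intro sum.cong refl moebius_mu_mult_prime) (auto simp: A_def)
  finally show ?thesis using False by (simp add: sum_negf)
qed simp

text \<open>The terms are sorted by the product \<open>j = u * v\<close>, and \<open>v\<close> is
  recovered as \<open>j div u\<close>. The second argument of \<open>g\<close> is the product
  itself, so that weights depend on \<open>u\<close> and \<open>j\<close> only.\<close>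

lemma sum_hyperbola:
  fixes g :: "nat \<Rightarrow> nat \<Rightarrow> 'a::comm_monoid_add"
  shows "(\<Sum>u\<in>{1..N}. \<Sum>v\<in>{1..N}. if u * v \<le> N then g u (u * v) else 0) = (\<Sum>j\<in>{1..N}. \<Sum>u | u dvd j. g u j)"
proof -
  have "(\<Sum>j\<in>{1..N}. \<Sum>u | u dvd j. g u j) = (\<Sum>j\<in>{1..N}. \<Sum>u\<in>{1..N}. if u dvd j then g u j else 0)"
    by (intro sum.cong refl divsum_eq)
  also have "\<dots> = (\<Sum>u\<in>{1..N}. \<Sum>j\<in>{1..N}. if u dvd j then g u j else 0)" by (rule sum.swap)
  also have "\<dots> = (\<Sum>u\<in>{1..N}. \<Sum>v\<in>{1..N}. if u * v \<le> N then g u (u * v) else 0)"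
  proof (rule sum.cong[OF refl])
    fix u assume u: "u \<in> {1..N}"
    have "(\<Sum>j\<in>{1..N}. if u dvd j then g u j else 0) = (\<Sum>j | j \<in> {1..N} \<and> u dvd j. g u j)"
      by (simp only: sum_if_filter)
    also have "\<dots> = (\<Sum>v | v \<in> {1..N} \<and> u * v \<le> N. g u (u * v))"
      using u
      by (intro sum.reindex_bij_witness[of _ "\<lambda>v. u * v" "\<lambda>j. j div u"])
         (auto simp: Suc_le_eq intro: div_greater_zero_iff[THEN iffD2] dvd_imp_le order.trans[OF div_le_dividend])
    also have "\<dots> = (\<Sum>v\<in>{1..N}. if u * v \<le> N then g u (u * v) else 0)"
      by (simp only: sum_if_filter)
    finally show "(\<Sum>j\<in>{1..N}. if u dvd j then g u j else 0) = (\<Sum>v\<in>{1..N}. if u * v \<le> N then g u (u * v) else 0)" .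
  qed
  finally show ?thesis by simp
qed

lemma mult_le_imp_le:
  assumes "(a::nat) * b \<le> N" "b \<ge> 1" shows "a \<le> N"
proof -
  have "a * 1 \<le> a * b" using assms by (intro mult_le_mono2) auto
  then show ?thesis using assms(1) by linarith
qed

text \<open>Coefficient of one variable of the type II sum; it arises when the Moebius variable
  \<open>d > V\<close> is merged with the free variable.\<close>

definition vaughan_coeff :: "real \<Rightarrow> nat \<Rightarrow> real"
  where "vaughan_coeff V m = (\<Sum>d | d dvd m \<and> real d > V. moebius_mu d)"

text \<open>Consider all triples with \<open>d * k * m \<le> N\<close>, weighted by
  \<open>moebius_mu d * mangoldt k * f (d * k * m)\<close>. Summing over \<open>d\<close> and
  \<open>m\<close> first leaves \<open>mangoldt k * f k\<close>, which is wanted for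
  \<open>k > V\<close>. That region is \<open>k > V, d > V\<close>, plus \<open>d \<le> V\<close>,
  minus \<open>d \<le> V, k \<le> V\<close>; the terms with \<open>k \<le> V\<close> are kept aside
  as the first sum.\<close>

theorem vaughan_identity:
  fixes f :: "nat \<Rightarrow> complex"
  assumes V: "V \<ge> 1"
  shows "(\<Sum>n\<in>{1..N}. mangoldt n * f n) =
     (\<Sum>n | n \<in> {1..N} \<and> real n \<le> V. mangoldt n * f n)
   + (\<Sum>d | d \<in> {1..N} \<and> real d \<le> V. of_real (moebius_mu d) * (\<Sum>j | j \<in> {1..N} \<and> d * j \<le> N. of_real (ln (real j)) * f (d * j)))
   - (\<Sum>d | d \<in> {1..N} \<and> real d \<le> V. \<Sum>k | k \<in> {1..N} \<and> real k \<le> V.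
        of_real (moebius_mu d) * mangoldt k * (\<Sum>m | m \<in> {1..N} \<and> d * k * m \<le> N. f (d * k * m)))
   + (\<Sum>m | m \<in> {1..N} \<and> real m > V. \<Sum>k | k \<in> {1..N} \<and> real k > V \<and> m * k \<le> N.
        of_real (vaughan_coeff V m) * mangoldt k * f (m * k))"
proof -
  define G where "G d k m = (if d * k * m \<le> N then of_real (moebius_mu d) * mangoldt k * f (d * k * m) else 0)" for d k m
  define T where "T P = (\<Sum>d\<in>{1..N}. \<Sum>k\<in>{1..N}. \<Sum>m\<in>{1..N}. if P d k then G d k m else 0)" for P :: "nat \<Rightarrow> nat \<Rightarrow> bool"
  have split: "T (\<lambda>d k. real k > V) = T (\<lambda>d k. real k > V \<and> real d > V) + T (\<lambda>d k. real d \<le> V) - T (\<lambda>d k. real d \<le> V \<and> real k \<le> V)"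
    unfolding T_def sum.distrib[symmetric] sum_subtractf[symmetric]
    by (intro sum.cong refl) auto
  have pr: "d * k * m \<le> N \<Longrightarrow> m \<ge> 1 \<Longrightarrow> d * k \<le> N" for d k m :: nat
    by (rule mult_le_imp_le)
  \<comment> \<open>Grouping \<open>d * m = j\<close> for fixed \<open>k\<close>, the Moebius sum
    over the divisors of \<open>j\<close> keeps only \<open>j = 1\<close>.\<close>
  have 1: "T (\<lambda>d k. real k > V) = (\<Sum>k | k \<in> {1..N} \<and> real k > V. mangoldt k * f k)"
  proof -
    have "T (\<lambda>d k. real k > V) = (\<Sum>k\<in>{1..N}. \<Sum>d\<in>{1..N}. \<Sum>m\<in>{1..N}. if real k > V then G d k m else 0)"
      unfolding T_def by (rule sum.swap)
    also have "\<dots> = (\<Sum>k\<in>{1..N}. if real k > V then mangoldt k * f k else 0)"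
    proof (intro sum.cong refl)
      fix k assume k: "k \<in> {1..N}"
      have "(\<Sum>d\<in>{1..N}. \<Sum>m\<in>{1..N}. G d k m) =
         (\<Sum>d\<in>{1..N}. \<Sum>m\<in>{1..N}. if d * m \<le> N then (if k * (d * m) \<le> N then of_real (moebius_mu d) * mangoldt k * f (k * (d * m)) else 0) else 0)"
      proof (intro sum.cong refl)
        fix d m assume "d \<in> {1..N}" "m \<in> {1..N}"
        have "d * m \<le> N" if "k * (d * m) \<le> N" using that k mult_le_imp_le[of "d * m" k N] by (simp add: mult_ac)
        then show "G d k m = (if d * m \<le> N then (if k * (d * m) \<le> N then of_real (moebius_mu d) * mangoldt k * f (k * (d * m)) else 0) else 0)"
          by (auto simp: G_def mult_ac)
      qed
      also have "\<dots> = (\<Sum>j\<in>{1..N}. \<Sum>d | d dvd j. if k * j \<le> N then of_real (moebius_mu d) * mangoldt k * f (k * j) else 0)"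
        by (rule sum_hyperbola)
      also have "\<dots> = (\<Sum>j\<in>{1..N}. if j = 1 then mangoldt k * f k else 0)"
      proof (intro sum.cong refl)
        fix j assume j: "j \<in> {1..N}"
        have "(\<Sum>d | d dvd j. if k * j \<le> N then of_real (moebius_mu d) * mangoldt k * f (k * j) else 0)
          = (if k * j \<le> N then of_real (\<Sum>d | d dvd j. moebius_mu d) * mangoldt k * f (k * j) else 0)"
          by (simp add: sum_distrib_right)
        then show "(\<Sum>d | d dvd j. if k * j \<le> N then of_real (moebius_mu d) * mangoldt k * f (k * j) else 0)
          = (if j = 1 then mangoldt k * f k else 0)"
          using j k by (simp add: sum_moebius_mu)
      qed
      also have "\<dots> = mangoldt k * f k" using k by simp
      finally have *: "(\<Sum>d\<in>{1..N}. \<Sum>m\<in>{1..N}. G d k m) = mangoldt k * f k" .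
      show "(\<Sum>d\<in>{1..N}. \<Sum>m\<in>{1..N}. if real k > V then G d k m else 0) = (if real k > V then mangoldt k * f k else 0)"
        using * by simp
    qed
    finally show ?thesis by (simp only: sum_if_filter)
  qed
  \<comment> \<open>With \<open>d\<close> fixed, \<open>k * m = j\<close> is grouped instead, and
    \<open>mangoldt\<close> summed over the divisors of \<open>j\<close> gives
    \<open>ln j\<close>.\<close>
  have 2: "T (\<lambda>d k. real d \<le> V) = (\<Sum>d | d \<in> {1..N} \<and> real d \<le> V. of_real (moebius_mu d) * (\<Sum>j | j \<in> {1..N} \<and> d * j \<le> N. of_real (ln (real j)) * f (d * j)))"
  proof -
    have *: "(\<Sum>k\<in>{1..N}. \<Sum>m\<in>{1..N}. G d k m) = of_real (moebius_mu d) * (\<Sum>j | j \<in> {1..N} \<and> d * j \<le> N. of_real (ln (real j)) * f (d * j))"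
      if d: "d \<in> {1..N}" for d
    proof -
      have "(\<Sum>k\<in>{1..N}. \<Sum>m\<in>{1..N}. G d k m) =
         (\<Sum>k\<in>{1..N}. \<Sum>m\<in>{1..N}. if k * m \<le> N then (if d * (k * m) \<le> N then of_real (moebius_mu d) * mangoldt k * f (d * (k * m)) else 0) else 0)"
      proof (intro sum.cong refl)
        fix k m assume "k \<in> {1..N}" "m \<in> {1..N}"
        have "k * m \<le> N" if "d * (k * m) \<le> N" using that d mult_le_imp_le[of "k * m" d N] by (simp add: mult_ac)
        then show "G d k m = (if k * m \<le> N then (if d * (k * m) \<le> N then of_real (moebius_mu d) * mangoldt k * f (d * (k * m)) else 0) else 0)"
          by (auto simp: G_def mult_ac)
      qed
      also have "\<dots> = (\<Sum>j\<in>{1..N}. \<Sum>k | k dvd j. if d * j \<le> N then of_real (moebius_mu d) * mangoldt k * f (d * j) else 0)"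
        by (rule sum_hyperbola)
      also have "\<dots> = (\<Sum>j\<in>{1..N}. if d * j \<le> N then of_real (moebius_mu d) * (of_real (ln (real j)) * f (d * j)) else 0)"
      proof (intro sum.cong refl)
        fix j assume j: "j \<in> {1..N}"
        have "(\<Sum>k | k dvd j. if d * j \<le> N then of_real (moebius_mu d) * mangoldt k * f (d * j) else 0)
          = (if d * j \<le> N then of_real (moebius_mu d) * ((\<Sum>k | k dvd j. mangoldt k) * f (d * j)) else 0)"
          by (simp add: sum_distrib_right sum_distrib_left mult_ac)
        then show "(\<Sum>k | k dvd j. if d * j \<le> N then of_real (moebius_mu d) * mangoldt k * f (d * j) else 0)
          = (if d * j \<le> N then of_real (moebius_mu d) * (of_real (ln (real j)) * f (d * j)) else 0)"
          using j by (simp add: mangoldt_sum)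
      qed
      also have "\<dots> = of_real (moebius_mu d) * (\<Sum>j | j \<in> {1..N} \<and> d * j \<le> N. of_real (ln (real j)) * f (d * j))"
        unfolding sum_if_filter by (simp only: sum_distrib_left)
      finally show ?thesis .
    qed
    have "T (\<lambda>d k. real d \<le> V) = (\<Sum>d\<in>{1..N}. if real d \<le> V then (\<Sum>k\<in>{1..N}. \<Sum>m\<in>{1..N}. G d k m) else 0)"
      unfolding T_def by (intro sum.cong refl) simp
    also have "\<dots> = (\<Sum>d | d \<in> {1..N} \<and> real d \<le> V. \<Sum>k\<in>{1..N}. \<Sum>m\<in>{1..N}. G d k m)"
      by (simp only: sum_if_filter)
    also have "\<dots> = (\<Sum>d | d \<in> {1..N} \<and> real d \<le> V. of_real (moebius_mu d) * (\<Sum>j | j \<in> {1..N} \<and> d * j \<le> N. of_real (ln (real j)) * f (d * j)))"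
      by (intro sum.cong refl *) auto
    finally show ?thesis .
  qed
  have 3: "T (\<lambda>d k. real d \<le> V \<and> real k \<le> V) = (\<Sum>d | d \<in> {1..N} \<and> real d \<le> V. \<Sum>k | k \<in> {1..N} \<and> real k \<le> V.
        of_real (moebius_mu d) * mangoldt k * (\<Sum>m | m \<in> {1..N} \<and> d * k * m \<le> N. f (d * k * m)))"
  proof -
    have *: "(\<Sum>m\<in>{1..N}. G d k m) = of_real (moebius_mu d) * mangoldt k * (\<Sum>m | m \<in> {1..N} \<and> d * k * m \<le> N. f (d * k * m))" for d k
      unfolding G_def sum_if_filter by (simp only: sum_distrib_left)
    have "T (\<lambda>d k. real d \<le> V \<and> real k \<le> V) =
      (\<Sum>d\<in>{1..N}. if real d \<le> V then (\<Sum>k\<in>{1..N}. if real k \<le> V then \<Sum>m\<in>{1..N}. G d k m else 0) else 0)"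
      unfolding T_def by (intro sum.cong refl) (auto intro!: sum.cong)
    then show ?thesis by (simp only: sum_if_filter *)
  qed
  \<comment> \<open>Here \<open>d * m = j\<close> is grouped under the condition
    \<open>d > V\<close>, which produces \<open>vaughan_coeff V j\<close>.\<close>
  have 4: "T (\<lambda>d k. real k > V \<and> real d > V) = (\<Sum>m | m \<in> {1..N} \<and> real m > V. \<Sum>k | k \<in> {1..N} \<and> real k > V \<and> m * k \<le> N.
        of_real (vaughan_coeff V m) * mangoldt k * f (m * k))"
  proof -
    have "T (\<lambda>d k. real k > V \<and> real d > V) = (\<Sum>k\<in>{1..N}. \<Sum>d\<in>{1..N}. \<Sum>m\<in>{1..N}. if real k > V \<and> real d > V then G d k m else 0)"
      unfolding T_def by (rule sum.swap)
    also have "\<dots> = (\<Sum>k\<in>{1..N}. \<Sum>j\<in>{1..N}. if real j > V \<and> real k > V \<and> j * k \<le> N then of_real (vaughan_coeff V j) * mangoldt k * f (j * k) else 0)"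
    proof (rule sum.cong[OF refl])
      fix k assume k: "k \<in> {1..N}"
      have "(\<Sum>d\<in>{1..N}. \<Sum>m\<in>{1..N}. if real k > V \<and> real d > V then G d k m else 0) =
         (\<Sum>d\<in>{1..N}. \<Sum>m\<in>{1..N}. if d * m \<le> N then (if real k > V \<and> real d > V \<and> (d * m) * k \<le> N then of_real (moebius_mu d) * mangoldt k * f ((d * m) * k) else 0) else 0)"
      proof (intro sum.cong refl)
        fix d m assume "d \<in> {1..N}" "m \<in> {1..N}"
        have "d * m \<le> N" if "d * m * k \<le> N" using that k mult_le_imp_le[of "d * m" k N] by (simp add: mult_ac)
        then show "(if real k > V \<and> real d > V then G d k m else 0) = (if d * m \<le> N then (if real k > V \<and> real d > V \<and> (d * m) * k \<le> N then of_real (moebius_mu d) * mangoldt k * f ((d * m) * k) else 0) else 0)"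
          by (auto simp: G_def mult_ac)
      qed
      also have "\<dots> = (\<Sum>j\<in>{1..N}. \<Sum>d | d dvd j. if real k > V \<and> real d > V \<and> j * k \<le> N then of_real (moebius_mu d) * mangoldt k * f (j * k) else 0)"
        by (rule sum_hyperbola)
      also have "\<dots> = (\<Sum>j\<in>{1..N}. if real j > V \<and> real k > V \<and> j * k \<le> N then of_real (vaughan_coeff V j) * mangoldt k * f (j * k) else 0)"
      proof (intro sum.cong refl)
        fix j assume j: "j \<in> {1..N}"
        have fin: "finite {d. d dvd j}" using j by simp
        have eq: "(\<Sum>d | d dvd j. if real k > V \<and> real d > V \<and> j * k \<le> N then of_real (moebius_mu d) * mangoldt k * f (j * k) else 0)
          = (if real k > V \<and> j * k \<le> N then of_real (vaughan_coeff V j) * mangoldt k * f (j * k) else 0)"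
        proof -
          have "(\<Sum>d | d dvd j. if real d > V then of_real (moebius_mu d) * mangoldt k * f (j * k) else 0) = of_real (vaughan_coeff V j) * mangoldt k * f (j * k)"
            unfolding vaughan_coeff_def of_real_sum sum_distrib_right
            using sum.inter_filter[OF fin, of "\<lambda>d. of_real (moebius_mu d) * mangoldt k * f (j * k)" "\<lambda>d. real d > V"]
            by simp
          then show ?thesis by auto
        qed
        \<comment> \<open>A divisor \<open>d > V\<close> of \<open>j\<close> forces
          \<open>j > V\<close>, so the condition \<open>j > V\<close> may be added for free.\<close>
        have "vaughan_coeff V j = 0" if "real j \<le> V"
        proof -
          have "{d. d dvd j \<and> real d > V} = {}" using that j dvd_imp_le[of _ j] by force
          then show ?thesis unfolding vaughan_coeff_def by (simp only: sum.empty)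
        qed
        then show "(\<Sum>d | d dvd j. if real k > V \<and> real d > V \<and> j * k \<le> N then of_real (moebius_mu d) * mangoldt k * f (j * k) else 0)
          = (if real j > V \<and> real k > V \<and> j * k \<le> N then of_real (vaughan_coeff V j) * mangoldt k * f (j * k) else 0)"
          unfolding eq by (cases "real j > V") auto
      qed
      finally show "(\<Sum>d\<in>{1..N}. \<Sum>m\<in>{1..N}. if real k > V \<and> real d > V then G d k m else 0) =
        (\<Sum>j\<in>{1..N}. if real j > V \<and> real k > V \<and> j * k \<le> N then of_real (vaughan_coeff V j) * mangoldt k * f (j * k) else 0)" .
    qed
    also have "\<dots> = (\<Sum>j\<in>{1..N}. \<Sum>k\<in>{1..N}. if real j > V \<and> real k > V \<and> j * k \<le> N then of_real (vaughan_coeff V j) * mangoldt k * f (j * k) else 0)"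
      by (rule sum.swap)
    also have "\<dots> = (\<Sum>j\<in>{1..N}. if real j > V then (\<Sum>k\<in>{1..N}. if real k > V \<and> j * k \<le> N then of_real (vaughan_coeff V j) * mangoldt k * f (j * k) else 0) else 0)"
      by (intro sum.cong refl) (auto intro!: sum.cong)
    finally show ?thesis by (simp only: sum_if_filter)
  qed
  have eq: "{1..N} = {n. n \<in> {1..N} \<and> real n \<le> V} \<union> {n. n \<in> {1..N} \<and> real n > V}" by auto
  have "(\<Sum>n\<in>{1..N}. mangoldt n * f n) = (\<Sum>n | n \<in> {1..N} \<and> real n \<le> V. mangoldt n * f n) + (\<Sum>n | n \<in> {1..N} \<and> real n > V. mangoldt n * f n)"
    by (subst eq, rule sum.union_disjoint) auto
  then show ?thesis using split unfolding 1 2 3 4 by simp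
qed

lemma abs_vaughan_coeff_le: "m \<ge> 1 \<Longrightarrow> \<bar>vaughan_coeff V m\<bar> \<le> real (num_divisors m)"
proof -
  assume m: "m \<ge> 1"
  have "\<bar>vaughan_coeff V m\<bar> \<le> (\<Sum>d | d dvd m \<and> real d > V. 1)"
    unfolding vaughan_coeff_def by (rule order.trans[OF sum_abs]) (intro sum_mono abs_moebius_mu_le)
  also have "\<dots> \<le> (\<Sum>d | d dvd m. 1)" using m by (intro sum_mono2) auto
  finally show ?thesis by (simp add: num_divisors_def)
qed

section \<open>The bilinear form estimate\<close>

text \<open>A factorisation \<open>h * k = r\<close> is determined by the divisor \<open>k\<close>
  of \<open>r\<close>, so \<open>r\<close> receives at most \<open>divsum \<beta> r\<close>.
  Enlarging both ranges to \<open>H * K\<close> adds only nonnegative terms.\<close>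

lemma sum_group_products:
  fixes \<beta> \<phi> :: "nat \<Rightarrow> real"
  assumes "\<And>k. \<beta> k \<ge> 0" "\<And>r. \<phi> r \<ge> 0"
  shows "(\<Sum>h\<in>{1..H}. \<Sum>k\<in>{1..K}. \<beta> k * \<phi> (h * k)) \<le> (\<Sum>r\<in>{1..H*K}. divsum \<beta> r * \<phi> r)"
proof -
  have "(\<Sum>h\<in>{1..H}. \<Sum>k\<in>{1..K}. \<beta> k * \<phi> (h * k)) = (\<Sum>k\<in>{1..K}. \<Sum>h\<in>{1..H}. if k * h \<le> H * K then \<beta> k * \<phi> (k * h) else 0)"
    by (subst sum.swap, intro sum.cong refl) (auto simp: mult.commute intro!: mult_le_mono)
  also have "\<dots> \<le> (\<Sum>k\<in>{1..H*K}. \<Sum>h\<in>{1..H}. if k * h \<le> H * K then \<beta> k * \<phi> (k * h) else 0)"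
  proof (cases "H = 0")
    case False
    then have "K \<le> H * K" by simp
    then show ?thesis using assms by (intro sum_mono2) (auto intro!: sum_nonneg)
  qed simp
  also have "\<dots> \<le> (\<Sum>k\<in>{1..H*K}. \<Sum>h\<in>{1..H*K}. if k * h \<le> H * K then \<beta> k * \<phi> (k * h) else 0)"
  proof (cases "K = 0")
    case False
    then have "H \<le> H * K" by simp
    then show ?thesis using assms by (intro sum_mono sum_mono2) auto
  qed simp
  also have "\<dots> = (\<Sum>j\<in>{1..H*K}. \<Sum>k | k dvd j. \<beta> k * \<phi> j)"
    by (rule sum_hyperbola)
  finally show ?thesis by (simp add: sum_distrib_right)
qed

context rational_approx
begin

text \<open>\<open>2 * c r * c r' \<le> c r ^ 2 + c r' ^ 2\<close> reduces the form to row and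
  column sums, each of which runs over \<open>R\<close> consecutive differences.\<close>

lemma quadratic_form_le:
  fixes c :: "nat \<Rightarrow> real"
  assumes X: "X \<ge> 0"
  shows "(\<Sum>r\<in>{1..R}. \<Sum>r'\<in>{1..R}. c r * (c r' * geo_bound X (\<alpha> * of_int (int r - int r'))))
     \<le> (\<Sum>r\<in>{1..R}. c r ^ 2) * ((real R / of_int q + 1) * (6 * X + 2 * of_int q * hq))"
    (is "_ \<le> _ * ?B")
proof -
  let ?F = "\<lambda>r r'. geo_bound X (\<alpha> * of_int (int r - int r'))"
  have F0: "?F r r' \<ge> 0" for r r' by (rule geo_bound_nonneg[OF X])
  have row: "(\<Sum>r'\<in>{1..R}. ?F r r') \<le> ?B" for r
  proof -
    have "(\<Sum>r'\<in>{1..R}. ?F r r') = (\<Sum>s\<in>{int r - 1 - int R<..(int r - 1 - int R) + int R}. geo_bound X (\<alpha> * of_int s))"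
      by (rule sum.reindex_bij_witness[of _ "\<lambda>s. nat (int r - s)" "\<lambda>r'. int r - int r'"]) auto
    also have "\<dots> \<le> ?B" by (rule interval_sum[OF X])
    finally show ?thesis .
  qed
  have col: "(\<Sum>r\<in>{1..R}. ?F r r') \<le> ?B" for r'
  proof -
    have "(\<Sum>r\<in>{1..R}. ?F r r') = (\<Sum>s\<in>{- int r'<..- int r' + int R}. geo_bound X (\<alpha> * of_int s))"
      by (rule sum.reindex_bij_witness[of _ "\<lambda>s. nat (int r' + s)" "\<lambda>r. int r - int r'"]) auto
    also have "\<dots> \<le> ?B" by (rule interval_sum[OF X])
    finally show ?thesis .
  qed
  have "(\<Sum>r\<in>{1..R}. \<Sum>r'\<in>{1..R}. c r * (c r' * ?F r r'))
    \<le> (\<Sum>r\<in>{1..R}. \<Sum>r'\<in>{1..R}. c r ^ 2 / 2 * ?F r r' + c r' ^ 2 / 2 * ?F r r')"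
  proof (intro sum_mono)
    fix r r'
    have "c r * c r' \<le> c r ^ 2 / 2 + c r' ^ 2 / 2"
      using sum_squares_bound[of "c r" "c r'"] by simp
    from mult_right_mono[OF this F0] show "c r * (c r' * ?F r r') \<le> c r ^ 2 / 2 * ?F r r' + c r' ^ 2 / 2 * ?F r r'"
      by (simp add: distrib_right mult.assoc)
  qed
  also have "\<dots> = (\<Sum>r\<in>{1..R}. c r ^ 2 / 2 * (\<Sum>r'\<in>{1..R}. ?F r r')) + (\<Sum>r'\<in>{1..R}. c r' ^ 2 / 2 * (\<Sum>r\<in>{1..R}. ?F r r'))"
    unfolding sum.distrib sum_distrib_left by (intro arg_cong2[of _ _ _ _ "(+)"] refl sum.swap)
  also have "\<dots> \<le> (\<Sum>r\<in>{1..R}. c r ^ 2 / 2 * ?B) + (\<Sum>r'\<in>{1..R}. c r' ^ 2 / 2 * ?B)"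
    by (intro add_mono sum_mono mult_left_mono row col) auto
  also have "\<dots> = (\<Sum>r\<in>{1..R}. c r ^ 2) * ?B"
    by (simp add: sum_distrib_right[symmetric] sum_divide_distrib[symmetric])
  finally show ?thesis .
qed

text \<open>
  The sum over \<open>h\<close> is kept inside the square when Cauchy's inequality is applied to the sum
  over \<open>m\<close>, and the products \<open>h * k\<close> are merged into one variable.
\<close>

lemma bilinear_bound:
  fixes a' b' :: "nat \<Rightarrow> complex" and M1 M2 H K N :: nat
  defines "X \<equiv> real (M2 - M1)"
  shows "(\<Sum>h\<in>{1..H}. norm (\<Sum>m\<in>{M1<..M2}. \<Sum>k | k \<in> {1..K} \<and> m * k \<le> N. a' m * b' k * ee (\<alpha> * real (h * m * k))))
    \<le> sqrt ((\<Sum>m\<in>{M1<..M2}. norm (a' m) ^ 2) * ((\<Sum>r\<in>{1..H*K}. divsum (\<lambda>k. norm (b' k)) r ^ 2)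
        * ((real (H*K) / of_int q + 1) * (6 * X + 2 * of_int q * hq))))"
proof -
  define z where "z h = (\<Sum>m\<in>{M1<..M2}. \<Sum>k\<in>{1..K}. if m * k \<le> N then a' m * b' k * ee (\<alpha> * real (h * m * k)) else 0)" for h
  \<comment> \<open>Phases that turn the sum of norms into a linear form. \<open>sgn 0 = 0\<close>,
    so their modulus is at most 1 rather than equal to 1.\<close>
  define \<theta> where "\<theta> h = cnj (sgn (z h))" for h
  define W where "W m = (\<Sum>(h,k)\<in>{1..H}\<times>{1..K}. if m * k \<le> N then \<theta> h * b' k * ee (\<alpha> * real (h * m * k)) else 0)" for m
  have X0: "X \<ge> 0" by (simp add: X_def)
  have th: "norm (\<theta> h) \<le> 1" for h by (simp add: \<theta>_def norm_sgn)
  have thz: "of_real (norm (z h)) = \<theta> h * z h" for h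
    by (cases "z h = 0") (simp_all add: \<theta>_def sgn_eq complex_norm_square[symmetric] power2_eq_square mult.commute[of "cnj _"])
  have "of_real (\<Sum>h\<in>{1..H}. norm (z h)) = (\<Sum>h\<in>{1..H}. \<theta> h * z h)"
    by (simp add: thz)
  also have "\<dots> = (\<Sum>h\<in>{1..H}. \<Sum>m\<in>{M1<..M2}. \<Sum>k\<in>{1..K}. a' m * (if m * k \<le> N then \<theta> h * b' k * ee (\<alpha> * real (h * m * k)) else 0))"
    unfolding z_def sum_distrib_left by (intro sum.cong refl) auto
  also have "\<dots> = (\<Sum>m\<in>{M1<..M2}. a' m * W m)"
    unfolding W_def sum_distrib_left sum.cartesian_product[symmetric] by (rule sum.swap)
  finally have eq: "of_real (\<Sum>h\<in>{1..H}. norm (z h)) = (\<Sum>m\<in>{M1<..M2}. a' m * W m)" .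
  have "(\<Sum>h\<in>{1..H}. norm (z h)) = norm (complex_of_real (\<Sum>h\<in>{1..H}. norm (z h)))"
    by (simp only: norm_of_real abs_of_nonneg sum_nonneg norm_ge_zero)
  also have "\<dots> \<le> (\<Sum>m\<in>{M1<..M2}. norm (a' m) * norm (W m))"
    unfolding eq by (rule order.trans[OF norm_sum]) (simp add: norm_mult)
  finally have S: "(\<Sum>h\<in>{1..H}. norm (z h)) \<le> (\<Sum>m\<in>{M1<..M2}. norm (a' m) * norm (W m))" .
  have "(\<Sum>m\<in>{M1<..M2}. norm (W m) ^ 2) \<le> (\<Sum>r\<in>{1..H*K}. divsum (\<lambda>k. norm (b' k)) r ^ 2)
        * ((real (H*K) / of_int q + 1) * (6 * X + 2 * of_int q * hq))" (is "_ \<le> ?R")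
  proof -
    let ?P = "{1..H} \<times> {1..K}"
    let ?c = "\<lambda>h k. \<theta> h * b' k"
    define E where "E h k h' k' = (\<Sum>m | m \<in> {M1<..M2} \<and> m * k \<le> N \<and> m * k' \<le> N.
       ee (\<alpha> * of_int (int (h * k) - int (h' * k')) * real m))" for h k h' k'
    have E: "norm (E h k h' k') \<le> geo_bound X (\<alpha> * of_int (int (h * k) - int (h' * k')))" if "k \<ge> 1" "k' \<ge> 1" for h k h' k'
    proof -
      \<comment> \<open>The two cut-offs \<open>m * k \<le> N\<close> and
        \<open>m * k' \<le> N\<close> only shorten the interval, so the sum over \<open>m\<close>
        stays geometric.\<close>
      have "{m. m \<in> {M1<..M2} \<and> m * k \<le> N \<and> m * k' \<le> N} = {M1<..min M2 (min (N div k) (N div k'))}"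
        using that by (auto simp: less_eq_div_iff_mult_less_eq)
      then have "norm (E h k h' k') \<le> geo_bound (real (min M2 (min (N div k) (N div k')) - M1)) (\<alpha> * of_int (int (h * k) - int (h' * k')))"
        unfolding E_def by (simp only: norm_sum_ee)
      also have "\<dots> \<le> geo_bound X (\<alpha> * of_int (int (h * k) - int (h' * k')))"
        unfolding X_def by (intro geo_bound_mono) auto
      finally show ?thesis .
    qed
    have "complex_of_real (\<Sum>m\<in>{M1<..M2}. norm (W m) ^ 2) = (\<Sum>m\<in>{M1<..M2}. W m * cnj (W m))"
      by (simp only: complex_norm_square of_real_sum)
    also have "\<dots> = (\<Sum>m\<in>{M1<..M2}. \<Sum>p\<in>?P. \<Sum>p'\<in>?P.
        if m * snd p \<le> N \<and> m * snd p' \<le> N then ?c (fst p) (snd p) * cnj (?c (fst p') (snd p')) *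
          ee (\<alpha> * of_int (int (fst p * snd p) - int (fst p' * snd p')) * real m) else 0)"
    proof (intro sum.cong refl)
      fix m
      have ee: "ee (\<alpha> * real (h * m * k)) * cnj (ee (\<alpha> * real (h' * m * k'))) = ee (\<alpha> * of_int (int (h * k) - int (h' * k')) * real m)" for h k h' k'
        by (simp add: ee_minus[symmetric] ee_add[symmetric] algebra_simps)
      have "W m * cnj (W m) = (\<Sum>p\<in>?P. \<Sum>p'\<in>?P. (if m * snd p \<le> N then ?c (fst p) (snd p) * ee (\<alpha> * real (fst p * m * snd p)) else 0) *
        cnj (if m * snd p' \<le> N then ?c (fst p') (snd p') * ee (\<alpha> * real (fst p' * m * snd p')) else 0))"
        unfolding W_def cnj_sum sum_product by (simp add: case_prod_unfold)
      also have "\<dots> = (\<Sum>p\<in>?P. \<Sum>p'\<in>?P.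
        if m * snd p \<le> N \<and> m * snd p' \<le> N then ?c (fst p) (snd p) * cnj (?c (fst p') (snd p')) *
          ee (\<alpha> * of_int (int (fst p * snd p) - int (fst p' * snd p')) * real m) else 0)"
        unfolding ee[symmetric] by (intro sum.cong refl) auto
      finally show "W m * cnj (W m) = \<dots>" .
    qed
    also have "\<dots> = (\<Sum>p\<in>?P. \<Sum>p'\<in>?P. \<Sum>m\<in>{M1<..M2}.
        if m * snd p \<le> N \<and> m * snd p' \<le> N then ?c (fst p) (snd p) * cnj (?c (fst p') (snd p')) *
          ee (\<alpha> * of_int (int (fst p * snd p) - int (fst p' * snd p')) * real m) else 0)"
      by (subst sum.swap) (intro sum.cong refl sum.swap)
    also have "\<dots> = (\<Sum>p\<in>?P. \<Sum>p'\<in>?P. ?c (fst p) (snd p) * cnj (?c (fst p') (snd p')) * E (fst p) (snd p) (fst p') (snd p'))"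
      unfolding E_def sum_distrib_left sum.inter_filter[OF finite_greaterThanAtMost]
      by (intro sum.cong refl) auto
    finally have eqW: "complex_of_real (\<Sum>m\<in>{M1<..M2}. norm (W m) ^ 2) =
      (\<Sum>p\<in>?P. \<Sum>p'\<in>?P. ?c (fst p) (snd p) * cnj (?c (fst p') (snd p')) * E (fst p) (snd p) (fst p') (snd p'))" .
    have "(\<Sum>m\<in>{M1<..M2}. norm (W m) ^ 2) = norm (complex_of_real (\<Sum>m\<in>{M1<..M2}. norm (W m) ^ 2))"
      by (simp only: norm_of_real abs_of_nonneg sum_nonneg zero_le_power2)
    also have "\<dots> \<le> (\<Sum>p\<in>?P. \<Sum>p'\<in>?P. norm (b' (snd p)) * (norm (b' (snd p')) * 
        geo_bound X (\<alpha> * of_int (int (fst p * snd p) - int (fst p' * snd p')))))"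
      unfolding eqW
    proof (intro order.trans[OF norm_sum] sum_mono)
      fix p p' assume p: "p \<in> ?P" "p' \<in> ?P"
      have c: "norm (?c h k) \<le> norm (b' k)" for h k
        using mult_right_mono[OF th, of "norm (b' k)" h] by (simp add: norm_mult)
      have "norm (?c (fst p) (snd p) * cnj (?c (fst p') (snd p')) * E (fst p) (snd p) (fst p') (snd p')) =
        norm (?c (fst p) (snd p)) * (norm (?c (fst p') (snd p')) * norm (E (fst p) (snd p) (fst p') (snd p')))"
        by (simp add: norm_mult)
      also have "\<dots> \<le> norm (b' (snd p)) * (norm (b' (snd p')) * geo_bound X (\<alpha> * of_int (int (fst p * snd p) - int (fst p' * snd p'))))"
        using p by (intro mult_mono c E mult_nonneg_nonneg) auto
      finally show "norm (?c (fst p) (snd p) * cnj (?c (fst p') (snd p')) * E (fst p) (snd p) (fst p') (snd p')) \<le> \<dots>" .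
    qed
    also have "\<dots> = (\<Sum>(h,k)\<in>?P. norm (b' k) * (\<Sum>(h',k')\<in>?P. norm (b' k') *
        geo_bound X (\<alpha> * of_int (int (h * k) - int (h' * k')))))"
      by (simp only: case_prod_unfold sum_distrib_left)
    also have "\<dots> = (\<Sum>h\<in>{1..H}. \<Sum>k\<in>{1..K}. norm (b' k) * (\<Sum>h'\<in>{1..H}. \<Sum>k'\<in>{1..K}. norm (b' k') *
        geo_bound X (\<alpha> * of_int (int (h * k) - int (h' * k')))))"
      by (simp only: sum.cartesian_product)
    \<comment> \<open>The pair \<open>(h', k')\<close> is merged into \<open>r'\<close> first, then
      \<open>(h, k)\<close> into \<open>r\<close>; both steps need the nonnegativity of
      \<open>geo_bound\<close>.\<close>
    also have "\<dots> \<le> (\<Sum>h\<in>{1..H}. \<Sum>k\<in>{1..K}. norm (b' k) * (\<Sum>r'\<in>{1..H*K}. divsum (\<lambda>k. norm (b' k)) r' *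
        geo_bound X (\<alpha> * of_int (int (h * k) - int r'))))"
      by (intro sum_mono mult_left_mono sum_group_products geo_bound_nonneg X0) auto
    also have "\<dots> \<le> (\<Sum>r\<in>{1..H*K}. divsum (\<lambda>k. norm (b' k)) r * (\<Sum>r'\<in>{1..H*K}. divsum (\<lambda>k. norm (b' k)) r' *
        geo_bound X (\<alpha> * of_int (int r - int r'))))"
      by (rule sum_group_products) (auto intro!: sum_nonneg mult_nonneg_nonneg geo_bound_nonneg X0)
    also have "\<dots> = (\<Sum>r\<in>{1..H*K}. \<Sum>r'\<in>{1..H*K}. divsum (\<lambda>k. norm (b' k)) r * (divsum (\<lambda>k. norm (b' k)) r' *
        geo_bound X (\<alpha> * of_int (int r - int r'))))"
      by (simp only: sum_distrib_left)
    also have "\<dots> \<le> ?R" by (rule quadratic_form_le[OF X0])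
    finally show ?thesis .
  qed
  then have "(\<Sum>m\<in>{M1<..M2}. norm (a' m) ^ 2) * (\<Sum>m\<in>{M1<..M2}. norm (W m) ^ 2) \<le> (\<Sum>m\<in>{M1<..M2}. norm (a' m) ^ 2) * ?R"
    by (intro mult_left_mono sum_nonneg) auto
  with Cauchy_Schwarz_ineq_sum[of "\<lambda>m. norm (a' m)" "\<lambda>m. norm (W m)" "{M1<..M2}"]
  have "(\<Sum>m\<in>{M1<..M2}. norm (a' m) * norm (W m))\<^sup>2 \<le> (\<Sum>m\<in>{M1<..M2}. norm (a' m) ^ 2) * ?R"
    by linarith
  then have "(\<Sum>m\<in>{M1<..M2}. norm (a' m) * norm (W m)) \<le> sqrt ((\<Sum>m\<in>{M1<..M2}. norm (a' m) ^ 2) * ?R)"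
    by (rule real_le_rsqrt)
  moreover have "(\<Sum>k | k \<in> {1..K} \<and> m * k \<le> N. a' m * b' k * ee (\<alpha> * real (h * m * k))) =
     (\<Sum>k\<in>{1..K}. if m * k \<le> N then a' m * b' k * ee (\<alpha> * real (h * m * k)) else 0)" for m h
    by (rule sum_if_filter[symmetric])
  ultimately show ?thesis using S unfolding z_def by simp
qed

end

section \<open>Fejer majorants and minorants\<close>

definition fejer :: "nat \<Rightarrow> real \<Rightarrow> real"
  where "fejer Q x = 1 + (\<Sum>h\<in>{1..<Q}. 2 * (1 - real h / real Q) * cos (2 * pi * real h * x))"

definition fejer_int :: "nat \<Rightarrow> real \<Rightarrow> real"
  where "fejer_int Q x = x + (\<Sum>h\<in>{1..<Q}. (1 - real h / real Q) * (sin (2 * pi * real h * x) / (pi * real h)))"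

lemma fejer_int_deriv: "(fejer_int Q has_real_derivative fejer Q x) (at x)"
proof -
  have "((\<lambda>x. (1 - real h / real Q) * (sin (2 * pi * real h * x) / (pi * real h))) has_real_derivative
      2 * (1 - real h / real Q) * cos (2 * pi * real h * x)) (at x)" if "h \<in> {1..<Q}" for h
  proof -
    have "((\<lambda>x. sin (2 * pi * real h * x) / (pi * real h)) has_real_derivative 2 * cos (2 * pi * real h * x)) (at x)"
      using that by (auto intro!: derivative_eq_intros)
    from DERIV_cmult[OF this, of "1 - real h / real Q"] show ?thesis by (simp only: mult_ac)
  qed
  then show ?thesis unfolding fejer_int_def[abs_def] fejer_def
    by (intro DERIV_add DERIV_ident DERIV_sum)
qed

text \<open>Induction on \<open>Q\<close>: the new term \<open>w\<close> adds 1 and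
  \<open>2 * Re (w * cnj s)\<close>, which raises the coefficient of each cosine of frequency 1 to
  \<open>Q\<close> by 2.\<close>

lemma norm_sum_ee_sq:
  "norm (\<Sum>j\<in>{0<..Q}. ee (x * real j)) ^ 2 = real Q + (\<Sum>h\<in>{1..<Q}. 2 * (real Q - real h) * cos (2 * pi * real h * x))"
proof (induction Q)
  case (Suc Q)
  define s where "s = (\<Sum>j\<in>{0<..Q}. ee (x * real j))"
  define w where "w = ee (x * real (Suc Q))"
  have "(\<Sum>j\<in>{0<..Suc Q}. ee (x * real j)) = s + w"
  proof -
    have "{0<..Suc Q} = insert (Suc Q) {0<..Q}" by auto
    then show ?thesis by (simp add: s_def w_def)
  qed
  moreover have "norm (s + w) ^ 2 = norm s ^ 2 + 1 + 2 * Re (w * cnj s)"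
  proof -
    have "norm w = 1" by (simp add: w_def)
    then have "Re w ^ 2 + Im w ^ 2 = 1" by (simp add: cmod_def)
    then show ?thesis unfolding cmod_power2 by (simp add: power2_eq_square algebra_simps)
  qed
  moreover have "Re (w * cnj s) = (\<Sum>h\<in>{1..<Suc Q}. cos (2 * pi * real h * x))"
  proof -
    have "w * cnj s = (\<Sum>j\<in>{0<..Q}. ee (x * real (Suc Q - j)))"
      unfolding s_def w_def cnj_sum sum_distrib_left
      by (intro sum.cong refl) (simp add: ee_minus[symmetric] ee_add[symmetric] of_nat_diff algebra_simps)
    also have "\<dots> = (\<Sum>h\<in>{1..<Suc Q}. ee (x * real h))"
      by (rule sum.reindex_bij_witness[of _ "\<lambda>h. Suc Q - h" "\<lambda>j. Suc Q - j"]) auto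
    finally show ?thesis by (simp add: ee_def mult_ac)
  qed
  moreover have "(\<Sum>h\<in>{1..<Suc Q}. 2 * (real (Suc Q) - real h) * cos (2 * pi * real h * x))
     = (\<Sum>h\<in>{1..<Q}. 2 * (real Q - real h) * cos (2 * pi * real h * x)) + 2 * (\<Sum>h\<in>{1..<Suc Q}. cos (2 * pi * real h * x))"
  proof -
    have "(\<Sum>h\<in>{1..<Q}. 2 * (real Q - real h) * cos (2 * pi * real h * x)) = (\<Sum>h\<in>{1..<Suc Q}. 2 * (real Q - real h) * cos (2 * pi * real h * x))"
      by (rule sum.mono_neutral_left) auto
    then show ?thesis by (simp only: sum_distrib_left sum.distrib[symmetric]) (simp add: algebra_simps)
  qed
  ultimately show ?case using Suc.IH unfolding s_def[symmetric] by simp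
qed simp

lemma fejer_eq: 
  assumes "Q \<ge> 1"
  shows "fejer Q x = norm (\<Sum>j\<in>{0<..Q}. ee (x * real j)) ^ 2 / real Q"
  unfolding norm_sum_ee_sq fejer_def add_divide_distrib sum_divide_distrib
  using assms by (simp add: diff_divide_distrib right_diff_distrib left_diff_distrib cong: sum.cong)

lemma fejer_nonneg: "Q \<ge> 1 \<Longrightarrow> fejer Q x \<ge> 0"
  by (simp add: fejer_eq)

text \<open>The bound for the geometric sum, squared; on (0, 1/2] the number \<open>x\<close> is its
  own distance to the integers.\<close>

lemma fejer_le:
  assumes "Q \<ge> 1" "0 < x" "x \<le> 1/2"
  shows "fejer Q x \<le> 1 / (real Q * x ^ 2)"
proof -
  have "x \<le> int_dist x"
  proof (cases "x < 1/2")
    case True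
    then have "round x = 0" using assms by (simp add: round_def floor_eq_iff)
    then show ?thesis by (simp add: int_dist_def)
  next
    case False
    then have "x = 1/2" using assms by simp
    \<comment> \<open>\<open>round (1/2)\<close> is 1, so the endpoint needs its own
      computation.\<close>
    moreover have "int_dist (1/2) = 1/2" by (simp add: int_dist_def round_def)
    ultimately show ?thesis by (simp only: order.refl)
  qed
  then have "norm (\<Sum>j\<in>{0<..Q}. ee (x * real j)) \<le> 1 / x"
    using norm_sum_ee[where \<theta> = x, of 0 Q] geo_bound_le_inverse[of x "real (Q - 0)"] assms
      frac_le[of 1 1 x "int_dist x"] by linarith
  then have "norm (\<Sum>j\<in>{0<..Q}. ee (x * real j)) ^ 2 \<le> (1 / x) ^ 2" by (intro power_mono) auto
  then show ?thesis using assms by (simp add: fejer_eq divide_simps mult_ac)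
qed

lemma fejer_int_mono:
  assumes "Q \<ge> 1" "x \<le> y" shows "fejer_int Q x \<le> fejer_int Q y"
  using assms(2) by (rule DERIV_nonneg_imp_nondecreasing) (use fejer_int_deriv fejer_nonneg[OF assms(1)] in blast)

lemma fejer_int_minus: "fejer_int Q (- x) = - fejer_int Q x"
  by (simp add: fejer_int_def sum_negf)

lemma fejer_int_add_1: "fejer_int Q (x + 1) = fejer_int Q x + 1"
proof -
  have "sin (2 * pi * real h * (x + 1)) = sin (2 * pi * real h * x)" for h
    using sin.plus_of_nat[of "2*pi*real h*x" h] by (simp add: algebra_simps)
  then show ?thesis by (simp add: fejer_int_def)
qed

lemma fejer_int_half: "fejer_int Q (1/2) = 1/2"
  using fejer_int_add_1[of Q "-1/2"] fejer_int_minus[of Q "1/2"] by simp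

text \<open>\<open>fejer_le\<close> makes \<open>fejer_int Q t + 1 / (Q * t)\<close> nonincreasing
  on (0, 1/2], and at 1/2 its value exceeds 1/2. Beyond 1/2 monotonicity is enough.\<close>

lemma fejer_int_ge:
  assumes Q: "Q \<ge> 1" and x: "0 < \<eta>" "\<eta> \<le> x"
  shows "fejer_int Q x \<ge> 1/2 - 1 / (real Q * \<eta>)"
proof -
  have *: "fejer_int Q y \<ge> 1/2 - 1 / (real Q * y)" if "0 < y" "y \<le> 1/2" for y
  proof -
    have "fejer_int Q (1/2) + 1 / (real Q * (1/2)) \<le> fejer_int Q y + 1 / (real Q * y)"
    proof (rule DERIV_nonpos_imp_nonincreasing[OF that(2)])
      fix t assume t: "y \<le> t" "t \<le> 1/2"
      have "((\<lambda>t. fejer_int Q t + 1 / (real Q * t)) has_real_derivative fejer Q t + (- (1 / (real Q * t ^ 2)))) (at t)"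
      proof (rule DERIV_add[OF fejer_int_deriv])
        show "((\<lambda>t. 1 / (real Q * t)) has_real_derivative - (1 / (real Q * t ^ 2))) (at t)"
          using t that Q
          by (auto intro!: derivative_eq_intros simp: power2_eq_square divide_simps)
      qed
      moreover have "fejer Q t + (- (1 / (real Q * t ^ 2))) \<le> 0"
        using fejer_le[OF Q, of t] t that by simp
      ultimately show "\<exists>D. ((\<lambda>t. fejer_int Q t + 1 / (real Q * t)) has_real_derivative D) (at t) \<and> D \<le> 0" by blast
    qed
    moreover have "0 \<le> 1 / (real Q * (1/2))" by simp
    ultimately show ?thesis unfolding fejer_int_half by linarith
  qed
  show ?thesis
  proof (cases "x \<le> 1/2")
    case True
    have "1 / (real Q * x) \<le> 1 / (real Q * \<eta>)" using Q x by (intro divide_left_mono mult_left_mono) auto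
    then show ?thesis using *[of x] True x by linarith
  next
    case False
    have "1/2 \<le> fejer_int Q x" using fejer_int_mono[OF Q, of "1/2" x] False by (simp add: fejer_int_half)
    moreover have "0 \<le> 1 / (real Q * \<eta>)" using x by simp
    ultimately show ?thesis by linarith
  qed
qed

text \<open>The convolution of the kernel with the indicator of the interval from
  \<open>- \<delta>\<close> to \<open>\<delta>\<close>, evaluated through the primitive
  \<open>fejer_int\<close>.\<close>

definition smooth_chi :: "nat \<Rightarrow> real \<Rightarrow> real \<Rightarrow> real"
  where "smooth_chi Q \<delta> x = fejer_int Q (x + \<delta>) - fejer_int Q (x - \<delta>)"

lemma smooth_chi_add_int: "smooth_chi Q \<delta> (x + of_int n) = smooth_chi Q \<delta> x"
proof -
  have nat: "fejer_int Q (y + real k) = fejer_int Q y + real k" for y k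
  proof (induction k)
    case (Suc k)
    then show ?case using fejer_int_add_1[of Q "y + real k"] by (simp add: add_ac)
  qed simp
  have int: "fejer_int Q (y + of_int n) = fejer_int Q y + of_int n" for y
  proof (cases "n \<ge> 0")
    case True then show ?thesis using nat[of y "nat n"] by simp
  next
    case False then show ?thesis using nat[of "y + of_int n" "nat (-n)"] by simp
  qed
  show ?thesis using int[of "x + \<delta>"] int[of "x - \<delta>"] by (simp add: smooth_chi_def algebra_simps)
qed

lemma smooth_chi_expand:
  "smooth_chi Q \<delta> x = 2 * \<delta> + (\<Sum>h\<in>{1..<Q}. 2 * (1 - real h / real Q) * (sin (2 * pi * real h * \<delta>) / (pi * real h)) * cos (2 * pi * real h * x))"
proof -
  have "sin (2 * pi * real h * (x + \<delta>)) - sin (2 * pi * real h * (x - \<delta>)) = 2 * sin (2 * pi * real h * \<delta>) * cos (2 * pi * real h * x)" for h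
    by (simp add: distrib_left right_diff_distrib sin_add sin_diff)
  then have *: "(1 - real h / real Q) * (sin (2 * pi * real h * (x + \<delta>)) / (pi * real h)) - (1 - real h / real Q) * (sin (2 * pi * real h * (x - \<delta>)) / (pi * real h))
    = 2 * (1 - real h / real Q) * (sin (2 * pi * real h * \<delta>) / (pi * real h)) * cos (2 * pi * real h * x)" for h
    by (simp add: right_diff_distrib[symmetric] diff_divide_distrib[symmetric])
  show ?thesis
    unfolding smooth_chi_def fejer_int_def *[symmetric] sum_subtractf by simp
qed

text \<open>On the interval both \<open>t + (\<delta> + \<eta>)\<close> and
  \<open>- (t - (\<delta> + \<eta>))\<close> are at least \<open>\<eta>\<close>, so each contributes
  \<open>1/2 - 1 / (Q * \<eta>)\<close>; elsewhere nonnegativity of the kernel suffices. It does no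
  harm that \<open>\<delta> + \<eta>\<close> may exceed 1/2.\<close>

lemma chi_le_smooth:
  assumes "Q \<ge> 1" "0 < \<delta>" "\<delta> < 1/2" "0 < \<eta>"
  shows "chi \<delta> x \<le> smooth_chi Q (\<delta> + \<eta>) x + 2 / (real Q * \<eta>)"
proof -
  define t where "t = x - of_int \<lceil>x - 1/2\<rceil>"
  have "smooth_chi Q (\<delta> + \<eta>) x = smooth_chi Q (\<delta> + \<eta>) t"
    using smooth_chi_add_int[of Q "\<delta> + \<eta>" t "\<lceil>x - 1/2\<rceil>"] by (simp add: t_def)
  moreover have "chi \<delta> x \<le> smooth_chi Q (\<delta> + \<eta>) t + 2 / (real Q * \<eta>)"
  proof (cases "-\<delta> < t \<and> t \<le> \<delta>")
    case True
    have "fejer_int Q (t + (\<delta> + \<eta>)) \<ge> 1/2 - 1 / (real Q * \<eta>)"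
      using True assms by (intro fejer_int_ge) auto
    moreover have "fejer_int Q (- (t - (\<delta> + \<eta>))) \<ge> 1/2 - 1 / (real Q * \<eta>)"
      using True assms by (intro fejer_int_ge) auto
    moreover have "chi \<delta> x = 1" using True by (simp add: chi_def t_def Let_def)
    ultimately show ?thesis unfolding smooth_chi_def fejer_int_minus by simp
  next
    case False
    then have "chi \<delta> x = 0" by (simp add: chi_def t_def Let_def)
    moreover have "smooth_chi Q (\<delta> + \<eta>) t \<ge> 0"
      unfolding smooth_chi_def using fejer_int_mono[OF assms(1), of "t - (\<delta> + \<eta>)" "t + (\<delta> + \<eta>)"] assms by simp
    ultimately show ?thesis using assms by simp
  qed
  ultimately show ?thesis by simp
qed

text \<open>Inside, the window has length \<open>2 * (\<delta> - \<eta>) \<le> 1\<close>, at most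
  one period, over which the kernel has mass 1. Outside with \<open>t \<ge> 0\<close>, the window
  stays at least \<open>\<eta>\<close> to the right of 0 and at least \<open>\<eta>\<close> to the
  left of 1, the next peak of the kernel; \<open>t < 0\<close> is the mirror image.\<close>

lemma chi_ge_smooth:
  assumes "Q \<ge> 1" "0 < \<delta>" "\<delta> < 1/2" "0 < \<eta>" "\<eta> \<le> \<delta>"
  shows "chi \<delta> x \<ge> smooth_chi Q (\<delta> - \<eta>) x - 2 / (real Q * \<eta>)"
proof -
  define t where "t = x - of_int \<lceil>x - 1/2\<rceil>"
  have t: "-1/2 \<le> t" "t \<le> 1/2" unfolding t_def by linarith+
  have "smooth_chi Q (\<delta> - \<eta>) x = smooth_chi Q (\<delta> - \<eta>) t"
    using smooth_chi_add_int[of Q "\<delta> - \<eta>" t "\<lceil>x - 1/2\<rceil>"] by (simp add: t_def)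
  moreover have "chi \<delta> x \<ge> smooth_chi Q (\<delta> - \<eta>) t - 2 / (real Q * \<eta>)"
  proof (cases "-\<delta> < t \<and> t \<le> \<delta>")
    case True
    have "chi \<delta> x = 1" using True by (simp add: chi_def t_def Let_def)
    moreover have "fejer_int Q (t + (\<delta> - \<eta>)) \<le> fejer_int Q (t - (\<delta> - \<eta>) + 1)"
      using assms by (intro fejer_int_mono) auto
    then have "smooth_chi Q (\<delta> - \<eta>) t \<le> 1" by (simp add: smooth_chi_def fejer_int_add_1)
    moreover have "0 \<le> 2 / (real Q * \<eta>)" using assms by simp
    ultimately show ?thesis by linarith
  next
    case False
    then have c: "chi \<delta> x = 0" by (simp add: chi_def t_def Let_def)
    have "smooth_chi Q (\<delta> - \<eta>) t \<le> 2 / (real Q * \<eta>)"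
    proof (cases "t \<ge> 0")
      case True
      then have "fejer_int Q (t - (\<delta> - \<eta>)) \<ge> 1/2 - 1 / (real Q * \<eta>)"
        using False assms by (intro fejer_int_ge) auto
      moreover have "fejer_int Q (- (t + (\<delta> - \<eta>)) + 1) \<ge> 1/2 - 1 / (real Q * \<eta>)"
        using t assms by (intro fejer_int_ge) auto
      ultimately show ?thesis unfolding smooth_chi_def fejer_int_add_1 fejer_int_minus by simp
    next
      case neg: False
      then have "fejer_int Q (- (t + (\<delta> - \<eta>))) \<ge> 1/2 - 1 / (real Q * \<eta>)"
        using False assms by (intro fejer_int_ge) auto
      moreover have "fejer_int Q ((t - (\<delta> - \<eta>)) + 1) \<ge> 1/2 - 1 / (real Q * \<eta>)"
        using t assms by (intro fejer_int_ge) auto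
      ultimately show ?thesis unfolding smooth_chi_def fejer_int_add_1 fejer_int_minus by simp
    qed
    with c show ?thesis by simp
  qed
  ultimately show ?thesis by simp
qed

section \<open>Type I sums\<close>

text \<open>Abel summation over the tails of \<open>z\<close>; the increments of \<open>w\<close>
  are nonnegative and telescope to \<open>w J\<close>.\<close>

lemma norm_sum_monotone_weights:
  fixes z :: "nat \<Rightarrow> complex" and w :: "nat \<Rightarrow> real"
  assumes "w 0 = 0" and mono: "\<And>i. w i \<le> w (Suc i)"
    and C: "\<And>i. norm (\<Sum>j\<in>{i<..J}. z j) \<le> C"
  shows "norm (\<Sum>j\<in>{0<..J}. of_real (w j) * z j) \<le> w J * C"
proof -
  have eq: "(\<Sum>j\<in>{0<..J}. of_real (w j) * z j) = (\<Sum>i<J. of_real (w (Suc i) - w i) * (\<Sum>j\<in>{i<..J}. z j))"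
  proof (induction J)
    case (Suc J)
    have ins: "{i<..Suc J} = insert (Suc J) {i<..J}" if "i \<le> J" for i using that by auto
    have "(\<Sum>i<Suc J. of_real (w (Suc i) - w i) * (\<Sum>j\<in>{i<..Suc J}. z j))
       = (\<Sum>i<Suc J. of_real (w (Suc i) - w i) * (\<Sum>j\<in>{i<..J}. z j) + of_real (w (Suc i) - w i) * z (Suc J))"
      by (intro sum.cong refl) (simp add: ins algebra_simps)
    also have "\<dots> = (\<Sum>i<J. of_real (w (Suc i) - w i) * (\<Sum>j\<in>{i<..J}. z j)) + of_real (\<Sum>i<Suc J. w (Suc i) - w i) * z (Suc J)"
      by (simp only: sum.distrib of_real_sum sum_distrib_right) simp
    also have "(\<Sum>i<Suc J. w (Suc i) - w i) = w (Suc J)"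
      using assms(1) by (simp add: sum_lessThan_telescope)
    finally show ?case using Suc.IH by (simp add: ins)
  qed simp
  have "norm (\<Sum>j\<in>{0<..J}. of_real (w j) * z j) \<le> (\<Sum>i<J. (w (Suc i) - w i) * C)"
    unfolding eq using mono C
    by (intro order.trans[OF norm_sum] sum_mono)
       (simp add: norm_mult mult_left_mono flip: of_real_diff)
  also have "\<dots> = w J * C" using assms(1) by (simp add: sum_lessThan_telescope flip: sum_distrib_right)
  finally show ?thesis .
qed

lemma mangoldt_le_ln: "n \<ge> 1 \<Longrightarrow> (mangoldt n :: real) \<le> ln (real n)"
proof -
  assume n: "n \<ge> 1"
  have "(mangoldt n :: real) \<le> (\<Sum>d | d dvd n. mangoldt d)"
    using n by (intro member_le_sum) (auto intro: mangoldt_nonneg)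
  also have "\<dots> = ln (real n)" using n by (subst mangoldt_sum) auto
  finally show ?thesis .
qed

lemma norm_sum_multiples_ee:
  assumes "d \<ge> 1"
  shows "norm (\<Sum>j | j \<in> {1..N} \<and> d * j \<le> N. ee (\<theta> * real j)) \<le> geo_bound (real N / real d) \<theta>"
    and "norm (\<Sum>j | j \<in> {1..N} \<and> d * j \<le> N. of_real (ln (real j)) * ee (\<theta> * real j))
      \<le> ln (real N) * geo_bound (real N / real d) \<theta>"
proof -
  have set: "{j. j \<in> {1..N} \<and> d * j \<le> N} = {0<..N div d}"
    using assms by (auto simp: less_eq_div_iff_mult_less_eq mult.commute[of d] intro: mult_le_imp_le)
  have le: "geo_bound (real (N div d - i)) \<theta> \<le> geo_bound (real N / real d) \<theta>" for i
    using of_nat_div_le_of_nat[of N d, where 'a = real] by (intro geo_bound_mono) linarith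
  have *: "norm (\<Sum>j\<in>{i<..N div d}. ee (\<theta> * real j)) \<le> geo_bound (real N / real d) \<theta>" for i
    using norm_sum_ee le by (rule order.trans)
  show "norm (\<Sum>j | j \<in> {1..N} \<and> d * j \<le> N. ee (\<theta> * real j)) \<le> geo_bound (real N / real d) \<theta>"
    unfolding set by (rule *)
  have "norm (\<Sum>j\<in>{0<..N div d}. of_real (ln (real j)) * ee (\<theta> * real j)) \<le> ln (real (N div d)) * geo_bound (real N / real d) \<theta>"
  proof (rule norm_sum_monotone_weights)
    \<comment> \<open>The default value \<open>ln 0 = 0\<close> makes the weight vanish at 0, as
      Abel summation requires, and keeps it monotone there.\<close>
    show "ln (real i) \<le> ln (real (Suc i))" for i by (cases "i = 0") auto
  qed (use * in auto)
  also have "\<dots> \<le> ln (real N) * geo_bound (real N / real d) \<theta>"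
  proof (intro mult_right_mono geo_bound_nonneg)
    show "ln (real (N div d)) \<le> ln (real N)"
      using div_le_dividend[of N d] by (cases "N div d = 0"; cases "N = 0") auto
  qed auto
  finally show "norm (\<Sum>j | j \<in> {1..N} \<and> d * j \<le> N. of_real (ln (real j)) * ee (\<theta> * real j)) \<le> ln (real N) * geo_bound (real N / real d) \<theta>"
    unfolding set .
qed

text \<open>\<open>lg\<close> bounds every logarithmic factor, and \<open>V\<close> is the cut-off in Vaughan's identity.\<close>

locale vaughan_setup = rational_approx +
  fixes N H :: nat and V lg :: real
  assumes N1: "N \<ge> 1" and H1: "H \<ge> 1" and V1: "V \<ge> 1" and V2: "V ^ 2 \<le> real N"
    and l49: "lg \<ge> 49" and hq_le: "hq \<le> lg"
    and harm_le: "\<And>n. real n \<le> 4 * real H * real N \<Longrightarrow> harm n \<le> lg"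
begin

definition v :: nat where "v = nat \<lfloor>V\<rfloor>"

definition Z :: real where "Z = real H * real N"

text \<open>\<open>num_divisors s\<close> bounds the number of ways to write
  \<open>s = h * r\<close>. Both type I sums are reduced to this quantity.\<close>

definition G :: real
  where "G = (\<Sum>s\<in>{1..H * (v * v)}. real (num_divisors s) * geo_bound (Z / real s) (\<alpha> * real s))"

lemma v_le: "real v \<le> V" "real k \<le> V \<longleftrightarrow> k \<le> v"
  using V1 by (auto simp: v_def le_nat_floor) linarith+

lemma v_sq_le: "real (v * v) \<le> V ^ 2"
  using v_le(1) by (simp add: power2_eq_square mult_mono)

lemma Z_pos: "Z \<ge> 1"
  using N1 H1 unfolding Z_def by (simp add: Suc_le_eq flip: of_nat_mult)

lemma R_le: "real (H * (v * v)) \<le> real H * V ^ 2" "real (H * (v * v)) \<le> Z"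
proof -
  show 1: "real (H * (v * v)) \<le> real H * V ^ 2"
    unfolding of_nat_mult[of H] using v_sq_le by (intro mult_left_mono) auto
  show "real (H * (v * v)) \<le> Z"
    using order.trans[OF 1 mult_left_mono[OF V2]] by (simp add: Z_def)
qed

lemma ln_le_l: "1 \<le> n \<Longrightarrow> real n \<le> 4 * real H * real N \<Longrightarrow> ln (real n) \<le> lg"
proof -
  assume n: "1 \<le> n" "real n \<le> 4 * real H * real N"
  have "ln (real n) \<le> ln (real n + 1)" using n by simp
  also have "\<dots> \<le> harm n" by (rule harm_ge_ln)
  also have "\<dots> \<le> lg" by (rule harm_le[OF n(2)])
  finally show ?thesis .
qed

lemma N_le: "n \<le> N \<Longrightarrow> real n \<le> 4 * real H * real N"
proof -
  assume "n \<le> N"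
  then have "real n \<le> 1 * real N" by simp
  also have "\<dots> \<le> (4 * real H) * real N" using H1 by (intro mult_right_mono) auto
  finally show ?thesis .
qed

lemma ln_N: "ln (real N) \<le> lg"
  using ln_le_l[of N] N_le[of N] N1 by simp

lemma sum_geo_bound_le:
  "(\<Sum>s\<in>{1..H * (v * v)}. geo_bound (Z / real s) (\<alpha> * real s)) \<le> 12 * lg * (Z / of_int q + real (H * (v * v)) + of_int q)"
proof -
  define R where "R = H * (v * v)"
  have "(\<Sum>s\<in>{1..R}. geo_bound (Z / real s) (\<alpha> * real s)) = (\<Sum>s\<in>{1..int R}. geo_bound (Z / of_int s) (\<alpha> * of_int s))"
    by (rule sum.reindex_bij_witness[of _ nat int]) auto
  also have "\<dots> \<le> 12 * Z / of_int q * harm (R div nat q + 1) + (2 * real R + 6 * of_int q) * hq"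
    using Z_pos by (intro hyper_sum) auto
  also have "\<dots> \<le> 12 * Z / of_int q * lg + (2 * real R + 6 * of_int q) * lg"
  proof (intro add_mono mult_left_mono harm_le hq_le)
    \<comment> \<open>\<open>R \<le> Z\<close> and \<open>Z \<ge> 1\<close> put
      \<open>R div q + 1\<close> below \<open>2 * Z\<close>, inside the range in which
      \<open>harm_le\<close> applies.\<close>
    have "real (R div nat q + 1) \<le> real R + 1" using div_le_dividend[of R "nat q"] by simp
    also have "\<dots> \<le> Z + Z" using R_le(2) Z_pos unfolding R_def by linarith
    finally show "real (R div nat q + 1) \<le> 4 * real H * real N" using Z_pos unfolding Z_def by linarith
  qed (use Z_pos q_pos in auto)
  also have "\<dots> \<le> 12 * Z / of_int q * lg + (12 * real R + 12 * of_int q) * lg"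
    using l49 q_pos by (intro add_mono order.refl mult_right_mono) auto
  also have "\<dots> = 12 * lg * (Z / of_int q + real R + of_int q)" by (simp add: algebra_simps)
  finally show ?thesis unfolding R_def .
qed

text \<open>Cauchy's inequality with \<open>num_divisors s * sqrt g\<close> against
  \<open>sqrt g\<close>, where \<open>g\<close> is the geometric bound: in the first factor the
  trivial bound \<open>Z / s\<close> leaves the logarithmic mean of the squared divisor function,
  while the second keeps all cancellation.\<close>

lemma G_sq_le: "G ^ 2 \<le> Z * lg ^ 4 * (12 * lg * (Z / of_int q + real (H * (v * v)) + of_int q))"
proof -
  let ?R = "H * (v * v)"
  let ?g = "\<lambda>s. geo_bound (Z / real s) (\<alpha> * real s)"
  have g0: "?g s \<ge> 0" for s using Z_pos by (intro geo_bound_nonneg) auto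
  have "G = (\<Sum>s\<in>{1..?R}. (real (num_divisors s) * sqrt (?g s)) * sqrt (?g s))"
    unfolding G_def using g0 by (intro sum.cong refl) (simp add: mult.assoc)
  then have "G ^ 2 \<le> (\<Sum>s\<in>{1..?R}. (real (num_divisors s) * sqrt (?g s)) ^ 2) * (\<Sum>s\<in>{1..?R}. sqrt (?g s) ^ 2)"
    by (simp only: Cauchy_Schwarz_ineq_sum)
  also have "\<dots> = (\<Sum>s\<in>{1..?R}. real (num_divisors s) ^ 2 * ?g s) * (\<Sum>s\<in>{1..?R}. ?g s)"
    using g0 by (simp only: power_mult_distrib real_sqrt_pow2)
  also have "\<dots> \<le> (Z * lg ^ 4) * (12 * lg * (Z / of_int q + real ?R + of_int q))"
  proof (rule mult_mono[OF _ sum_geo_bound_le])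
    have "(\<Sum>s\<in>{1..?R}. real (num_divisors s) ^ 2 * ?g s) \<le> (\<Sum>s\<in>{1..?R}. real (num_divisors s) ^ 2 * (Z / real s))"
      by (intro sum_mono mult_left_mono geo_bound_le) auto
    also have "\<dots> = Z * (\<Sum>s\<in>{1..?R}. real (num_divisors s) ^ 2 / real s)"
      by (simp add: sum_distrib_left mult_ac)
    also have "\<dots> \<le> Z * harm ?R ^ 4" using Z_pos by (intro mult_left_mono sum_num_divisors_sq_div) auto
    also have "\<dots> \<le> Z * lg ^ 4"
      using Z_pos R_le(2) unfolding Z_def
      by (intro mult_left_mono power_mono harm_le harm_nonneg) auto
    finally show "(\<Sum>s\<in>{1..?R}. real (num_divisors s) ^ 2 * ?g s) \<le> Z * lg ^ 4" .
  qed (use Z_pos l49 g0 in \<open>auto intro!: sum_nonneg\<close>)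
  finally show ?thesis .
qed

lemma G_le_divisor_bound:
  assumes "\<And>s. s \<in> {1..H * (v * v)} \<Longrightarrow> real (num_divisors s) \<le> D" "D \<ge> 0"
  shows "G \<le> D * (12 * lg * (Z / of_int q + real (H * (v * v)) + of_int q))"
proof -
  have "G \<le> (\<Sum>s\<in>{1..H * (v * v)}. D * geo_bound (Z / real s) (\<alpha> * real s))"
    unfolding G_def using Z_pos by (intro sum_mono mult_right_mono assms geo_bound_nonneg) auto
  also have "\<dots> = D * (\<Sum>s\<in>{1..H * (v * v)}. geo_bound (Z / real s) (\<alpha> * real s))" by (simp only: sum_distrib_left)
  also have "\<dots> \<le> D * (12 * lg * (Z / of_int q + real (H * (v * v)) + of_int q))"
    by (intro mult_left_mono sum_geo_bound_le assms)
  finally show ?thesis .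
qed

text \<open>\<open>N / r = h * N / (h * r) \<le> Z / (h * r)\<close>: the bound now depends only on
  the product \<open>h * r\<close>, which is merged into \<open>s\<close>.\<close>

lemma sum_geo_bound_le_G: "(\<Sum>h\<in>{1..H}. \<Sum>r\<in>{1..v * v}. geo_bound (real N / real r) (\<alpha> * real (h * r))) \<le> G"
proof -
  have "(\<Sum>h\<in>{1..H}. \<Sum>r\<in>{1..v * v}. geo_bound (real N / real r) (\<alpha> * real (h * r)))
     \<le> (\<Sum>h\<in>{1..H}. \<Sum>r\<in>{1..v * v}. 1 * geo_bound (Z / real (h * r)) (\<alpha> * real (h * r)))"
  proof (intro sum_mono)
    fix h r assume h: "h \<in> {1..H}" and r: "r \<in> {1..v * v}"
    have "real h * real N / (real h * real r) \<le> Z / (real h * real r)"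
      using h unfolding Z_def by (intro divide_right_mono mult_right_mono) auto
    then have "real N / real r \<le> Z / real (h * r)" using h by simp
    then show "geo_bound (real N / real r) (\<alpha> * real (h * r)) \<le> 1 * geo_bound (Z / real (h * r)) (\<alpha> * real (h * r))"
      by (simp only: mult_1 geo_bound_mono)
  qed
  also have "\<dots> \<le> (\<Sum>s\<in>{1..H * (v * v)}. divsum (\<lambda>_. 1) s * geo_bound (Z / real s) (\<alpha> * real s))"
    using Z_pos by (intro sum_group_products) (auto intro!: geo_bound_nonneg)
  finally show ?thesis unfolding G_def divsum_one .
qed

section \<open>The two type I sums and the initial terms\<close>

lemma type_I_log:
  "(\<Sum>h\<in>{1..H}. norm (\<Sum>d | d \<in> {1..N} \<and> real d \<le> V. of_real (moebius_mu d) *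
     (\<Sum>j | j \<in> {1..N} \<and> d * j \<le> N. of_real (ln (real j)) * ee (\<alpha> * real (h * (d * j)))))) \<le> lg * G"
proof -
  have "(\<Sum>h\<in>{1..H}. norm (\<Sum>d | d \<in> {1..N} \<and> real d \<le> V. of_real (moebius_mu d) *
     (\<Sum>j | j \<in> {1..N} \<and> d * j \<le> N. of_real (ln (real j)) * ee (\<alpha> * real (h * (d * j))))))
    \<le> (\<Sum>h\<in>{1..H}. \<Sum>r\<in>{1..v * v}. lg * geo_bound (real N / real r) (\<alpha> * real (h * r)))"
  proof (intro sum_mono)
    fix h
    let ?z = "\<lambda>d. (\<Sum>j | j \<in> {1..N} \<and> d * j \<le> N. of_real (ln (real j)) * ee (\<alpha> * real (h * (d * j))))"
    have "norm (\<Sum>d | d \<in> {1..N} \<and> real d \<le> V. of_real (moebius_mu d) * ?z d)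
      \<le> (\<Sum>d | d \<in> {1..N} \<and> real d \<le> V. lg * geo_bound (real N / real d) (\<alpha> * real (h * d)))"
    proof (intro order.trans[OF norm_sum] sum_mono)
      fix d assume d: "d \<in> {d. d \<in> {1..N} \<and> real d \<le> V}"
      have ge: "geo_bound (real N / real d) (\<alpha> * real (h * d)) \<ge> 0" by (intro geo_bound_nonneg) auto
      have z: "?z d = (\<Sum>j | j \<in> {1..N} \<and> d * j \<le> N. of_real (ln (real j)) * ee (\<alpha> * real (h * d) * real j))"
        by (simp add: mult_ac)
      have "norm (of_real (moebius_mu d) * ?z d) \<le> 1 * norm (?z d)"
        unfolding norm_mult using abs_moebius_mu_le by (intro mult_right_mono) auto
      also have "1 * norm (?z d) \<le> ln (real N) * geo_bound (real N / real d) (\<alpha> * real (h * d))"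
        unfolding z using norm_sum_multiples_ee(2)[where d = d and N = N and \<theta> = "\<alpha> * real (h * d)"] d by simp
      also have "\<dots> \<le> lg * geo_bound (real N / real d) (\<alpha> * real (h * d))"
        by (intro mult_right_mono ln_N ge)
      finally show "norm (of_real (moebius_mu d) * ?z d) \<le> lg * geo_bound (real N / real d) (\<alpha> * real (h * d))" .
    qed
    also have "\<dots> \<le> (\<Sum>r\<in>{1..v * v}. lg * geo_bound (real N / real r) (\<alpha> * real (h * r)))"
    proof (rule sum_mono2)
      \<comment> \<open>Only \<open>d \<le> v\<close> occurs; the longer range lets the same
        \<open>G\<close> serve both type I sums.\<close>
      show "{d. d \<in> {1..N} \<and> real d \<le> V} \<subseteq> {1..v * v}"
        unfolding v_le by (auto intro: order.trans[OF _ le_square])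
    qed (use l49 in \<open>auto intro!: geo_bound_nonneg mult_nonneg_nonneg\<close>)
    finally show "norm (\<Sum>d | d \<in> {1..N} \<and> real d \<le> V. of_real (moebius_mu d) * ?z d) \<le> \<dots>" .
  qed
  also have "\<dots> = lg * (\<Sum>h\<in>{1..H}. \<Sum>r\<in>{1..v * v}. geo_bound (real N / real r) (\<alpha> * real (h * r)))"
    by (simp only: sum_distrib_left)
  also have "\<dots> \<le> lg * G" using l49 by (intro mult_left_mono sum_geo_bound_le_G) auto
  finally show ?thesis .
qed

text \<open>Merging \<open>d * k = r\<close> gives \<open>r\<close> the weight
  \<open>divsum mangoldt r = ln r\<close>, at most \<open>lg\<close>, so no further divisor function
  arises.\<close>

lemma type_I:
  "(\<Sum>h\<in>{1..H}. norm (\<Sum>d | d \<in> {1..N} \<and> real d \<le> V. \<Sum>k | k \<in> {1..N} \<and> real k \<le> V.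
      of_real (moebius_mu d) * mangoldt k *
     (\<Sum>m | m \<in> {1..N} \<and> d * k * m \<le> N. ee (\<alpha> * real (h * (d * k * m)))))) \<le> lg * G"
proof -
  have "(\<Sum>h\<in>{1..H}. norm (\<Sum>d | d \<in> {1..N} \<and> real d \<le> V. \<Sum>k | k \<in> {1..N} \<and> real k \<le> V.
      of_real (moebius_mu d) * mangoldt k *
     (\<Sum>m | m \<in> {1..N} \<and> d * k * m \<le> N. ee (\<alpha> * real (h * (d * k * m))))))
    \<le> (\<Sum>h\<in>{1..H}. \<Sum>r\<in>{1..v * v}. lg * geo_bound (real N / real r) (\<alpha> * real (h * r)))"
  proof (intro sum_mono)
    fix h
    let ?z = "\<lambda>d k. (\<Sum>m | m \<in> {1..N} \<and> d * k * m \<le> N. ee (\<alpha> * real (h * (d * k * m))))"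
    let ?\<phi> = "\<lambda>r. geo_bound (real N / real r) (\<alpha> * real (h * r))"
    have ge: "?\<phi> r \<ge> 0" for r by (intro geo_bound_nonneg) auto
    have "norm (\<Sum>d | d \<in> {1..N} \<and> real d \<le> V. \<Sum>k | k \<in> {1..N} \<and> real k \<le> V. of_real (moebius_mu d) * mangoldt k * ?z d k)
      \<le> (\<Sum>d | d \<in> {1..N} \<and> real d \<le> V. \<Sum>k | k \<in> {1..N} \<and> real k \<le> V. mangoldt k * ?\<phi> (d * k))"
    proof (intro order.trans[OF norm_sum] sum_mono)
      fix d k assume d: "d \<in> {d. d \<in> {1..N} \<and> real d \<le> V}" and k: "k \<in> {k. k \<in> {1..N} \<and> real k \<le> V}"
      have z: "?z d k = (\<Sum>m | m \<in> {1..N} \<and> d * k * m \<le> N. ee (\<alpha> * real (h * (d * k)) * real m))"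
        by (simp add: mult_ac)
      have "norm (of_real (moebius_mu d) * mangoldt k * ?z d k) \<le> 1 * mangoldt k * norm (?z d k)"
        unfolding norm_mult using abs_moebius_mu_le mangoldt_nonneg[of k]
        by (intro mult_mono mult_nonneg_nonneg) auto
      also have "1 * mangoldt k * norm (?z d k) \<le> 1 * mangoldt k * ?\<phi> (d * k)"
        unfolding z using norm_sum_multiples_ee(1)[where d = "d * k" and N = N and \<theta> = "\<alpha> * real (h * (d * k))"] d k mangoldt_nonneg[of k]
        by (intro mult_left_mono) auto
      finally show "norm (of_real (moebius_mu d) * mangoldt k * ?z d k) \<le> mangoldt k * ?\<phi> (d * k)" by simp
    qed
    also have "\<dots> \<le> (\<Sum>d\<in>{1..v}. \<Sum>k\<in>{1..v}. mangoldt k * ?\<phi> (d * k))"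
    proof -
      have sub: "{d. d \<in> {1..N} \<and> real d \<le> V} \<subseteq> {1..v}" unfolding v_le by auto
      have "(\<Sum>d | d \<in> {1..N} \<and> real d \<le> V. \<Sum>k | k \<in> {1..N} \<and> real k \<le> V. mangoldt k * ?\<phi> (d * k))
        \<le> (\<Sum>d | d \<in> {1..N} \<and> real d \<le> V. \<Sum>k\<in>{1..v}. mangoldt k * ?\<phi> (d * k))"
        by (intro sum_mono sum_mono2 sub mult_nonneg_nonneg ge mangoldt_nonneg) auto
      also have "\<dots> \<le> (\<Sum>d\<in>{1..v}. \<Sum>k\<in>{1..v}. mangoldt k * ?\<phi> (d * k))"
        by (intro sum_mono2 sub sum_nonneg mult_nonneg_nonneg ge mangoldt_nonneg) auto
      finally show ?thesis .
    qed
    also have "\<dots> \<le> (\<Sum>r\<in>{1..v * v}. divsum mangoldt r * ?\<phi> r)"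
      by (intro sum_group_products ge mangoldt_nonneg)
    also have "\<dots> \<le> (\<Sum>r\<in>{1..v * v}. lg * ?\<phi> r)"
    proof (intro sum_mono mult_right_mono ge)
      fix r assume r: "r \<in> {1..v * v}"
      have "real r \<le> real (v * v)" using r by (simp only: of_nat_le_iff) simp
      then have "r \<le> N" using v_sq_le V2 by linarith
      then show "divsum mangoldt r \<le> lg" using r ln_le_l[of r] N_le[of r] by (subst mangoldt_sum) auto
    qed
    finally show "norm (\<Sum>d | d \<in> {1..N} \<and> real d \<le> V. \<Sum>k | k \<in> {1..N} \<and> real k \<le> V. of_real (moebius_mu d) * mangoldt k * ?z d k) \<le> \<dots>" .
  qed
  also have "\<dots> = lg * (\<Sum>h\<in>{1..H}. \<Sum>r\<in>{1..v * v}. geo_bound (real N / real r) (\<alpha> * real (h * r)))"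
    by (simp only: sum_distrib_left)
  also have "\<dots> \<le> lg * G" using l49 by (intro mult_left_mono sum_geo_bound_le_G) auto
  finally show ?thesis .
qed

lemma small_part:
  "(\<Sum>h\<in>{1..H}. norm (\<Sum>n | n \<in> {1..N} \<and> real n \<le> V. mangoldt n * ee (\<alpha> * real (h * n)))) \<le> real H * (V * lg)"
proof -
  have "norm (\<Sum>n | n \<in> {1..N} \<and> real n \<le> V. mangoldt n * ee (\<alpha> * real (h * n))) \<le> V * lg" for h
  proof -
    have "norm (\<Sum>n | n \<in> {1..N} \<and> real n \<le> V. mangoldt n * ee (\<alpha> * real (h * n))) \<le> (\<Sum>n | n \<in> {1..N} \<and> real n \<le> V. lg)"
    proof (intro order.trans[OF norm_sum] sum_mono)
      fix n assume n: "n \<in> {n. n \<in> {1..N} \<and> real n \<le> V}"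
      then show "norm (mangoldt n * ee (\<alpha> * real (h * n))) \<le> lg"
        using mangoldt_le_ln[of n] ln_le_l[of n] N_le[of n] by (simp add: norm_mult)
    qed
    also have "\<dots> = real (card {n. n \<in> {1..N} \<and> real n \<le> V}) * lg" by simp
    also have "\<dots> \<le> V * lg"
    proof (rule mult_right_mono)
      have "card {n. n \<in> {1..N} \<and> real n \<le> V} \<le> card {1..v}" unfolding v_le by (intro card_mono) auto
      then show "real (card {n. n \<in> {1..N} \<and> real n \<le> V}) \<le> V" using v_le(1) by simp
    qed (use l49 in auto)
    finally show ?thesis .
  qed
  then have "(\<Sum>h\<in>{1..H}. norm (\<Sum>n | n \<in> {1..N} \<and> real n \<le> V. mangoldt n * ee (\<alpha> * real (h * n)))) \<le> (\<Sum>h\<in>{1..H}. V * lg)"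
    by (intro sum_mono)
  then show ?thesis by simp
qed

end

section \<open>Type II sums\<close>

lemma sum_dyadic_blocks:
  fixes g :: "nat \<Rightarrow> 'a::comm_monoid_add"
  shows "(\<Sum>m\<in>{s<..2 ^ J * s}. g m) = (\<Sum>i<J. \<Sum>m\<in>{2 ^ i * s<..2 ^ Suc i * s}. g m)"
proof (induction J)
  case (Suc J)
  have "{s<..2 ^ Suc J * s} = {s<..2 ^ J * s} \<union> {2 ^ J * s<..2 ^ Suc J * s}"
    by (rule ivl_disj_un_two(6)[symmetric]) auto
  then have "(\<Sum>m\<in>{s<..2 ^ Suc J * s}. g m) = (\<Sum>m\<in>{s<..2 ^ J * s}. g m) + (\<Sum>m\<in>{2 ^ J * s<..2 ^ Suc J * s}. g m)"
    by (simp only:) (rule sum.union_disjoint, auto)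
  then show ?case by (simp only: Suc.IH sum.lessThan_Suc)
qed simp

context vaughan_setup
begin

text \<open>Bound for a single block in \<open>type_II\<close>. Of the exponent 11, at most 10 comes
  from the mean squares of the coefficients and 1 from \<open>hq\<close>.\<close>

definition type_II_root :: real
  where "type_II_root = sqrt (24 * lg ^ 11 * (Z * (Z / of_int q + real H * sqrt (real N) + real N / V + of_int q)))"

text \<open>\<open>P\<close> bounds the outer variable; \<open>K * P \<le> 2 * N\<close> and
  \<open>P \<ge> sqrt N / 2\<close> force \<open>K \<le> 4 * sqrt N\<close>. In
  \<open>H * K * P * (H * K / q + 1) * (6 * P + 2 * q * lg)\<close> the first three factors are at
  most \<open>2 * Z\<close>, and multiplying out the rest leaves the four terms under the
  root.\<close>

lemma block_bound:
  fixes x y :: "nat \<Rightarrow> complex" and M1 M2 K P :: nat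
  assumes P: "M2 \<le> P" "real P \<ge> sqrt (real N) / 2" "real P \<le> 2 * real N / V" "K * P \<le> 2 * N"
    and A: "(\<Sum>m\<in>{M1<..M2}. norm (x m) ^ 2) \<le> real P * A"
    and C: "(\<Sum>r\<in>{1..H * K}. divsum (\<lambda>k. norm (y k)) r ^ 2) \<le> real (H * K) * C"
    and AC: "A \<ge> 0" "C \<ge> 0" "A * C \<le> lg ^ 10"
  shows "(\<Sum>h\<in>{1..H}. norm (\<Sum>m\<in>{M1<..M2}. \<Sum>k | k \<in> {1..K} \<and> m * k \<le> N. x m * y k * ee (\<alpha> * real (h * m * k)))) \<le> type_II_root"
proof -
  let ?B = "(real (H * K) / of_int q + 1) * (6 * real (M2 - M1) + 2 * of_int q * hq)"
  have q0: "real_of_int q \<ge> 1" using q_pos by simp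
  have lg1: "lg \<ge> 1" using l49 by simp
  have sN: "sqrt (real N) \<ge> 1" using N1 by simp
  have P0: "real P > 0" using P(2) sN by linarith
  have KP: "real K * real P \<le> 2 * real N" using P(4) by (metis of_nat_le_iff of_nat_mult of_nat_numeral)
  have HKP: "real H * real K * real P \<le> 2 * Z"
    using mult_left_mono[OF KP, of "real H"] by (simp add: Z_def mult_ac)
  have HK: "real H * real K \<le> 4 * (real H * sqrt (real N))"
  proof -
    have "real K * (sqrt (real N) / 2) \<le> real K * real P" using P(2) by (intro mult_left_mono) auto
    also have "\<dots> \<le> 2 * (sqrt (real N) * sqrt (real N))" using KP by simp
    finally have "real K * sqrt (real N) \<le> (4 * sqrt (real N)) * sqrt (real N)"
      by (simp add: mult.assoc)
    then have "real K \<le> 4 * sqrt (real N)" using sN by (simp only: mult_le_cancel_right_pos)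
    from mult_left_mono[OF this, of "real H"] show ?thesis by simp
  qed
  have B: "?B \<le> (real H * real K / of_int q + 1) * (6 * real P + 2 * of_int q * lg)"
    using P(1) hq_le q_pos hq_nonneg by (intro mult_mono add_mono mult_left_mono) auto
  have B0: "?B \<ge> 0" using q_pos hq_nonneg by (intro mult_nonneg_nonneg add_nonneg_nonneg) auto
  have "(\<Sum>m\<in>{M1<..M2}. norm (x m) ^ 2) * ((\<Sum>r\<in>{1..H*K}. divsum (\<lambda>k. norm (y k)) r ^ 2) * ?B)
     \<le> (real P * A) * ((real (H * K) * C) * ((real H * real K / of_int q + 1) * (6 * real P + 2 * of_int q * lg)))"
  proof (rule mult_mono[OF A])
    show "(\<Sum>r\<in>{1..H*K}. divsum (\<lambda>k. norm (y k)) r ^ 2) * ?B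
        \<le> (real (H * K) * C) * ((real H * real K / of_int q + 1) * (6 * real P + 2 * of_int q * lg))"
      by (rule mult_mono'[OF C B _ B0]) (intro sum_nonneg zero_le_power2)
    show "0 \<le> (\<Sum>r\<in>{1..H*K}. divsum (\<lambda>k. norm (y k)) r ^ 2) * ?B"
      by (intro mult_nonneg_nonneg[OF _ B0] sum_nonneg zero_le_power2)
  qed (use AC in auto)
  also have "\<dots> = (A * C) * (real H * real K * real P * ((real H * real K / of_int q + 1) * (6 * real P + 2 * of_int q * lg)))"
    by (simp add: mult_ac)
  also have "\<dots> \<le> lg ^ 10 * (2 * Z * (12 * lg * (Z / of_int q + real H * sqrt (real N) + real N / V + of_int q)))"
  proof (rule mult_mono[OF AC(3) mult_mono[OF HKP]])
    have "(real H * real K / of_int q + 1) * (6 * real P + 2 * of_int q * lg)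
      = 6 * (real H * real K * real P / of_int q) + 2 * (real H * real K) * lg + 6 * real P + 2 * of_int q * lg"
      using q0 by (simp add: field_simps)
    also have "\<dots> \<le> 6 * (2 * Z / of_int q) + 2 * (4 * (real H * sqrt (real N))) * lg + 6 * (2 * real N / V) + 2 * of_int q * lg"
      using q0 lg1 P(3) by (intro add_mono mult_left_mono mult_right_mono divide_right_mono HKP HK) auto
    also have "\<dots> \<le> 12 * (lg * (Z / of_int q)) + 12 * (lg * (real H * sqrt (real N))) + 12 * (lg * (real N / V)) + 12 * (lg * of_int q)"
    proof (intro add_mono)
      have "1 * (Z / of_int q) \<le> lg * (Z / of_int q)" using lg1 Z_pos q0 by (intro mult_right_mono) auto
      then show "6 * (2 * Z / of_int q) \<le> 12 * (lg * (Z / of_int q))" by simp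
      have "1 * (real N / V) \<le> lg * (real N / V)" using lg1 V1 by (intro mult_right_mono) auto
      then show "6 * (2 * real N / V) \<le> 12 * (lg * (real N / V))" by simp
      have "0 \<le> lg * (real H * sqrt (real N))" using lg1 by simp
      then show "2 * (4 * (real H * sqrt (real N))) * lg \<le> 12 * (lg * (real H * sqrt (real N)))" by (simp add: mult_ac)
      show "2 * of_int q * lg \<le> 12 * (lg * of_int q)" using lg1 q0 by (simp add: mult_ac)
    qed
    also have "\<dots> = 12 * lg * (Z / of_int q + real H * sqrt (real N) + real N / V + of_int q)"
      by (simp add: algebra_simps)
    finally show "(real H * real K / of_int q + 1) * (6 * real P + 2 * of_int q * lg) \<le> \<dots>" .
  qed (use lg1 q0 Z_pos in \<open>auto intro!: add_nonneg_nonneg mult_nonneg_nonneg\<close>)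
  also have "\<dots> = 24 * lg ^ 11 * (Z * (Z / of_int q + real H * sqrt (real N) + real N / V + of_int q))"
    by (simp add: eval_nat_numeral mult_ac)
  finally have "sqrt ((\<Sum>m\<in>{M1<..M2}. norm (x m) ^ 2) * ((\<Sum>r\<in>{1..H*K}. divsum (\<lambda>k. norm (y k)) r ^ 2) * ?B)) \<le> type_II_root"
    unfolding type_II_root_def by (rule real_sqrt_le_mono)
  then show ?thesis using bilinear_bound[where a' = x and b' = y and H = H and K = K and N = N and ?M1.0 = M1 and ?M2.0 = M2] by linarith
qed

text \<open>This and the next three bounds supply \<open>A\<close> and \<open>C\<close> in
  \<open>block_bound\<close>. Either variable may be the outer one, so each of the two coefficients
  needs both a mean square and a mean square of its divisor sums.\<close>

lemma vaughan_side_sum: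
  assumes "\<And>m. m \<ge> 1 \<Longrightarrow> norm (x m) \<le> real (num_divisors m)" "real M2 \<le> 2 * real N"
  shows "(\<Sum>m\<in>{M1<..M2}. norm (x m :: complex) ^ 2) \<le> real M2 * lg ^ 3"
proof -
  have "(\<Sum>m\<in>{M1<..M2}. norm (x m) ^ 2) \<le> (\<Sum>m\<in>{M1<..M2}. real (num_divisors m) ^ 2)"
    by (intro sum_mono power_mono assms) auto
  also have "\<dots> \<le> (\<Sum>m\<in>{1..M2}. real (num_divisors m) ^ 2)" by (intro sum_mono2) auto
  also have "\<dots> \<le> real M2 * harm M2 ^ 3" by (rule sum_num_divisors_sq)
  also have "\<dots> \<le> real M2 * lg ^ 3"
  proof (intro mult_left_mono power_mono harm_le harm_nonneg)
    have "real M2 \<le> 2 * (1 * real N)" using assms(2) by simp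
    also have "\<dots> \<le> 4 * (real H * real N)" using H1 by (intro mult_mono) auto
    finally show "real M2 \<le> 4 * real H * real N" by (simp add: mult_ac)
  qed auto
  finally show ?thesis .
qed

lemma vaughan_side_divsum:
  assumes "\<And>k. k \<ge> 1 \<Longrightarrow> norm (y k) \<le> real (num_divisors k)" "K \<le> 4 * N"
  shows "(\<Sum>r\<in>{1..H * K}. divsum (\<lambda>k. norm (y k :: complex)) r ^ 2) \<le> real (H * K) * lg ^ 8"
proof -
  have "(\<Sum>r\<in>{1..H * K}. divsum (\<lambda>k. norm (y k)) r ^ 2) \<le> (\<Sum>r\<in>{1..H * K}. divsum (\<lambda>k. real (num_divisors k)) r ^ 2)"
    by (intro sum_mono power_mono sum_nonneg assms) (auto simp: Suc_le_eq intro: dvd_pos_nat)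
  also have "\<dots> \<le> real (H * K) * harm (H * K) ^ 8" by (rule sum_divsum_num_divisors_sq)
  also have "\<dots> \<le> real (H * K) * lg ^ 8"
  proof (intro mult_left_mono power_mono harm_le harm_nonneg)
    have "real (H * K) \<le> real (H * (4 * N))" using assms(2) by (simp only: of_nat_le_iff mult_le_mono2)
    then show "real (H * K) \<le> 4 * real H * real N" by (simp add: mult_ac)
  qed auto
  finally show ?thesis .
qed

lemma mangoldt_side_sum:
  assumes "\<And>m. m \<ge> 1 \<Longrightarrow> norm (x m) \<le> mangoldt m" "real M2 \<le> 2 * real N"
  shows "(\<Sum>m\<in>{M1<..M2}. norm (x m :: complex) ^ 2) \<le> real M2 * lg ^ 2"
proof -
  have "(\<Sum>m\<in>{M1<..M2}. norm (x m) ^ 2) \<le> (\<Sum>m\<in>{M1<..M2}. lg ^ 2)"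
  proof (intro sum_mono power_mono)
    fix m assume m: "m \<in> {M1<..M2}"
    have "real m \<le> 2 * (1 * real N)" using assms(2) m by simp
    also have "\<dots> \<le> 4 * (real H * real N)" using H1 by (intro mult_mono) auto
    finally have "ln (real m) \<le> lg" using m by (intro ln_le_l) (auto simp: mult_ac)
    then show "norm (x m) \<le> lg" using assms(1)[of m] mangoldt_le_ln[of m] m by auto
  qed auto
  also have "\<dots> \<le> real M2 * lg ^ 2" by (simp add: mult_right_mono)
  finally show ?thesis .
qed

lemma mangoldt_side_divsum:
  assumes "\<And>k. k \<ge> 1 \<Longrightarrow> norm (y k) \<le> mangoldt k" "K \<le> 4 * N"
  shows "(\<Sum>r\<in>{1..H * K}. divsum (\<lambda>k. norm (y k :: complex)) r ^ 2) \<le> real (H * K) * lg ^ 2"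
proof -
  have "(\<Sum>r\<in>{1..H * K}. divsum (\<lambda>k. norm (y k)) r ^ 2) \<le> (\<Sum>r\<in>{1..H * K}. lg ^ 2)"
  proof (intro sum_mono power_mono sum_nonneg)
    fix r assume r: "r \<in> {1..H * K}"
    have "divsum (\<lambda>k. norm (y k)) r \<le> divsum mangoldt r"
      using r by (intro sum_mono assms) (auto simp: Suc_le_eq intro: dvd_pos_nat)
    also have "\<dots> = ln (real r)" using r by (subst mangoldt_sum) auto
    also have "\<dots> \<le> lg"
    proof (rule ln_le_l)
      have "r \<le> H * (4 * N)" using r assms(2) by (meson atLeastAtMost_iff le_trans mult_le_mono2)
      then have "real r \<le> real (H * (4 * N))" by (simp only: of_nat_le_iff)
      then show "real r \<le> 4 * real H * real N" by (simp add: mult_ac)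
    qed (use r in auto)
    finally show "divsum (\<lambda>k. norm (y k)) r \<le> lg" .
  qed auto
  then show ?thesis by simp
qed

text \<open>\<open>block_bound\<close> wants the outer variable to be the longer one. The region is
  therefore cut at \<open>s\<close>, about the square root of \<open>N\<close>: a square with both
  variables at most \<open>s\<close>, dyadic ranges of \<open>k\<close> with
  \<open>m \<le> s\<close> and the roles exchanged, and dyadic ranges of \<open>m\<close> with all
  \<open>k\<close>.\<close>

lemma type_II:
  "(\<Sum>h\<in>{1..H}. norm (\<Sum>m | m \<in> {1..N} \<and> real m > V. \<Sum>k | k \<in> {1..N} \<and> real k > V \<and> m * k \<le> N.
        of_real (vaughan_coeff V m) * mangoldt k * ee (\<alpha> * real (h * (m * k))))) \<le> 3 * lg * type_II_root"
proof -
  define a' :: "nat \<Rightarrow> complex" where "a' m = (if real m > V then of_real (vaughan_coeff V m) else 0)" for m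
  define b' :: "nat \<Rightarrow> complex" where "b' k = (if real k > V then mangoldt k else 0)" for k
  define w where "w h m k = (if m * k \<le> N then a' m * b' k * ee (\<alpha> * real (h * m * k)) else 0)" for h m k
  have a'_le: "norm (a' m) \<le> real (num_divisors m)" if "m \<ge> 1" for m
    using that abs_vaughan_coeff_le by (simp add: a'_def)
  have b'_le: "norm (b' k) \<le> mangoldt k" for k by (simp add: b'_def mangoldt_nonneg)
  have V0: "V > 0" using V1 by simp
  define s where "s = nat \<lfloor>sqrt (real N)\<rfloor>"
  have s_le: "real s \<le> sqrt (real N)" by (simp add: s_def)
  have s_ge: "real s \<ge> sqrt (real N) / 2" "s \<ge> 1"
  proof -
    have 1: "sqrt (real N) \<ge> 1" using N1 by simp
    then have "\<lfloor>sqrt (real N)\<rfloor> \<ge> 1" by (simp only: one_le_floor)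
    then show "s \<ge> 1" unfolding s_def by linarith
    then have "real s \<ge> 1" by simp
    moreover have "real s > sqrt (real N) - 1" unfolding s_def using 1 by linarith
    ultimately show "real s \<ge> sqrt (real N) / 2" by linarith
  qed
  have ss: "s * s \<le> N"
  proof -
    have "real s * real s \<le> sqrt (real N) * sqrt (real N)" using s_le by (intro mult_mono) auto
    then have "real (s * s) \<le> real N" by simp
    then show ?thesis by (simp only: of_nat_le_iff)
  qed
  have VsN: "V * sqrt (real N) \<le> real N"
  proof -
    have "V \<le> sqrt (real N)" using V2 by (rule real_le_rsqrt)
    then have "V * sqrt (real N) \<le> sqrt (real N) * sqrt (real N)" by (intro mult_right_mono) auto
    then show ?thesis by simp
  qed
  have sNV: "real s \<le> real N / V"
  proof -
    have "V * real s \<le> V * sqrt (real N)" using s_le V0 by (intro mult_left_mono) auto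
    also note VsN
    finally show ?thesis using V0 by (simp add: pos_le_divide_eq mult.commute)
  qed
  \<comment> \<open>The least \<open>J\<close> for which \<open>2 ^ J * s\<close> reaches
    \<open>N / V\<close>; minimality keeps this end below \<open>2 * N / V\<close>, and for
    \<open>J = 0\<close> that follows from \<open>V \<le> sqrt N\<close>.\<close>
  define J where "J = (LEAST J. real N / V \<le> real (2 ^ J * s))"
  have ex: "\<exists>J. real N / V \<le> real (2 ^ J * s)"
  proof -
    obtain n where "real N / V < 2 ^ n" using real_arch_pow[of 2 "real N / V"] by auto
    moreover have "(2::real) ^ n * 1 \<le> 2 ^ n * real s" using s_ge(2) by (intro mult_left_mono) auto
    ultimately have "real N / V \<le> real (2 ^ n * s)"
      unfolding of_nat_mult of_nat_power of_nat_numeral by linarith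
    then show ?thesis by blast
  qed
  have J_ge: "real N / V \<le> real (2 ^ J * s)" unfolding J_def using ex by (rule LeastI_ex)
  have J_le: "real (2 ^ J * s) \<le> 2 * real N / V"
  proof (cases J)
    case 0
    have "real N / V \<ge> 0" using V0 by simp
    then show ?thesis using sNV 0 by simp
  next
    case (Suc i)
    then have "i < J" by simp
    then have "\<not> real N / V \<le> real (2 ^ i * s)" unfolding J_def by (rule not_less_Least)
    then show ?thesis using Suc by simp
  qed
  have NV: "2 * real N / V \<le> 2 * real N" using divide_left_mono[OF V1, of "2 * real N"] V0 by simp
  have J_card: "2 * real J + 1 \<le> 3 * lg"
  proof -
    have "(2::real) ^ J * 1 \<le> 2 ^ J * real s" using s_ge(2) by (intro mult_left_mono) auto
    moreover have "(2::real) ^ J * real s \<le> 2 * real N / V" using J_le by simp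
    ultimately have "(2::real) ^ J \<le> 2 * real N" using NV by linarith
    then have "ln ((2::real) ^ J) \<le> ln (2 * real N)" using N1 by (subst ln_le_cancel_iff) auto
    then have "real J * ln 2 \<le> ln 2 + ln (real N)" using N1 by (simp add: ln_realpow ln_mult)
    moreover have "real J * (2/3) \<le> real J * ln 2" using ln2_ge_two_thirds by (intro mult_left_mono) auto
    ultimately have "real J * (2/3) \<le> 1 + ln (real N)" using ln_2_less_1 by linarith
    \<comment> \<open>From \<open>2/3 * J \<le> 1 + ln N\<close> one gets
      \<open>2 * J + 1 \<le> 3 * (ln N + 4/3)\<close>. The 4/3 is paid by \<open>2 * ln 2\<close>,
      since \<open>lg\<close> dominates the harmonic number at \<open>4 * H * N\<close>.\<close>
    moreover have "ln (real N) + 4/3 \<le> lg"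
    proof -
      have "ln (real N) + 4/3 \<le> ln (real N) + 2 * ln 2" using ln2_ge_two_thirds by simp
      also have "\<dots> = ln (2 * (2 * real N))"
        using N1 ln_realpow[of 2 2] by (simp add: ln_mult)
      also have "\<dots> \<le> ln (real (4 * (H * N)) + 1)"
      proof -
        have "1 * real N \<le> real H * real N" using H1 by (intro mult_right_mono) auto
        then have "2 * (2 * real N) \<le> real (4 * (H * N)) + 1"
          unfolding of_nat_mult of_nat_numeral by linarith
        then show ?thesis using N1 by (intro ln_mono) auto
      qed
      also have "\<dots> \<le> harm (4 * (H * N))" by (rule harm_ge_ln)
      also have "\<dots> \<le> lg" by (rule harm_le) simp
      finally show ?thesis .
    qed
    ultimately show ?thesis using l49 by simp
  qed
  have block_le: "2 ^ Suc i * s \<le> 2 ^ J * s" if "i < J" for i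
    using that by (intro mult_le_mono1 power_increasing) auto
  have blockA: "(\<Sum>h\<in>{1..H}. norm (\<Sum>m\<in>{2 ^ i * s<..2 ^ Suc i * s}. \<Sum>k\<in>{1..N}. w h m k)) \<le> type_II_root" if i: "i < J" for i
  proof -
    \<comment> \<open>\<open>m > 2 ^ i * s\<close> and \<open>m * k \<le> N\<close> force
      \<open>k \<le> K\<close>. The right end of the block is twice the left one, hence
      \<open>K * P \<le> 2 * N\<close>.\<close>
    define K where "K = N div (2 ^ i * s)"
    have pos: "2 ^ i * s > 0" using s_ge(2) by simp
    have Ple: "real (2 ^ Suc i * s) \<le> 2 * real N / V"
      using block_le[OF i] J_le by (meson of_nat_le_iff order.trans)
    have eq: "(\<Sum>k\<in>{1..N}. w h m k) = (\<Sum>k | k \<in> {1..K} \<and> m * k \<le> N. a' m * b' k * ee (\<alpha> * real (h * m * k)))"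
      if m: "m \<in> {2 ^ i * s<..2 ^ Suc i * s}" for h m
    proof -
      have "k \<le> K" if "m * k \<le> N" for k
      proof -
        have "(2 ^ i * s) * k \<le> m * k" using m by (intro mult_le_mono1) auto
        also note that
        finally have "k * (2 ^ i * s) \<le> N" by (simp only: mult.commute)
        then show ?thesis unfolding K_def using pos by (simp add: less_eq_div_iff_mult_less_eq)
      qed
      moreover have "K \<le> N" unfolding K_def by (rule div_le_dividend)
      ultimately have "k \<le> K \<and> k \<le> N" if "m * k \<le> N" for k using that order.trans by blast
      then have "{k. k \<in> {1..K} \<and> m * k \<le> N} = {k. k \<in> {1..N} \<and> m * k \<le> N}" by auto
      then show ?thesis unfolding w_def sum_if_filter by simp
    qed
    have "(\<Sum>h\<in>{1..H}. norm (\<Sum>m\<in>{2 ^ i * s<..2 ^ Suc i * s}. \<Sum>k | k \<in> {1..K} \<and> m * k \<le> N. a' m * b' k * ee (\<alpha> * real (h * m * k)))) \<le> type_II_root"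
    proof (rule block_bound[where P = "2 ^ Suc i * s" and A = "lg ^ 3" and C = "lg ^ 2"])
      show "real (2 ^ Suc i * s) \<ge> sqrt (real N) / 2"
      proof -
        have "1 * real s \<le> 2 ^ Suc i * real s" by (intro mult_right_mono one_le_power) auto
        then show ?thesis using s_ge(1) by simp
      qed
      have "K * (2 ^ i * s) \<le> N" unfolding K_def by (rule div_times_less_eq_dividend)
      then show "K * (2 ^ Suc i * s) \<le> 2 * N" by simp
      show "(\<Sum>m\<in>{2 ^ i * s<..2 ^ Suc i * s}. norm (a' m) ^ 2) \<le> real (2 ^ Suc i * s) * lg ^ 3"
        using Ple NV by (intro vaughan_side_sum a'_le) auto
      have "K \<le> N" unfolding K_def by (rule div_le_dividend)
      then show "(\<Sum>r\<in>{1..H * K}. divsum (\<lambda>k. norm (b' k)) r ^ 2) \<le> real (H * K) * lg ^ 2"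
        by (intro mangoldt_side_divsum b'_le) auto
      show "lg ^ 3 * lg ^ 2 \<le> lg ^ 10"
        unfolding power_add[symmetric] using l49 by (intro power_increasing) auto
    qed (use Ple l49 in auto)
    then show ?thesis by (simp only: eq cong: sum.cong)
  qed
  \<comment> \<open>The outer variable is now \<open>k\<close>, with the Mangoldt weight;
    \<open>cov\<close> says that the range of \<open>m\<close> may be shortened to \<open>K\<close>
    without losing a term.\<close>
  have blockB: "(\<Sum>h\<in>{1..H}. norm (\<Sum>m\<in>{0<..s}. \<Sum>k\<in>{M1<..P}. w h m k)) \<le> type_II_root"
    if P: "real P \<ge> sqrt (real N) / 2" "real P \<le> 2 * real N / V" and K: "K * P \<le> 2 * N" "K \<le> s"
      and cov: "\<And>m k. M1 < k \<Longrightarrow> m \<le> s \<Longrightarrow> m * k \<le> N \<Longrightarrow> m \<le> K" for M1 P K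
  proof -
    have eq: "(\<Sum>m\<in>{0<..s}. \<Sum>k\<in>{M1<..P}. w h m k) = (\<Sum>k\<in>{M1<..P}. \<Sum>m | m \<in> {1..K} \<and> k * m \<le> N. b' k * a' m * ee (\<alpha> * real (h * k * m)))" for h
    proof -
      have "(\<Sum>m\<in>{0<..s}. \<Sum>k\<in>{M1<..P}. w h m k) = (\<Sum>k\<in>{M1<..P}. \<Sum>m\<in>{0<..s}. w h m k)" by (rule sum.swap)
      also have "\<dots> = (\<Sum>k\<in>{M1<..P}. \<Sum>m | m \<in> {1..K} \<and> k * m \<le> N. b' k * a' m * ee (\<alpha> * real (h * k * m)))"
      proof (rule sum.cong[OF refl])
        fix k assume k: "k \<in> {M1<..P}"
        have "{0<..s} = {1..s}" by auto
        moreover have "{m. m \<in> {1..s} \<and> m * k \<le> N} = {m. m \<in> {1..K} \<and> k * m \<le> N}"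
          using cov[of k] k K(2) by (auto simp: mult.commute)
        ultimately have "(\<Sum>m\<in>{0<..s}. w h m k) = (\<Sum>m | m \<in> {1..K} \<and> k * m \<le> N. a' m * b' k * ee (\<alpha> * real (h * m * k)))"
          unfolding w_def by (simp only: sum_if_filter)
        then show "(\<Sum>m\<in>{0<..s}. w h m k) = (\<Sum>m | m \<in> {1..K} \<and> k * m \<le> N. b' k * a' m * ee (\<alpha> * real (h * k * m)))"
          by (simp add: mult_ac)
      qed
      finally show ?thesis .
    qed
    have "real P \<le> 2 * real N" using P(2) NV by linarith
    moreover have KN: "K \<le> N" using K(2) ss le_square[of s] by linarith
    ultimately show ?thesis unfolding eq
    proof (intro block_bound[where P = P and A = "lg ^ 2" and C = "lg ^ 8"])
      show "lg ^ 2 * lg ^ 8 \<le> lg ^ 10" by (simp flip: power_add)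
      show "(\<Sum>r\<in>{1..H * K}. divsum (\<lambda>k. norm (a' k)) r ^ 2) \<le> real (H * K) * lg ^ 8"
        using KN by (intro vaughan_side_divsum a'_le) auto
    qed (use P K l49 in \<open>auto intro!: mangoldt_side_sum b'_le\<close>)
  qed
  define T where "T = 2 ^ J * s"
  have sT: "s \<le> T" by (simp add: T_def)
  \<comment> \<open>If one variable exceeds \<open>T \<ge> N / V\<close>, then the other is below
    \<open>V\<close>, where its coefficient is cut to 0.\<close>
  have w_zero: "w h m k = 0" if "m > T \<or> k > T" "m \<ge> 1" "k \<ge> 1" for h m k
  proof (rule ccontr)
    assume "w h m k \<noteq> 0"
    then have mk: "m * k \<le> N" "real m > V" "real k > V"
      by (auto simp: w_def a'_def b'_def split: if_splits)
    then have "real m * real k \<le> real N" by (simp flip: of_nat_mult)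
    moreover have "real m * V \<le> real m * real k" "V * real k \<le> real m * real k"
      using mk by (intro mult_left_mono mult_right_mono; simp)+
    ultimately have "real m \<le> real N / V" "real k \<le> real N / V" using V0 by (simp_all add: field_simps)
    then have "real m \<le> real T" "real k \<le> real T" using J_ge unfolding T_def by linarith+
    then show False using that by simp
  qed
  have w_N: "w h m k = 0" if "m > N \<or> k > N" "m \<ge> 1" "k \<ge> 1" for h m k
    using that mult_le_imp_le[of m k N] mult_le_imp_le[of k m N] by (auto simp: w_def mult.commute)
  have w_out: "w h m k = 0" if "m > T \<or> k > T \<or> m > N \<or> k > N" "m \<ge> 1" "k \<ge> 1" for h m k
    using w_zero w_N that by blast
  have decomp: "(\<Sum>m | m \<in> {1..N} \<and> real m > V. \<Sum>k | k \<in> {1..N} \<and> real k > V \<and> m * k \<le> N.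
        of_real (vaughan_coeff V m) * mangoldt k * ee (\<alpha> * real (h * (m * k))))
    = (\<Sum>m\<in>{0<..s}. \<Sum>k\<in>{0<..s}. w h m k)
      + (\<Sum>i<J. \<Sum>m\<in>{0<..s}. \<Sum>k\<in>{2 ^ i * s<..2 ^ Suc i * s}. w h m k)
      + (\<Sum>i<J. \<Sum>m\<in>{2 ^ i * s<..2 ^ Suc i * s}. \<Sum>k\<in>{1..N}. w h m k)" for h
  proof -
    have "(\<Sum>m | m \<in> {1..N} \<and> real m > V. \<Sum>k | k \<in> {1..N} \<and> real k > V \<and> m * k \<le> N.
        of_real (vaughan_coeff V m) * mangoldt k * ee (\<alpha> * real (h * (m * k))))
      = (\<Sum>m\<in>{1..N}. \<Sum>k\<in>{1..N}. w h m k)"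
      unfolding sum_if_filter[symmetric]
      by (intro sum.cong refl) (auto simp: w_def a'_def b'_def mult_ac intro!: sum.cong sum.neutral)
    \<comment> \<open>\<open>T\<close> may lie on either side of \<open>N\<close>; the terms in
      which the two ranges differ vanish.\<close>
    also have "\<dots> = (\<Sum>m\<in>{0<..T}. \<Sum>k\<in>{1..N}. w h m k)"
      by (rule sum.mono_neutral_cong) (auto intro!: sum.neutral w_out)
    also have "{0<..T} = {0<..s} \<union> {s<..T}" using sT by auto
    also have "(\<Sum>m\<in>{0<..s} \<union> {s<..T}. \<Sum>k\<in>{1..N}. w h m k) = (\<Sum>m\<in>{0<..s}. \<Sum>k\<in>{1..N}. w h m k) + (\<Sum>m\<in>{s<..T}. \<Sum>k\<in>{1..N}. w h m k)"
      by (rule sum.union_disjoint) auto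
    also have "(\<Sum>m\<in>{s<..T}. \<Sum>k\<in>{1..N}. w h m k) = (\<Sum>i<J. \<Sum>m\<in>{2 ^ i * s<..2 ^ Suc i * s}. \<Sum>k\<in>{1..N}. w h m k)"
      unfolding T_def by (rule sum_dyadic_blocks)
    also have "(\<Sum>m\<in>{0<..s}. \<Sum>k\<in>{1..N}. w h m k) = (\<Sum>m\<in>{0<..s}. (\<Sum>k\<in>{0<..s}. w h m k) + (\<Sum>i<J. \<Sum>k\<in>{2 ^ i * s<..2 ^ Suc i * s}. w h m k))"
    proof (rule sum.cong[OF refl])
      fix m assume m: "m \<in> {0<..s}"
      have "(\<Sum>k\<in>{1..N}. w h m k) = (\<Sum>k\<in>{0<..T}. w h m k)"
        using m by (intro sum.mono_neutral_cong) (auto intro!: w_out)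
      also have "{0<..T} = {0<..s} \<union> {s<..T}" using sT by auto
      also have "(\<Sum>k\<in>{0<..s} \<union> {s<..T}. w h m k) = (\<Sum>k\<in>{0<..s}. w h m k) + (\<Sum>k\<in>{s<..T}. w h m k)"
        by (rule sum.union_disjoint) auto
      also have "(\<Sum>k\<in>{s<..T}. w h m k) = (\<Sum>i<J. \<Sum>k\<in>{2 ^ i * s<..2 ^ Suc i * s}. w h m k)"
        unfolding T_def by (rule sum_dyadic_blocks)
      finally show "(\<Sum>k\<in>{1..N}. w h m k) = (\<Sum>k\<in>{0<..s}. w h m k) + (\<Sum>i<J. \<Sum>k\<in>{2 ^ i * s<..2 ^ Suc i * s}. w h m k)" .
    qed
    also have "\<dots> = (\<Sum>m\<in>{0<..s}. \<Sum>k\<in>{0<..s}. w h m k) + (\<Sum>i<J. \<Sum>m\<in>{0<..s}. \<Sum>k\<in>{2 ^ i * s<..2 ^ Suc i * s}. w h m k)"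
      unfolding sum.distrib by (intro arg_cong2[of _ _ _ _ "(+)"] refl sum.swap)
    finally show ?thesis .
  qed
  have "(\<Sum>h\<in>{1..H}. norm (\<Sum>m | m \<in> {1..N} \<and> real m > V. \<Sum>k | k \<in> {1..N} \<and> real k > V \<and> m * k \<le> N.
        of_real (vaughan_coeff V m) * mangoldt k * ee (\<alpha> * real (h * (m * k)))))
    \<le> (\<Sum>h\<in>{1..H}. norm (\<Sum>m\<in>{0<..s}. \<Sum>k\<in>{0<..s}. w h m k)
      + (\<Sum>i<J. norm (\<Sum>m\<in>{0<..s}. \<Sum>k\<in>{2 ^ i * s<..2 ^ Suc i * s}. w h m k))
      + (\<Sum>i<J. norm (\<Sum>m\<in>{2 ^ i * s<..2 ^ Suc i * s}. \<Sum>k\<in>{1..N}. w h m k)))"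
    unfolding decomp by (intro sum_mono norm_triangle_le add_mono norm_sum order.refl)
  also have "\<dots> = (\<Sum>h\<in>{1..H}. norm (\<Sum>m\<in>{0<..s}. \<Sum>k\<in>{0<..s}. w h m k))
      + (\<Sum>i<J. \<Sum>h\<in>{1..H}. norm (\<Sum>m\<in>{0<..s}. \<Sum>k\<in>{2 ^ i * s<..2 ^ Suc i * s}. w h m k))
      + (\<Sum>i<J. \<Sum>h\<in>{1..H}. norm (\<Sum>m\<in>{2 ^ i * s<..2 ^ Suc i * s}. \<Sum>k\<in>{1..N}. w h m k))"
    unfolding sum.distrib by (intro arg_cong2[of _ _ _ _ "(+)"] refl sum.swap)
  also have "\<dots> \<le> type_II_root + (\<Sum>i<J. type_II_root) + (\<Sum>i<J. type_II_root)"
  proof (intro add_mono sum_mono)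
    have "real s \<le> 2 * real N / V" using sNV V0 by (simp add: field_simps)
    then show "(\<Sum>h\<in>{1..H}. norm (\<Sum>m\<in>{0<..s}. \<Sum>k\<in>{0<..s}. w h m k)) \<le> type_II_root"
      using s_ge ss by (intro blockB[where K = s]) auto
  next
    fix i assume i: "i \<in> {..<J}"
    show "(\<Sum>h\<in>{1..H}. norm (\<Sum>m\<in>{2 ^ i * s<..2 ^ Suc i * s}. \<Sum>k\<in>{1..N}. w h m k)) \<le> type_II_root"
      using i by (intro blockA) auto
    define K where "K = min s (N div (2 ^ i * s))"
    have pos: "2 ^ i * s > 0" using s_ge(2) by simp
    show "(\<Sum>h\<in>{1..H}. norm (\<Sum>m\<in>{0<..s}. \<Sum>k\<in>{2 ^ i * s<..2 ^ Suc i * s}. w h m k)) \<le> type_II_root"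
    proof (rule blockB[where K = K])
      have "1 * real s \<le> 2 ^ Suc i * real s" by (intro mult_right_mono one_le_power) auto
      then show "sqrt (real N) / 2 \<le> real (2 ^ Suc i * s)" using s_ge(1) by simp
      show "real (2 ^ Suc i * s) \<le> 2 * real N / V"
        using block_le[of i] i J_le by (meson lessThan_iff of_nat_le_iff order.trans)
      have "K * (2 ^ i * s) \<le> N div (2 ^ i * s) * (2 ^ i * s)" unfolding K_def by (intro mult_le_mono1) auto
      also have "\<dots> \<le> N" by (rule div_times_less_eq_dividend)
      finally show "K * (2 ^ Suc i * s) \<le> 2 * N" by simp
      show "K \<le> s" by (simp add: K_def)
      fix m k assume mk: "2 ^ i * s < k" "m \<le> s" "m * k \<le> N"
      have "m * (2 ^ i * s) \<le> m * k" using mk by (intro mult_le_mono2) auto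
      then have "m * (2 ^ i * s) \<le> N" using mk by linarith
      then have "m \<le> N div (2 ^ i * s)" using pos by (simp add: less_eq_div_iff_mult_less_eq)
      then show "m \<le> K" using mk by (simp add: K_def)
    qed
  qed
  also have "\<dots> = (2 * real J + 1) * type_II_root" by (simp add: algebra_simps)
  also have "\<dots> \<le> 3 * lg * type_II_root"
    using J_card Z_pos V0 q_pos l49 unfolding type_II_root_def
    by (intro mult_right_mono real_sqrt_ge_zero mult_nonneg_nonneg add_nonneg_nonneg) auto
  finally show ?thesis .
qed

end

section \<open>Exponential sums over primes on average\<close>

definition exp_sums :: "real \<Rightarrow> nat \<Rightarrow> nat \<Rightarrow> real"
  where "exp_sums \<alpha> N H = (\<Sum>h\<in>{1..H}. norm (\<Sum>n\<in>{1..N}. mangoldt n * ee (\<alpha> * real (h * n))))"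

lemma sum_squares_le_square_sum:
  fixes a b c d :: real
  assumes "a \<ge> 0" "b \<ge> 0" "c \<ge> 0" "d \<ge> 0"
  shows "a ^ 2 + b ^ 2 + c ^ 2 + d ^ 2 \<le> (a + b + c + d) ^ 2"
proof -
  have "0 \<le> a*b + a*c + a*d + b*c + b*d + c*d"
    using assms by (intro add_nonneg_nonneg mult_nonneg_nonneg)
  then have "a ^ 2 + b ^ 2 + c ^ 2 + d ^ 2 \<le> a ^ 2 + b ^ 2 + c ^ 2 + d ^ 2 + 2 * (a*b + a*c + a*d + b*c + b*d + c*d)"
    by simp
  also have "\<dots> = (a + b + c + d) ^ 2" by (simp add: power2_eq_square algebra_simps)
  finally show ?thesis .
qed

lemma powr_squared: "(x powr a) ^ 2 = x powr (2 * a)" for x a :: real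
  by (simp add: power2_eq_square powr_add[symmetric])

context vaughan_setup
begin

lemma exp_sums_le: "exp_sums \<alpha> N H \<le> real H * (V * lg) + 2 * lg * G + 3 * lg * type_II_root"
proof -
  let ?f = "\<lambda>h n. ee (\<alpha> * real (h * n))"
  let ?S0 = "\<lambda>h. (\<Sum>n | n \<in> {1..N} \<and> real n \<le> V. mangoldt n * ?f h n)"
  let ?S1 = "\<lambda>h. (\<Sum>d | d \<in> {1..N} \<and> real d \<le> V. of_real (moebius_mu d) *
     (\<Sum>j | j \<in> {1..N} \<and> d * j \<le> N. of_real (ln (real j)) * ?f h (d * j)))"
  let ?S2 = "\<lambda>h. (\<Sum>d | d \<in> {1..N} \<and> real d \<le> V. \<Sum>k | k \<in> {1..N} \<and> real k \<le> V.
      of_real (moebius_mu d) * mangoldt k * (\<Sum>m | m \<in> {1..N} \<and> d * k * m \<le> N. ?f h (d * k * m)))"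
  let ?S3 = "\<lambda>h. (\<Sum>m | m \<in> {1..N} \<and> real m > V. \<Sum>k | k \<in> {1..N} \<and> real k > V \<and> m * k \<le> N.
        of_real (vaughan_coeff V m) * mangoldt k * ?f h (m * k))"
  have "norm (\<Sum>n\<in>{1..N}. mangoldt n * ?f h n) \<le> norm (?S0 h) + norm (?S1 h) + norm (?S2 h) + norm (?S3 h)" for h
    unfolding vaughan_identity[OF V1, where N = N and f = "?f h"]
    by (intro norm_triangle_le norm_triangle_le_diff add_mono order.refl)
  then have "exp_sums \<alpha> N H \<le> (\<Sum>h\<in>{1..H}. norm (?S0 h) + norm (?S1 h) + norm (?S2 h) + norm (?S3 h))"
    unfolding exp_sums_def by (intro sum_mono)
  also have "\<dots> \<le> real H * (V * lg) + lg * G + lg * G + 3 * lg * type_II_root"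
    unfolding sum.distrib by (intro add_mono small_part type_I_log type_I type_II)
  finally show ?thesis by simp
qed

text \<open>The squares of \<open>e1\<close>, ..., \<open>e4\<close> are the four terms under the root in \<open>type_II_root\<close>.\<close>

definition e1 :: real where "e1 = Z / sqrt (of_int q)"
definition e2 :: real where "e2 = real H * real N powr (3/4)"
definition e3 :: real where "e3 = sqrt (Z * (real N / V))"
definition e4 :: real where "e4 = sqrt (Z * of_int q)"

lemma e_nonneg: "e1 \<ge> 0" "e2 \<ge> 0" "e3 \<ge> 0" "e4 \<ge> 0"
  using Z_pos V1 q_pos by (auto simp: e1_def e2_def e3_def e4_def intro!: mult_nonneg_nonneg divide_nonneg_nonneg)

lemma e_sq: "e1 ^ 2 = Z * (Z / of_int q)" "e2 ^ 2 = Z * (real H * sqrt (real N))"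
  "e3 ^ 2 = Z * (real N / V)" "e4 ^ 2 = Z * of_int q"
proof -
  show "e1 ^ 2 = Z * (Z / of_int q)" "e3 ^ 2 = Z * (real N / V)" "e4 ^ 2 = Z * of_int q"
    using Z_pos V1 q_pos by (simp_all add: e1_def e3_def e4_def power_divide power2_eq_square)
  have "(real N powr (3/4)) ^ 2 = real N powr (1 + 1/2)" by (simp add: powr_squared)
  also have "\<dots> = real N * sqrt (real N)" unfolding powr_add using N1 by (simp add: powr_half_sqrt)
  finally show "e2 ^ 2 = Z * (real H * sqrt (real N))"
    by (simp add: e2_def Z_def power_mult_distrib power2_eq_square)
qed

lemma type_II_root_le: "type_II_root \<le> 5 / 7 * lg ^ 6 * (e1 + e2 + e3 + e4)"
  unfolding type_II_root_def
proof (rule real_le_lsqrt)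
  have "24 * lg ^ 11 * (Z * (Z / of_int q + real H * sqrt (real N) + real N / V + of_int q))
    = 24 * lg ^ 11 * (e1 ^ 2 + e2 ^ 2 + e3 ^ 2 + e4 ^ 2)"
    unfolding e_sq by (simp add: distrib_left)
  \<comment> \<open>\<open>lg \<ge> 49\<close> gives \<open>24 \<le> 25 / 49 * lg\<close>, a
    constant with an exact root, and the spare \<open>lg\<close> completes \<open>lg ^ 11\<close> to
    a square.\<close>
  also have "\<dots> \<le> (25 / 49 * lg) * lg ^ 11 * (e1 + e2 + e3 + e4) ^ 2"
    using l49 by (intro mult_mono sum_squares_le_square_sum e_nonneg) (auto intro!: add_nonneg_nonneg)
  also have "\<dots> = (5 / 7 * lg ^ 6 * (e1 + e2 + e3 + e4)) ^ 2"
    by (simp add: power_mult_distrib power_divide power_Suc[symmetric] flip: power_mult)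
  finally show "24 * lg ^ 11 * (Z * (Z / of_int q + real H * sqrt (real N) + real N / V + of_int q)) \<le> \<dots>" .
qed (use l49 e_nonneg in \<open>auto intro!: add_nonneg_nonneg\<close>)

text \<open>No pointwise bound for the divisor function enters. The price of Cauchy's inequality is
  that \<open>H * V ^ 2\<close> stands under the root together with \<open>Z\<close>.\<close>

lemma G_le_large: "G \<le> lg ^ 3 * (e1 + sqrt (Z * (real H * V ^ 2)) + e4)"
proof (rule power2_le_imp_le)
  let ?e = "sqrt (Z * (real H * V ^ 2))"
  have e: "?e \<ge> 0" "?e ^ 2 = Z * (real H * V ^ 2)" using Z_pos by auto
  have "G ^ 2 \<le> Z * lg ^ 4 * (12 * lg * (Z / of_int q + real H * V ^ 2 + of_int q))"
    using Z_pos l49 R_le(1) by (intro order.trans[OF G_sq_le] mult_left_mono add_mono order.refl) auto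
  also have "\<dots> = 12 * lg ^ 5 * (e1 ^ 2 + ?e ^ 2 + 0 ^ 2 + e4 ^ 2)"
    unfolding e_sq e(2) by (simp add: eval_nat_numeral algebra_simps)
  also have "\<dots> \<le> lg * lg ^ 5 * (e1 + ?e + 0 + e4) ^ 2"
    using l49 by (intro mult_mono sum_squares_le_square_sum e_nonneg e) (auto intro!: add_nonneg_nonneg)
  also have "\<dots> = (lg ^ 3 * (e1 + ?e + e4)) ^ 2"
    by (simp add: power_mult_distrib flip: power_mult power_Suc)
  finally show "G ^ 2 \<le> \<dots>" .
qed (use l49 e_nonneg Z_pos in auto)

text \<open>If \<open>H * v ^ 2\<close> does not exceed \<open>Z / q + q\<close>, Cauchy's
  inequality already gives the first two terms without \<open>D\<close>. Otherwise
  \<open>Z / q + q\<close> is absorbed by the number of terms, so that \<open>D\<close> multiplies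
  \<open>H * V ^ 2\<close> only and never the terms with \<open>q\<close>.\<close>

lemma G_le_small:
  assumes D: "\<And>s. 1 \<le> s \<Longrightarrow> real s \<le> real H * V ^ 2 \<Longrightarrow> real (num_divisors s) \<le> D" and "D \<ge> 0"
  shows "G \<le> lg ^ 3 * (e1 + e4) + 24 * lg * D * (real H * V ^ 2)"
proof (cases "real (H * (v * v)) \<le> Z / of_int q + of_int q")
  case True
  have "G \<le> lg ^ 3 * (e1 + e4)"
  proof (rule power2_le_imp_le)
    have "G ^ 2 \<le> Z * lg ^ 4 * (12 * lg * (2 * (Z / of_int q + of_int q)))"
      using Z_pos l49 True by (intro order.trans[OF G_sq_le] mult_left_mono) auto
    also have "\<dots> = 24 * lg ^ 5 * (e1 ^ 2 + 0 ^ 2 + 0 ^ 2 + e4 ^ 2)"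
      unfolding e_sq by (simp add: eval_nat_numeral algebra_simps)
    also have "\<dots> \<le> lg * lg ^ 5 * (e1 + 0 + 0 + e4) ^ 2"
      using l49 by (intro mult_mono sum_squares_le_square_sum e_nonneg) (auto intro!: add_nonneg_nonneg)
    also have "\<dots> = (lg ^ 3 * (e1 + e4)) ^ 2"
      by (simp add: power_mult_distrib flip: power_mult power_Suc)
    finally show "G ^ 2 \<le> \<dots>" .
  qed (use l49 e_nonneg in auto)
  moreover have "0 \<le> 24 * lg * D * (real H * V ^ 2)" using l49 \<open>D \<ge> 0\<close> by simp
  ultimately show ?thesis by linarith
next
  case False
  have "G \<le> D * (12 * lg * (Z / of_int q + real (H * (v * v)) + of_int q))"
  proof (rule G_le_divisor_bound)
    fix s assume s: "s \<in> {1..H * (v * v)}"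
    then have "real s \<le> real (H * (v * v))" by (simp only: of_nat_le_iff atLeastAtMost_iff)
    then show "real (num_divisors s) \<le> D" using s R_le(1) by (intro D) auto
  qed fact
  also have "\<dots> \<le> D * (12 * lg * (2 * (real H * V ^ 2)))"
    using False R_le(1) l49 \<open>D \<ge> 0\<close> by (intro mult_left_mono) auto
  also have "\<dots> = 24 * lg * D * (real H * V ^ 2)" by simp
  moreover have "0 \<le> lg ^ 3 * (e1 + e4)" using l49 e_nonneg by simp
  ultimately show ?thesis by linarith
qed

section \<open>The two choices of the cut-off \<open>V\<close>\<close>

lemma lg_powers: "lg \<le> lg ^ 7" "lg ^ 4 \<le> lg ^ 7 / 100"
proof -
  have "lg ^ 1 \<le> lg ^ 7" using l49 by (intro power_increasing) auto
  then show "lg \<le> lg ^ 7" by simp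
  have "100 \<le> lg ^ 3" using l49 power_mono[of 49 lg 3] by simp
  then have "lg ^ 4 * 100 \<le> lg ^ 4 * lg ^ 3" using l49 by (intro mult_left_mono) auto
  then show "lg ^ 4 \<le> lg ^ 7 / 100" unfolding power_add[symmetric] by simp
qed

text \<open>With this \<open>V\<close>, \<open>sqrt (Z * (H * V ^ 2))\<close> is exactly
  \<open>e2\<close>, and the lower bound on \<open>H\<close> gives
  \<open>N / V \<le> H * sqrt N\<close>, hence \<open>e3 \<le> e2\<close>.\<close>

lemma exp_sums_large:
  assumes V: "V = real N powr (1/4)" and H: "real H \<ge> real N powr (1/4)"
  shows "exp_sums \<alpha> N H \<le> 6 * lg ^ 7 * (e1 + e2 + e4)"
proof -
  have N0: "real N > 0" "real N \<ge> 1" using N1 by auto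
  have e5: "sqrt (Z * (real H * V ^ 2)) = e2"
  proof -
    have "V ^ 2 = sqrt (real N)"
      unfolding V powr_squared by (simp add: powr_half_sqrt)
    then have "sqrt (Z * (real H * V ^ 2)) = sqrt (e2 ^ 2)" unfolding e_sq by simp
    then show ?thesis using e_nonneg by simp
  qed
  have e3: "e3 \<le> e2"
  proof (rule power2_le_imp_le)
    have "real N / V \<le> real H * sqrt (real N)"
    proof -
      have "real N / V = real N powr (1/4) * real N powr (1/2)"
        unfolding V powr_add[symmetric] using N0 powr_diff[of "real N" 1 "1/4"] by simp
      also have "\<dots> \<le> real H * sqrt (real N)"
        unfolding powr_half_sqrt[OF order.strict_implies_order[OF N0(1)]] using H by (intro mult_right_mono) auto
      finally show ?thesis .
    qed
    then show "e3 ^ 2 \<le> e2 ^ 2" unfolding e_sq using Z_pos by (intro mult_left_mono) auto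
  qed (rule e_nonneg)
  have "V \<le> real N powr (3/4)" unfolding V using N0 by (intro powr_mono) auto
  then have "real H * V * lg \<le> e2 * lg" unfolding e2_def using l49 by (intro mult_right_mono mult_left_mono) auto
  then have "real H * (V * lg) \<le> e2 * lg" by (simp only: mult.assoc)
  moreover have "e2 * lg \<le> e2 * lg ^ 7" using lg_powers e_nonneg by (intro mult_left_mono) auto
  moreover have "2 * lg * G \<le> 2 * lg * (lg ^ 3 * (e1 + e2 + e4))"
    using G_le_large l49 unfolding e5 by (intro mult_left_mono) auto
  moreover have "2 * lg * (lg ^ 3 * (e1 + e2 + e4)) = 2 * (lg ^ 4 * (e1 + e2 + e4))"
    by (simp add: eval_nat_numeral)
  moreover have "lg ^ 4 * (e1 + e2 + e4) \<le> lg ^ 7 / 100 * (e1 + e2 + e4)"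
    using lg_powers e_nonneg by (intro mult_right_mono) auto
  moreover have "3 * lg * type_II_root \<le> 3 * lg * (5 / 7 * lg ^ 6 * (e1 + e2 + e2 + e4))"
  proof (rule mult_left_mono)
    have "5 / 7 * lg ^ 6 * (e1 + e2 + e3 + e4) \<le> 5 / 7 * lg ^ 6 * (e1 + e2 + e2 + e4)"
      using e3 l49 by (intro mult_left_mono add_mono) auto
    then show "type_II_root \<le> 5 / 7 * lg ^ 6 * (e1 + e2 + e2 + e4)" using type_II_root_le by linarith
  qed (use l49 in auto)
  moreover have "3 * lg * (5 / 7 * lg ^ 6 * (e1 + e2 + e2 + e4)) = 15 / 7 * (lg ^ 7 * (e1 + e2 + e2 + e4))"
    by (simp add: eval_nat_numeral)
  moreover have "lg ^ 7 * e1 \<ge> 0" "lg ^ 7 * e2 \<ge> 0" "lg ^ 7 * e4 \<ge> 0" using l49 e_nonneg by auto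
  ultimately have "real H * (V * lg) + 2 * lg * G + 3 * lg * type_II_root \<le> 6 * lg ^ 7 * (e1 + e2 + e4)"
    by (simp add: algebra_simps)
  then show ?thesis using exp_sums_le by linarith
qed

text \<open>This \<open>V\<close> solves \<open>H * V ^ 2 = e3\<close>, so that the single quantity
  \<open>w\<close> carries both the type I and the type II contribution of the cut-off.\<close>

lemma exp_sums_small:
  assumes V: "V = real N powr (2/5) * real H powr (-1/5)"
    and D: "\<And>s. 1 \<le> s \<Longrightarrow> real s \<le> real H powr (3/5) * real N powr (4/5) \<Longrightarrow> real (num_divisors s) \<le> D" and "D \<ge> 0"
  shows "exp_sums \<alpha> N H \<le> 6 * lg ^ 7 * (e1 + e2 + e4)
    + (3 * lg ^ 7 + 48 * lg ^ 2 * D) * (real H powr (3/5) * real N powr (4/5))"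
proof -
  have N0: "real N > 0" "real N \<ge> 1" and H0: "real H > 0" "real H \<ge> 1" using N1 H1 by auto
  define w where "w = real H powr (3/5) * real N powr (4/5)"
  have w0: "w \<ge> 0" by (simp add: w_def)
  have HV: "real H * V ^ 2 = w"
  proof -
    have "V ^ 2 = real N powr (4/5) * real H powr (-2/5)"
      unfolding V power_mult_distrib powr_squared by simp
    moreover have "real H * real H powr (-2/5) = real H powr (3/5)"
      using H0 powr_add[of "real H" 1 "-2/5"] by simp
    ultimately show ?thesis by (simp add: w_def mult_ac)
  qed
  have e3: "e3 = w"
  proof -
    have "V > 0" unfolding V using N0 H0 by simp
    have "w ^ 2 * V = Z * real N"
    proof -
      have "w ^ 2 * V = real H powr (6/5 + -1/5) * real N powr (8/5 + 2/5)"
        unfolding V w_def power_mult_distrib power2_eq_square powr_add by (simp add: powr_add[symmetric])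
          (simp add: mult_ac powr_add[symmetric])
      also have "\<dots> = real H * (real N powr 2)" using H0 by simp
      finally show ?thesis using N0 by (simp add: Z_def power2_eq_square)
    qed
    then have "w ^ 2 = Z * (real N / V)" using \<open>V > 0\<close> by (simp add: field_simps)
    then show ?thesis unfolding e3_def using w0 by (metis real_sqrt_unique)
  qed
  have "V \<le> real N powr (3/4)"
  proof -
    have "real H powr (-1/5) \<le> 1" using powr_mono[of "-1/5" 0 "real H"] H0 by simp
    then have "real N powr (2/5) * real H powr (-1/5) \<le> real N powr (3/4) * 1"
      using N0 by (intro mult_mono powr_mono) auto
    then show ?thesis by (simp add: V)
  qed
  then have "real H * V * lg \<le> e2 * lg" unfolding e2_def using l49 by (intro mult_right_mono mult_left_mono) auto
  then have "real H * (V * lg) \<le> e2 * lg" by (simp only: mult.assoc)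
  moreover have "e2 * lg \<le> e2 * lg ^ 7" using lg_powers e_nonneg by (intro mult_left_mono) auto
  moreover have "G \<le> lg ^ 3 * (e1 + e4) + 24 * lg * D * w"
    unfolding HV[symmetric] by (rule G_le_small) (use D \<open>D \<ge> 0\<close> in \<open>auto simp: HV w_def\<close>)
  then have "2 * lg * G \<le> 2 * lg * (lg ^ 3 * (e1 + e4) + 24 * lg * D * w)"
    using l49 by (intro mult_left_mono) auto
  moreover have "2 * lg * (lg ^ 3 * (e1 + e4) + 24 * lg * D * w) = 2 * (lg ^ 4 * (e1 + e4)) + 48 * lg ^ 2 * D * w"
    by (simp add: eval_nat_numeral algebra_simps)
  moreover have "lg ^ 4 * (e1 + e4) \<le> lg ^ 7 / 100 * (e1 + e4)"
    using lg_powers e_nonneg by (intro mult_right_mono) auto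
  moreover have "3 * lg * type_II_root \<le> 3 * lg * (5 / 7 * lg ^ 6 * (e1 + e2 + e3 + e4))"
    using l49 type_II_root_le by (intro mult_left_mono) auto
  moreover have "3 * lg * (5 / 7 * lg ^ 6 * (e1 + e2 + e3 + e4)) = 15 / 7 * (lg ^ 7 * (e1 + e2 + w + e4))"
    by (simp add: eval_nat_numeral e3)
  moreover have "lg ^ 7 * e1 \<ge> 0" "lg ^ 7 * e2 \<ge> 0" "lg ^ 7 * e4 \<ge> 0" "lg ^ 7 * w \<ge> 0" using l49 e_nonneg w0 by auto
  ultimately have "real H * (V * lg) + 2 * lg * G + 3 * lg * type_II_root \<le> 6 * lg ^ 7 * (e1 + e2 + e4) + (3 * lg ^ 7 + 48 * lg ^ 2 * D) * w"
    by (simp add: algebra_simps)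
  then show ?thesis using exp_sums_le unfolding w_def by linarith
qed

end

text \<open>The factor \<open>H\<close> is pulled out so that the bracket does not increase with
  \<open>H\<close>, as the dyadic summation over \<open>h\<close> needs. \<open>D\<close> is the
  divisor bound at \<open>w\<close>, and \<open>w\<close> to the power 5/4 \<epsilon> is H^(3/4
  \<epsilon>) N^\<epsilon>; \<open>Y\<close> majorises \<open>H\<close> in that power, uniformly
  over the ranges. For large \<open>H\<close> the term with \<open>M\<close> is merely
  added.\<close>

lemma (in rational_approx) exp_sums_bound:
  fixes N H :: nat and lg \<epsilon> M Y :: real
  assumes N1: "N \<ge> 1" and H1: "H \<ge> 1" and l49: "lg \<ge> 49" and hq: "hq \<le> lg"
    and harm: "\<And>n. real n \<le> 4 * real H * real N \<Longrightarrow> harm n \<le> lg"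
    and \<epsilon>: "\<epsilon> > 0" and M: "M > 0"
    and div: "\<And>x::nat. x \<ge> 1 \<Longrightarrow> real (num_divisors x) \<le> M * real x powr (5/4 * \<epsilon>)"
    and Y: "Y \<ge> real N"
  shows "exp_sums \<alpha> N H \<le> real H * (6 * lg ^ 7 * (real N * of_int q powr (-1/2) + real N powr (3/4) + (real N * of_int q / real H) powr (1/2))
     + (3 * lg ^ 7 + 48 * lg ^ 2 * M) * (Y powr (3/4 * \<epsilon>) * real H powr (-2/5) * real N powr (4/5 + \<epsilon>)))"
proof -
  have N0: "real N > 0" "real N \<ge> 1" and H0: "real H > 0" "real H \<ge> 1" and q0: "real_of_int q \<ge> 1" and Y0: "Y \<ge> 1"
    using N1 H1 q_pos Y by auto
  define E where "E = real N * of_int q powr (-1/2) + real N powr (3/4) + (real N * of_int q / real H) powr (1/2)"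
  have E_eq: "real H * real N / sqrt (of_int q) + real H * real N powr (3/4) + sqrt (real H * real N * of_int q) = real H * E"
  proof -
    have "sqrt (real H * real N * of_int q) = sqrt (real H ^ 2 * (real N * of_int q / real H))"
      using H0 by (simp add: power2_eq_square mult_ac)
    also have "\<dots> = real H * sqrt (real N * of_int q / real H)"
      by (simp only: real_sqrt_mult) simp
    also have "\<dots> = real H * (real N * of_int q / real H) powr (1/2)"
      using q0 by (subst powr_half_sqrt) auto
    finally have 1: "sqrt (real H * real N * of_int q) = real H * (real N * of_int q / real H) powr (1/2)" .
    have "of_int q powr (-1/2) = 1 / sqrt (of_int q)"
      using q0 by (simp add: powr_minus_divide powr_half_sqrt)
    then show ?thesis unfolding E_def 1 by (simp add: distrib_left)
  qed
  show ?thesis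
  proof (cases "real H \<ge> real N powr (1/4)")
    case True
    define V where "V = real N powr (1/4)"
    interpret vaughan_setup \<alpha> a q N H V lg
    proof unfold_locales
      show "V \<ge> 1" unfolding V_def using N0 by (simp add: ge_one_powr_ge_zero)
      have "V ^ 2 = real N powr (1/2)" unfolding V_def powr_squared by simp
      also have "\<dots> \<le> real N powr 1" using N0 by (intro powr_mono) auto
      finally show "V ^ 2 \<le> real N" using N0 by simp
    qed (use assms in auto)
    have "exp_sums \<alpha> N H \<le> 6 * lg ^ 7 * (e1 + e2 + e4)"
      using True by (intro exp_sums_large) (auto simp: V_def)
    also have "e1 + e2 + e4 = real H * E"
      unfolding E_eq[symmetric] e1_def e2_def e4_def Z_def by simp
    also have "6 * lg ^ 7 * (real H * E) = real H * (6 * lg ^ 7 * E + 0)" by simp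
    also have "\<dots> \<le> real H * (6 * lg ^ 7 * E + (3 * lg ^ 7 + 48 * lg ^ 2 * M) * (Y powr (3/4 * \<epsilon>) * real H powr (-2/5) * real N powr (4/5 + \<epsilon>)))"
      using l49 M by (intro mult_left_mono add_left_mono mult_nonneg_nonneg) auto
    finally show ?thesis unfolding E_def .
  next
    case False
    then have HN: "real H \<le> real N powr (1/4)" by simp
    define V where "V = real N powr (2/5) * real H powr (-1/5)"
    define w where "w = real H powr (3/5) * real N powr (4/5)"
    define D where "D = M * w powr (5/4 * \<epsilon>)"
    interpret vaughan_setup \<alpha> a q N H V lg
    proof unfold_locales
      \<comment> \<open>\<open>H \<le> N powr (1/4)\<close> gives
        \<open>V \<ge> N powr (7/20)\<close>, in particular \<open>V \<ge> 1\<close>.\<close>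
      have "(real N powr (1/4)) powr (-1/5) \<le> real H powr (-1/5)"
        using HN H0 by (intro powr_mono2') auto
      then have "real N powr (2/5) * (real N powr (1/4)) powr (-1/5) \<le> V"
        unfolding V_def by (intro mult_left_mono) auto
      then have "real N powr (2/5 - 1/20) \<le> V" by (simp add: powr_powr powr_add[symmetric])
      moreover have "real N powr (2/5 - 1/20) \<ge> 1" using N0 by (intro ge_one_powr_ge_zero) auto
      ultimately show "V \<ge> 1" by linarith
      have "V ^ 2 = real N powr (4/5) * real H powr (-2/5)"
        unfolding V_def power_mult_distrib powr_squared by simp
      also have "\<dots> \<le> real N powr 1 * real H powr 0" using N0 H0 by (intro mult_mono powr_mono) auto
      finally show "V ^ 2 \<le> real N" using N0 H0 by simp
    qed (use assms in auto)
    have "exp_sums \<alpha> N H \<le> 6 * lg ^ 7 * (e1 + e2 + e4) + (3 * lg ^ 7 + 48 * lg ^ 2 * D) * w"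
      unfolding w_def
    proof (rule exp_sums_small)
      fix s assume s: "1 \<le> s" "real s \<le> real H powr (3/5) * real N powr (4/5)"
      have "real (num_divisors s) \<le> M * real s powr (5/4 * \<epsilon>)" by (rule div[OF s(1)])
      also have "\<dots> \<le> D" unfolding D_def w_def using s M \<epsilon> by (intro mult_left_mono powr_mono2) auto
      finally show "real (num_divisors s) \<le> D" .
    qed (use M in \<open>auto simp: V_def D_def\<close>)
    also have "e1 + e2 + e4 = real H * E"
      unfolding E_eq[symmetric] e1_def e2_def e4_def Z_def by simp
    \<comment> \<open>\<open>w \<ge> 1\<close> lets the factor
      \<open>w powr (5/4 * \<epsilon>)\<close> be attached to the term \<open>3 * lg ^ 7\<close> as
      well.\<close>
    also have "(3 * lg ^ 7 + 48 * lg ^ 2 * D) * w \<le> (3 * lg ^ 7 + 48 * lg ^ 2 * M) * (w * w powr (5/4 * \<epsilon>))"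
    proof -
      have w1: "w \<ge> 1" unfolding w_def using N0 H0 mult_mono[of 1 "real H powr (3/5)" 1 "real N powr (4/5)"]
        by (simp add: ge_one_powr_ge_zero)
      have "w powr (5/4 * \<epsilon>) \<ge> 1" using w1 \<epsilon> by (intro ge_one_powr_ge_zero) auto
      then have "3 * lg ^ 7 * 1 \<le> 3 * lg ^ 7 * w powr (5/4 * \<epsilon>)" using l49 by (intro mult_left_mono) auto
      then have "3 * lg ^ 7 + 48 * lg ^ 2 * D \<le> (3 * lg ^ 7 + 48 * lg ^ 2 * M) * w powr (5/4 * \<epsilon>)"
        by (simp add: D_def algebra_simps)
      then have "(3 * lg ^ 7 + 48 * lg ^ 2 * D) * w \<le> ((3 * lg ^ 7 + 48 * lg ^ 2 * M) * w powr (5/4 * \<epsilon>)) * w"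
        using w1 by (intro mult_right_mono) auto
      then show ?thesis by (simp add: mult_ac)
    qed
    also have "w * w powr (5/4 * \<epsilon>) \<le> real H * (Y powr (3/4 * \<epsilon>) * real H powr (-2/5) * real N powr (4/5 + \<epsilon>))"
    proof -
      have "w powr (5/4 * \<epsilon>) = real H powr (3/4 * \<epsilon>) * real N powr \<epsilon>"
        unfolding w_def using N0 H0 by (simp add: powr_mult powr_powr)
      also have "\<dots> \<le> Y powr (3/4 * \<epsilon>) * real N powr \<epsilon>"
      proof (intro mult_right_mono powr_mono2)
        have "real N powr (1/4) \<le> real N powr 1" using N0 by (intro powr_mono) auto
        then show "real H \<le> Y" using HN Y N0 by simp
      qed (use \<epsilon> in auto)
      finally have "w * w powr (5/4 * \<epsilon>) \<le> w * (Y powr (3/4 * \<epsilon>) * real N powr \<epsilon>)"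
        by (intro mult_left_mono) (auto simp: w_def)
      also have "real H powr (3/5) = real H * real H powr (-2/5)"
        using H0 powr_add[of "real H" 1 "-2/5"] by simp
      then have "w * (Y powr (3/4 * \<epsilon>) * real N powr \<epsilon>) = real H * (Y powr (3/4 * \<epsilon>) * real H powr (-2/5) * real N powr (4/5 + \<epsilon>))"
        unfolding w_def by (simp add: powr_add mult_ac)
      finally show ?thesis .
    qed
    finally have "exp_sums \<alpha> N H \<le> 6 * lg ^ 7 * (real H * E) + (3 * lg ^ 7 + 48 * lg ^ 2 * M) *
       (real H * (Y powr (3/4 * \<epsilon>) * real H powr (-2/5) * real N powr (4/5 + \<epsilon>)))"
      using l49 M by (auto simp: mult_left_mono)
    also have "\<dots> = real H * (6 * lg ^ 7 * E + (3 * lg ^ 7 + 48 * lg ^ 2 * M) * (Y powr (3/4 * \<epsilon>) * real H powr (-2/5) * real N powr (4/5 + \<epsilon>)))"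
      by (simp add: algebra_simps)
    finally show ?thesis unfolding E_def .
  qed
qed

section \<open>The main estimate\<close>

lemma harm_le_ln:
  assumes "n \<ge> 1" shows "harm n \<le> 1 + ln (real n)"
proof -
  obtain m where m: "n = Suc m" using assms by (cases n) auto
  have "harm (Suc m) - ln (real (Suc m)) \<le> harm (Suc 0) - ln (real (Suc 0))"
    using decseqD[OF decseq_harm_diff_ln, of 0 m] by simp
  then show ?thesis by (simp add: m harm_def)
qed

lemma sum_mangoldt_le: "(\<Sum>n=1..N. mangoldt n) \<le> real N * ln (real N)"
proof -
  have "(\<Sum>n=1..N. mangoldt n) \<le> (\<Sum>n=1..N. ln (real N))"
  proof (rule sum_mono)
    fix n assume n: "n \<in> {1..N}"
    have "mangoldt n \<le> ln (real n)" using n by (intro mangoldt_le_ln) auto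
    also have "\<dots> \<le> ln (real N)" using n by (intro ln_mono) auto
    finally show "mangoldt n \<le> ln (real N)" .
  qed
  then show ?thesis by simp
qed

section \<open>From the indicator to exponential sums\<close>

abbreviation mangoldt_exp_sum :: "real \<Rightarrow> nat \<Rightarrow> nat \<Rightarrow> real"
  where "mangoldt_exp_sum \<alpha> N h \<equiv> norm (\<Sum>n\<in>{1..N}. mangoldt n * ee (\<alpha> * real (h * n)))"

text \<open>The shift \<open>\<beta>\<close> enters only through a phase of modulus 1. The
  coefficient of each cosine is at most \<open>8 * \<delta>\<close> by
  \<open>\<bar>sin y\<bar> \<le> \<bar>y\<bar>\<close>, and at most \<open>1 / h\<close> because
  \<open>pi \<ge> 2\<close>. Allowing \<open>d\<close> up to \<open>2 * \<delta>\<close> covers both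
  \<open>\<delta> + \<eta>\<close> and \<open>\<delta> - \<eta>\<close>.\<close>

lemma smooth_sum_le:
  assumes "0 \<le> d" "d \<le> 2 * \<delta>"
  shows "\<bar>\<Sum>n=1..N. mangoldt n * (smooth_chi Q d (\<alpha> * real n - \<beta>) - 2 * d)\<bar>
    \<le> (\<Sum>h\<in>{1..<Q}. min (8 * \<delta>) (1 / real h) * mangoldt_exp_sum \<alpha> N h)"
proof -
  define c where "c h = 2 * (1 - real h / real Q) * (sin (2 * pi * real h * d) / (pi * real h))" for h
  have c: "\<bar>c h\<bar> \<le> min (8 * \<delta>) (1 / real h)" if h: "h \<in> {1..<Q}" for h
  proof -
    have h0: "real h > 0" using h by simp
    have Q: "\<bar>2 * (1 - real h / real Q)\<bar> \<le> 2" using h by (simp add: field_simps)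
    have 1: "\<bar>sin (2 * pi * real h * d) / (pi * real h)\<bar> \<le> 4 * \<delta>"
    proof -
      have "\<bar>sin (2 * pi * real h * d)\<bar> \<le> 2 * pi * real h * d"
        using abs_sin_x_le_abs_x[of "2 * pi * real h * d"] assms by (simp add: abs_mult)
      also have "\<dots> \<le> 2 * pi * real h * (2 * \<delta>)" using assms by (intro mult_left_mono) auto
      finally show ?thesis using h0 by (simp add: abs_mult pos_divide_le_eq mult_ac)
    qed
    have 2: "\<bar>sin (2 * pi * real h * d) / (pi * real h)\<bar> \<le> 1 / (2 * real h)"
    proof -
      have "\<bar>sin (2 * pi * real h * d) / (pi * real h)\<bar> = \<bar>sin (2 * pi * real h * d)\<bar> / (pi * real h)"
        using h0 by (simp add: abs_mult)
      also have "\<dots> \<le> 1 / (2 * real h)" using h0 pi_ge_two by (intro frac_le mult_right_mono) auto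
      finally show ?thesis .
    qed
    have "\<bar>c h\<bar> \<le> 2 * (4 * \<delta>)" unfolding c_def abs_mult[of "2 * (1 - real h / real Q)"] by (intro mult_mono Q 1) auto
    moreover have "\<bar>c h\<bar> \<le> 2 * (1 / (2 * real h))" unfolding c_def abs_mult[of "2 * (1 - real h / real Q)"] by (intro mult_mono Q 2) auto
    ultimately show ?thesis by simp
  qed
  have "(\<Sum>n=1..N. mangoldt n * (smooth_chi Q d (\<alpha> * real n - \<beta>) - 2 * d))
      = (\<Sum>n=1..N. \<Sum>h\<in>{1..<Q}. c h * (mangoldt n * cos (2 * pi * real h * (\<alpha> * real n - \<beta>))))"
    by (simp add: smooth_chi_expand c_def sum_distrib_left mult_ac)
  also have "\<dots> = (\<Sum>h\<in>{1..<Q}. c h * (\<Sum>n=1..N. mangoldt n * cos (2 * pi * real h * (\<alpha> * real n - \<beta>))))"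
    unfolding sum_distrib_left by (rule sum.swap)
  also have "\<bar>\<dots>\<bar> \<le> (\<Sum>h\<in>{1..<Q}. min (8 * \<delta>) (1 / real h) * mangoldt_exp_sum \<alpha> N h)"
  proof (intro order.trans[OF sum_abs] sum_mono)
    fix h assume h: "h \<in> {1..<Q}"
    have "(\<Sum>n=1..N. mangoldt n * cos (2 * pi * real h * (\<alpha> * real n - \<beta>)))
      = Re (ee (- (real h * \<beta>)) * (\<Sum>n\<in>{1..N}. mangoldt n * ee (\<alpha> * real (h * n))))"
    proof -
      have "mangoldt n * cos (2 * pi * real h * (\<alpha> * real n - \<beta>)) = Re (ee (- (real h * \<beta>)) * (mangoldt n * ee (\<alpha> * real (h * n))))" for n
      proof -
        have "ee (- (real h * \<beta>)) * (mangoldt n * ee (\<alpha> * real (h * n))) = of_real (mangoldt n) * ee (real h * (\<alpha> * real n - \<beta>))"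
          using ee_add[of "- (real h * \<beta>)" "\<alpha> * real (h * n)"] by (simp add: algebra_simps)
        then show ?thesis by (simp only:) (simp add: ee_def mult_ac)
      qed
      then show ?thesis by (simp add: sum_distrib_left)
    qed
    also have "\<bar>\<dots>\<bar> \<le> norm (ee (- (real h * \<beta>)) * (\<Sum>n\<in>{1..N}. mangoldt n * ee (\<alpha> * real (h * n))))"
      by (rule abs_Re_le_cmod)
    also have "\<dots> = mangoldt_exp_sum \<alpha> N h" by (simp add: norm_mult)
    finally have "\<bar>\<Sum>n=1..N. mangoldt n * cos (2 * pi * real h * (\<alpha> * real n - \<beta>))\<bar> \<le> mangoldt_exp_sum \<alpha> N h" .
    then show "\<bar>c h * (\<Sum>n=1..N. mangoldt n * cos (2 * pi * real h * (\<alpha> * real n - \<beta>)))\<bar> \<le> min (8 * \<delta>) (1 / real h) * mangoldt_exp_sum \<alpha> N h"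
      unfolding abs_mult[of "c h"] using c[OF h] by (intro mult_mono) (auto intro: order.trans[OF abs_ge_zero])
  qed
  finally show ?thesis .
qed

text \<open>Changing the half-width by \<open>\<eta>\<close> shifts the expected density by
  \<open>2 * \<eta>\<close>, and the sandwich itself costs \<open>2 / (Q * \<eta>)\<close>.\<close>

lemma chi_sum_le:
  assumes \<delta>: "0 < \<delta>" "\<delta> < 1/2" and \<eta>: "0 < \<eta>" "\<eta> \<le> \<delta>" and Q: "Q \<ge> 1"
  shows "\<bar>\<Sum>n=1..N. mangoldt n * (chi \<delta> (\<alpha> * real n - \<beta>) - 2 * \<delta>)\<bar>
    \<le> (2 * \<eta> + 2 / (real Q * \<eta>)) * (\<Sum>n=1..N. mangoldt n)
      + (\<Sum>h\<in>{1..<Q}. min (8 * \<delta>) (1 / real h) * mangoldt_exp_sum \<alpha> N h)"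
proof -
  let ?B = "(\<Sum>h\<in>{1..<Q}. min (8 * \<delta>) (1 / real h) * mangoldt_exp_sum \<alpha> N h)"
  let ?\<tau> = "2 / (real Q * \<eta>)"
  let ?S = "\<Sum>n=1..N. mangoldt n * (chi \<delta> (\<alpha> * real n - \<beta>) - 2 * \<delta>)"
  let ?U = "\<lambda>d. \<Sum>n=1..N. mangoldt n * (smooth_chi Q d (\<alpha> * real n - \<beta>) - 2 * d)"
  have "?S \<le> (\<Sum>n=1..N. mangoldt n * (smooth_chi Q (\<delta> + \<eta>) (\<alpha> * real n - \<beta>) - 2 * (\<delta> + \<eta>)) + (2 * \<eta> + ?\<tau>) * mangoldt n)"
  proof (rule sum_mono)
    fix n
    have "mangoldt n * (chi \<delta> (\<alpha> * real n - \<beta>) - 2 * \<delta>) \<le> mangoldt n * (smooth_chi Q (\<delta> + \<eta>) (\<alpha> * real n - \<beta>) + ?\<tau> - 2 * \<delta>)"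
      using chi_le_smooth[OF Q \<delta> \<eta>(1), of "\<alpha> * real n - \<beta>"] by (intro mult_left_mono mangoldt_nonneg) simp
    then show "mangoldt n * (chi \<delta> (\<alpha> * real n - \<beta>) - 2 * \<delta>) \<le> mangoldt n * (smooth_chi Q (\<delta> + \<eta>) (\<alpha> * real n - \<beta>) - 2 * (\<delta> + \<eta>)) + (2 * \<eta> + ?\<tau>) * mangoldt n"
      by (simp add: algebra_simps)
  qed
  also have "\<dots> = ?U (\<delta> + \<eta>) + (2 * \<eta> + ?\<tau>) * (\<Sum>n=1..N. mangoldt n)"
    by (simp only: sum.distrib sum_distrib_left)
  finally have up: "?S \<le> ?U (\<delta> + \<eta>) + (2 * \<eta> + ?\<tau>) * (\<Sum>n=1..N. mangoldt n)" .
  have "(\<Sum>n=1..N. mangoldt n * (smooth_chi Q (\<delta> - \<eta>) (\<alpha> * real n - \<beta>) - 2 * (\<delta> - \<eta>)) - (2 * \<eta> + ?\<tau>) * mangoldt n) \<le> ?S"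
  proof (rule sum_mono)
    fix n
    have "mangoldt n * (smooth_chi Q (\<delta> - \<eta>) (\<alpha> * real n - \<beta>) - ?\<tau> - 2 * \<delta>) \<le> mangoldt n * (chi \<delta> (\<alpha> * real n - \<beta>) - 2 * \<delta>)"
      using chi_ge_smooth[OF Q \<delta> \<eta>, of "\<alpha> * real n - \<beta>"] by (intro mult_left_mono mangoldt_nonneg) simp
    then show "mangoldt n * (smooth_chi Q (\<delta> - \<eta>) (\<alpha> * real n - \<beta>) - 2 * (\<delta> - \<eta>)) - (2 * \<eta> + ?\<tau>) * mangoldt n \<le> mangoldt n * (chi \<delta> (\<alpha> * real n - \<beta>) - 2 * \<delta>)"
      by (simp add: algebra_simps)
  qed
  moreover have "(\<Sum>n=1..N. mangoldt n * (smooth_chi Q (\<delta> - \<eta>) (\<alpha> * real n - \<beta>) - 2 * (\<delta> - \<eta>)) - (2 * \<eta> + ?\<tau>) * mangoldt n)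
      = ?U (\<delta> - \<eta>) - (2 * \<eta> + ?\<tau>) * (\<Sum>n=1..N. mangoldt n)"
    by (simp only: sum_subtractf sum_distrib_left)
  ultimately have lo: "?U (\<delta> - \<eta>) - (2 * \<eta> + ?\<tau>) * (\<Sum>n=1..N. mangoldt n) \<le> ?S" by simp
  have "\<bar>?U (\<delta> + \<eta>)\<bar> \<le> ?B" "\<bar>?U (\<delta> - \<eta>)\<bar> \<le> ?B" using \<delta> \<eta> by (intro smooth_sum_le; simp)+
  with up lo show ?thesis by linarith
qed

text \<open>Up to \<open>H0\<close> the constant weight gives
  \<open>8 * \<delta> * H0 * B \<le> 12 * B\<close>. On a dyadic block above, the weight
  \<open>1 / h\<close> is at most the inverse of the left end, while the sum up to the right end is
  at most twice the left end times \<open>B\<close>; so each of the \<open>J\<close> blocks costs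
  \<open>2 * B\<close>.\<close>

lemma weighted_exp_sums_le:
  assumes \<delta>: "0 < \<delta>" and H0: "1 / \<delta> \<le> real H0" "real H0 \<le> 3 / (2 * \<delta>)" and Q: "\<And>h. h < Q \<Longrightarrow> h \<le> 2 ^ J * H0"
    and B: "\<And>j. j \<le> J \<Longrightarrow> exp_sums \<alpha> N (2 ^ j * H0) \<le> real (2 ^ j * H0) * B"
  shows "(\<Sum>h\<in>{1..<Q}. min (8 * \<delta>) (1 / real h) * mangoldt_exp_sum \<alpha> N h) \<le> (12 + 2 * real J) * B"
proof -
  let ?g = "\<lambda>h. min (8 * \<delta>) (1 / real h) * mangoldt_exp_sum \<alpha> N h"
  have g0: "?g h \<ge> 0" for h using \<delta> by (intro mult_nonneg_nonneg) auto
  have "0 < 1 / \<delta>" using \<delta> by simp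
  then have H0pos: "real H0 > 0" using H0(1) by linarith
  have B0: "B \<ge> 0"
  proof -
    have "0 \<le> exp_sums \<alpha> N H0" unfolding exp_sums_def by (intro sum_nonneg) auto
    then have "0 \<le> real H0 * B" using B[of 0] by simp
    then show ?thesis using H0pos by (simp add: zero_le_mult_iff)
  qed
  have "(\<Sum>h\<in>{1..<Q}. ?g h) \<le> (\<Sum>h\<in>{1..H0} \<union> {H0<..2 ^ J * H0}. ?g h)"
    using Q g0 by (intro sum_mono2) (force simp: not_le)+
  also have "\<dots> = (\<Sum>h\<in>{1..H0}. ?g h) + (\<Sum>h\<in>{H0<..2 ^ J * H0}. ?g h)"
    by (rule sum.union_disjoint) auto
  also have "(\<Sum>h\<in>{H0<..2 ^ J * H0}. ?g h) = (\<Sum>j<J. \<Sum>h\<in>{2 ^ j * H0<..2 ^ Suc j * H0}. ?g h)"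
    by (rule sum_dyadic_blocks)
  also have "\<dots> \<le> (\<Sum>j<J. 2 * B)"
  proof (rule sum_mono)
    fix j assume j: "j \<in> {..<J}"
    have pos: "real (2 ^ j * H0) > 0" using H0pos by simp
    have "(\<Sum>h\<in>{2 ^ j * H0<..2 ^ Suc j * H0}. ?g h) \<le> (\<Sum>h\<in>{2 ^ j * H0<..2 ^ Suc j * H0}. 1 / real (2 ^ j * H0) * mangoldt_exp_sum \<alpha> N h)"
    proof (intro sum_mono mult_right_mono)
      fix h assume "h \<in> {2 ^ j * H0<..2 ^ Suc j * H0}"
      then have "2 ^ j * H0 \<le> h" by simp
      then have "real (2 ^ j * H0) \<le> real h" by (simp only: of_nat_le_iff)
      then have "1 / real h \<le> 1 / real (2 ^ j * H0)" using pos by (intro divide_left_mono) auto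
      then show "min (8 * \<delta>) (1 / real h) \<le> 1 / real (2 ^ j * H0)" by linarith
    qed auto
    also have "\<dots> \<le> (\<Sum>h\<in>{1..2 ^ Suc j * H0}. 1 / real (2 ^ j * H0) * mangoldt_exp_sum \<alpha> N h)"
      by (intro sum_mono2 mult_nonneg_nonneg) auto
    also have "\<dots> = 1 / real (2 ^ j * H0) * exp_sums \<alpha> N (2 ^ Suc j * H0)"
      unfolding exp_sums_def by (simp only: sum_distrib_left)
    also have "\<dots> \<le> 1 / real (2 ^ j * H0) * (real (2 ^ Suc j * H0) * B)"
      using j by (intro mult_left_mono B) auto
    also have "\<dots> = 2 * B" using H0pos by simp
    finally show "(\<Sum>h\<in>{2 ^ j * H0<..2 ^ Suc j * H0}. ?g h) \<le> 2 * B" .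
  qed
  also have "(\<Sum>h\<in>{1..H0}. ?g h) \<le> 8 * \<delta> * exp_sums \<alpha> N H0"
    unfolding exp_sums_def sum_distrib_left by (intro sum_mono mult_right_mono) auto
  also have "\<dots> \<le> 8 * \<delta> * (real H0 * B)" using B[of 0] \<delta> by (intro mult_left_mono) auto
  also have "\<dots> \<le> 8 * \<delta> * (3 / (2 * \<delta>) * B)" using \<delta> B0 H0 by (intro mult_left_mono mult_right_mono) auto
  also have "\<dots> = 12 * B" using \<delta> by simp
  finally show ?thesis by (simp add: algebra_simps)
qed

lemma (in rational_approx) chi_sum_bound:
  fixes \<beta> \<delta> \<epsilon> M L :: real and N :: nat
  assumes \<delta>: "0 < \<delta>" "\<delta> < 1/2" and N1: "N \<ge> 1" and L: "L = ln (real N * of_int q / \<delta>)" and L36: "L \<ge> 36"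
    and \<epsilon>: "\<epsilon> > 0" and M: "M > 0"
    and div: "\<And>x::nat. x \<ge> 1 \<Longrightarrow> real (num_divisors x) \<le> M * real x powr (5/4 * \<epsilon>)"
  shows "\<bar>\<Sum>n=1..N. mangoldt n * (chi \<delta> (\<alpha> * real n - \<beta>) - 2 * \<delta>)\<bar>
    \<le> 10^3 * L^8 *
      (3422 * real N * of_int q powr (-1/2)
       + 251 * real N powr (3/4)
       + 38 * (\<delta> * real N * of_int q) powr (1/2)
       + (11 + 17 powr (-3) * M) * (real N * of_int q / \<delta>) powr (3/4 * \<epsilon>)
           * \<delta> powr (2/5) * real N powr (4/5 + \<epsilon>))"
proof -
  have N0: "real N > 0" "real N \<ge> 1" and q0: "real_of_int q \<ge> 1" using N1 q_pos by auto
  have L_eq: "L = ln (real N) + ln (of_int q) - ln \<delta>"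
    unfolding L using N0 q0 \<delta> by (simp add: ln_mult ln_div)
  have ln0: "ln (real N) \<ge> 0" "ln (real_of_int q) \<ge> 0" "- ln \<delta> \<ge> 0"
    using N0 q0 \<delta> by auto
  \<comment> \<open>All ranges satisfy \<open>4 * H * N \<le> 8 * N powr (3/2) / \<delta>\<close>,
    so the harmonic numbers are at most \<open>4 + 3/2 * L\<close>, which is below
    \<open>13/8 * L\<close> as soon as \<open>L \<ge> 32\<close>.\<close>
  define lg where "lg = 13 / 8 * L"
  define Y where "Y = real N * of_int q / \<delta>"
  have sN: "sqrt (real N) \<ge> 1" using N0 by simp
  define H0 where "H0 = nat \<lceil>1 / \<delta>\<rceil>"
  have d2: "1 / \<delta> \<ge> 2" using \<delta> by (simp add: field_simps)
  have H0: "1 / \<delta> \<le> real H0" "real H0 \<le> 3 / (2 * \<delta>)"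
  proof -
    show "1 / \<delta> \<le> real H0" unfolding H0_def by (rule real_nat_ceiling_ge)
    have "real H0 = of_int \<lceil>1 / \<delta>\<rceil>" unfolding H0_def using d2 by (simp add: le_ceiling_iff)
    then have "real H0 \<le> 1 / \<delta> + 1" by linarith
    also have "\<dots> \<le> 1 / \<delta> + 1 / \<delta> / 2" using d2 by simp
    finally show "real H0 \<le> 3 / (2 * \<delta>)" by simp
  qed
  have H0pos: "H0 \<ge> 1"
  proof -
    have "real H0 \<ge> 1" using H0(1) d2 by linarith
    then show ?thesis by simp
  qed
  \<comment> \<open>Degree of the kernel, matched with
    \<open>\<eta> = \<delta> * N powr (-1/4)\<close> below: \<open>Q * \<eta>\<close> is at least
    N^(1/4), so both smoothing losses are of order N^(-1/4) and contribute N^(3/4) times a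
    logarithm.\<close>
  define Q where "Q = nat \<lceil>sqrt (real N) / \<delta>\<rceil>"
  have Qge: "sqrt (real N) / \<delta> \<le> real Q" unfolding Q_def by (rule real_nat_ceiling_ge)
  have sNd: "sqrt (real N) / \<delta> > 0" using sN \<delta> by (intro divide_pos_pos) auto
  then have Q1: "Q \<ge> 1" using Qge by (cases Q) auto
  define J where "J = (LEAST J. sqrt (real N) / \<delta> \<le> real (2 ^ J * H0))"
  have ex: "\<exists>J. sqrt (real N) / \<delta> \<le> real (2 ^ J * H0)"
  proof -
    obtain n where n: "sqrt (real N) / \<delta> < 2 ^ n" using real_arch_pow[of 2 "sqrt (real N) / \<delta>"] by auto
    have "(2::real) ^ n * 1 \<le> 2 ^ n * real H0" using H0pos by (intro mult_left_mono) auto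
    then have "sqrt (real N) / \<delta> \<le> real (2 ^ n * H0)"
      using n unfolding of_nat_mult of_nat_power of_nat_numeral by linarith
    then show ?thesis by blast
  qed
  have J_ge: "sqrt (real N) / \<delta> \<le> real (2 ^ J * H0)" unfolding J_def using ex by (rule LeastI_ex)
  have J_le: "real (2 ^ J * H0) \<le> 2 * (sqrt (real N) / \<delta>)"
  proof (cases J)
    case 0
    have "2 * (1 / \<delta>) \<le> 2 * (sqrt (real N) / \<delta>)" using sN \<delta> by (intro mult_left_mono divide_right_mono) auto
    moreover have "3 / (2 * \<delta>) \<le> 2 * (1 / \<delta>)" using \<delta> by (simp add: field_simps)
    ultimately show ?thesis using 0 H0(2) by simp
  next
    case (Suc i)
    then have "i < J" by simp
    then have "\<not> sqrt (real N) / \<delta> \<le> real (2 ^ i * H0)" unfolding J_def by (rule not_less_Least)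
    then show ?thesis using Suc by simp
  qed
  \<comment> \<open>The bound on the last range gives \<open>2 ^ J \<le> 2 * sqrt N\<close>; with
    \<open>ln 2 \<ge> 2/3\<close> this yields \<open>12 + 2 * J \<le> 15 + 3/2 * L\<close>, and
    \<open>L \<ge> 30\<close> suffices.\<close>
  have J_card: "12 + 2 * real J \<le> 2 * L"
  proof -
    have "(2::real) ^ J * (1 / \<delta>) \<le> 2 ^ J * real H0" using H0(1) by (intro mult_left_mono) auto
    then have "(2::real) ^ J * (1 / \<delta>) \<le> 2 * (sqrt (real N) / \<delta>)" using J_le by simp
    then have "(2::real) ^ J \<le> 2 * sqrt (real N)" using \<delta> by (simp add: field_simps)
    then have "ln ((2::real) ^ J) \<le> ln (2 * sqrt (real N))" using N0 by (subst ln_le_cancel_iff) auto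
    then have "real J * ln 2 \<le> ln 2 + ln (real N) / 2" using N0 by (simp add: ln_realpow ln_mult ln_sqrt)
    moreover have "real J * (2/3) \<le> real J * ln 2" using ln2_ge_two_thirds by (intro mult_left_mono) auto
    moreover have "ln (real N) \<le> L" using L_eq ln0 by simp
    ultimately show ?thesis using ln_2_less_1 L36 by linarith
  qed
  define E where "E = real N * of_int q powr (-1/2) + real N powr (3/4) + (\<delta> * real N * of_int q) powr (1/2)"
  define W where "W = Y powr (3/4 * \<epsilon>) * \<delta> powr (2/5) * real N powr (4/5 + \<epsilon>)"
  define Bd where "Bd = 6 * lg ^ 7 * E + (3 * lg ^ 7 + 48 * lg ^ 2 * M) * W"
  have lg0: "lg \<ge> 49" unfolding lg_def using L36 by simp
  have hq_le: "hq \<le> lg"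
  proof -
    have "hq \<le> 1 + ln (real (nat q))" unfolding hq_def using q_pos by (intro harm_le_ln) auto
    also have "real (nat q) = of_int q" using q_pos by simp
    also have "1 + ln (of_int q) \<le> lg" using L_eq ln0 L36 unfolding lg_def by linarith
    finally show ?thesis .
  qed
  have Y_ge: "Y \<ge> real N"
  proof -
    have "real N * 1 \<le> real N * of_int q" using q0 by (intro mult_left_mono) auto
    also have "\<dots> \<le> Y" unfolding Y_def using \<delta> N0 q0 by (simp add: field_simps mult_le_one)
    finally show ?thesis by simp
  qed
  have block: "exp_sums \<alpha> N (2 ^ j * H0) \<le> real (2 ^ j * H0) * Bd" if j: "j \<le> J" for j
  proof -
    define H where "H = 2 ^ j * H0"
    have H1: "H \<ge> 1" unfolding H_def using H0pos by simp
    have "H \<le> 2 ^ J * H0" unfolding H_def using j by (intro mult_le_mono1 power_increasing) auto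
    then have "real H \<le> real (2 ^ J * H0)" by (simp only: of_nat_le_iff)
    then have HJ: "real H \<le> 2 * (sqrt (real N) / \<delta>)" using J_le by linarith
    have "H0 \<le> H" unfolding H_def by simp
    then have "real H0 \<le> real H" by simp
    then have Hd: "1 / \<delta> \<le> real H" using H0(1) by linarith
    then have Hd': "1 / real H \<le> \<delta>" using \<delta> H1 by (simp add: field_simps)
    have harm: "harm n \<le> lg" if n: "real n \<le> 4 * real H * real N" for n
    proof (cases "n = 0")
      case True then show ?thesis using lg0 by (simp add: harm_def)
    next
      case False
      have "real n \<le> 4 * (2 * (sqrt (real N) / \<delta>)) * real N"
        using n HJ mult_right_mono[of "4 * real H" "4 * (2 * (sqrt (real N) / \<delta>))" "real N"] by simp
      then have "ln (real n) \<le> ln (2 ^ 3 * (sqrt (real N) * real N / \<delta>))" using False by (intro ln_mono) (auto simp: mult_ac)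
      also have "\<dots> = 3 * ln 2 + (ln (real N) / 2 + ln (real N) - ln \<delta>)"
        using N0 \<delta> ln_realpow[of 2 3] by (simp add: ln_mult ln_div ln_sqrt)
      finally have "ln (real n) \<le> 3 + 3 / 2 * L" using ln_2_less_1 L_eq ln0 by linarith
      then show ?thesis using harm_le_ln[of n] False L36 unfolding lg_def by simp
    qed
    have "exp_sums \<alpha> N H \<le> real H * (6 * lg ^ 7 * (real N * of_int q powr (-1/2) + real N powr (3/4) + (real N * of_int q / real H) powr (1/2))
     + (3 * lg ^ 7 + 48 * lg ^ 2 * M) * (Y powr (3/4 * \<epsilon>) * real H powr (-2/5) * real N powr (4/5 + \<epsilon>)))"
      by (rule exp_sums_bound[OF N1 H1 lg0 hq_le harm \<epsilon> M div Y_ge])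
    \<comment> \<open>The powers of \<open>H\<close> in the bracket are negative, so
      \<open>H \<ge> 1 / \<delta>\<close> replaces them by powers of \<open>\<delta>\<close> and
      makes \<open>Bd\<close> the same for all ranges.\<close>
    also have "\<dots> \<le> real H * Bd"
      unfolding Bd_def E_def W_def
    proof (intro mult_left_mono add_mono mult_right_mono order.refl)
      have "real N * of_int q / real H = real N * of_int q * (1 / real H)" by simp
      also have "\<dots> \<le> real N * of_int q * \<delta>" using Hd' q0 by (intro mult_left_mono) auto
      finally show "(real N * of_int q / real H) powr (1/2) \<le> (\<delta> * real N * of_int q) powr (1/2)"
        using q0 by (intro powr_mono2) (auto simp: mult_ac)
      have "real H powr (-2/5) \<le> (1 / \<delta>) powr (-2/5)" using Hd \<delta> by (intro powr_mono2') auto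
      also have "\<dots> = \<delta> powr (2/5)" using \<delta> by (simp add: powr_divide powr_minus_divide)
      finally show "real H powr (-2/5) \<le> \<delta> powr (2/5)" .
    qed (use lg0 M in auto)
    finally show ?thesis unfolding H_def .
  qed
  define \<eta> where "\<eta> = \<delta> * real N powr (-1/4)"
  have eta: "0 < \<eta>" "\<eta> \<le> \<delta>"
  proof -
    have "real N powr (-1/4) \<le> real N powr 0" using N0 by (intro powr_mono) auto
    then show "\<eta> \<le> \<delta>" unfolding \<eta>_def using \<delta> N0 mult_left_mono[of "real N powr (-1/4)" 1 \<delta>] by simp
    show "0 < \<eta>" unfolding \<eta>_def using \<delta> N0 by simp
  qed
  have "\<bar>\<Sum>n=1..N. mangoldt n * (chi \<delta> (\<alpha> * real n - \<beta>) - 2 * \<delta>)\<bar>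
    \<le> (2 * \<eta> + 2 / (real Q * \<eta>)) * (\<Sum>n=1..N. mangoldt n)
      + (\<Sum>h\<in>{1..<Q}. min (8 * \<delta>) (1 / real h) * mangoldt_exp_sum \<alpha> N h)"
    by (rule chi_sum_le[OF \<delta> eta Q1])
  also have "(\<Sum>h\<in>{1..<Q}. min (8 * \<delta>) (1 / real h) * mangoldt_exp_sum \<alpha> N h) \<le> (12 + 2 * real J) * Bd"
  proof (rule weighted_exp_sums_le[OF \<delta>(1) H0 _ block])
    fix h assume "h < Q"
    then have "real h < sqrt (real N) / \<delta>" unfolding Q_def by (simp add: zless_nat_eq_int_zless less_ceiling_iff)
    then have "real h \<le> real (2 ^ J * H0)" using J_ge by linarith
    then show "h \<le> 2 ^ J * H0" by (simp only: of_nat_le_iff)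
  qed
  also have "(12 + 2 * real J) * Bd \<le> 2 * L * Bd"
    unfolding Bd_def E_def W_def using J_card lg0 M by (intro mult_right_mono) (auto intro!: add_nonneg_nonneg)
  also have "(2 * \<eta> + 2 / (real Q * \<eta>)) * (\<Sum>n=1..N. mangoldt n) \<le> (3 * real N powr (-1/4)) * (real N * L)"
  proof (intro mult_mono)
    have "2 * \<eta> \<le> real N powr (-1/4)" unfolding \<eta>_def using \<delta> mult_right_mono[of "2 * \<delta>" 1 "real N powr (-1/4)"] by simp
    moreover have "2 / (real Q * \<eta>) \<le> 2 * real N powr (-1/4)"
    proof -
      have "real N powr (1/4) = sqrt (real N) / \<delta> * \<eta>"
        unfolding \<eta>_def using \<delta> N0 by (simp add: powr_half_sqrt[symmetric] powr_add[symmetric])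
      also have "\<dots> \<le> real Q * \<eta>" using Qge eta by (intro mult_right_mono) auto
      finally have "2 / (real Q * \<eta>) \<le> 2 / real N powr (1/4)" using N0 by (intro frac_le) auto
      then show ?thesis using N0 by (simp add: powr_minus_divide)
    qed
    ultimately show "2 * \<eta> + 2 / (real Q * \<eta>) \<le> 3 * real N powr (-1/4)" by linarith
    have "ln (real N) \<le> L" using L_eq ln0 by simp
    then have "real N * ln (real N) \<le> real N * L" by (intro mult_left_mono) auto
    then show "(\<Sum>n=1..N. mangoldt n) \<le> real N * L" using sum_mangoldt_le[of N] by linarith
    show "0 \<le> (\<Sum>n=1..N. mangoldt n :: real)" by (intro sum_nonneg mangoldt_nonneg)
  qed auto
  also have "(3 * real N powr (-1/4)) * (real N * L) = 3 * L * real N powr (3/4)"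
    using powr_add[of "real N" "-1/4" 1] N0 by (simp add: mult_ac)
  finally have main: "\<bar>\<Sum>n=1..N. mangoldt n * (chi \<delta> (\<alpha> * real n - \<beta>) - 2 * \<delta>)\<bar> \<le> 3 * L * real N powr (3/4) + 2 * L * Bd" by simp
  have L8: "L \<le> L ^ 8" "L ^ 3 \<le> L ^ 8 / 10 ^ 6"
  proof -
    have "L ^ 1 \<le> L ^ 8" using L36 by (intro power_increasing) auto
    then show "L \<le> L ^ 8" by simp
    have "10 ^ 6 \<le> L ^ 5" using L36 power_mono[of 36 L 5] by simp
    then have "L ^ 3 * 10 ^ 6 \<le> L ^ 3 * L ^ 5" using L36 by (intro mult_left_mono) auto
    then show "L ^ 3 \<le> L ^ 8 / 10 ^ 6" unfolding power_add[symmetric] by simp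
  qed
  have "2 * L * Bd = 12 * (13/8) ^ 7 * (L ^ 8 * E) + 6 * (13/8) ^ 7 * (L ^ 8 * W) + 96 * (13/8) ^ 2 * M * (L ^ 3 * W)"
    unfolding Bd_def lg_def by (simp add: eval_nat_numeral algebra_simps)
  \<comment> \<open>\<open>(13/8) ^ 7 < 30\<close> gives 360 and 180, rounded up to 400 and 200. The
    term with \<open>M\<close> has only \<open>L ^ 3\<close>, and the missing \<open>L ^ 5\<close>
    exceeds \<open>10 ^ 6\<close>.\<close>
  also have "\<dots> \<le> 400 * (L ^ 8 * E) + 200 * (L ^ 8 * W) + 300 * M * (L ^ 8 / 10 ^ 6 * W)"
    using L8 L36 M by (intro add_mono mult_mono) (auto simp: E_def W_def power_divide intro!: add_nonneg_nonneg)
  finally have b: "2 * L * Bd \<le> 400 * (L ^ 8 * E) + 200 * (L ^ 8 * W) + 300 * M * (L ^ 8 / 10 ^ 6 * W)" .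
  have c: "3 * L * real N powr (3/4) \<le> 3 * L ^ 8 * real N powr (3/4)"
    using L8 by (intro mult_right_mono) auto
  have 17: "17 powr (-3) = (1 / 4913 :: real)" by (simp add: powr_minus_divide)
  let ?e1 = "real N * of_int q powr (-1/2)" and ?e2 = "real N powr (3/4)" and ?e3 = "(\<delta> * real N * of_int q) powr (1/2)"
  have nn: "L ^ 8 * ?e1 \<ge> 0" "L ^ 8 * ?e2 \<ge> 0" "L ^ 8 * ?e3 \<ge> 0" "L ^ 8 * W \<ge> 0" "M * (L ^ 8 * W) \<ge> 0"
    using L36 M by (auto simp: W_def)
  have "3 * L * ?e2 + 2 * L * Bd \<le> 3422000 * (L ^ 8 * ?e1) + 251000 * (L ^ 8 * ?e2) + 38000 * (L ^ 8 * ?e3) + 11000 * (L ^ 8 * W) + 1000 / 4913 * (M * (L ^ 8 * W))"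
  proof -
    have eq: "400 * (L ^ 8 * E) + 200 * (L ^ 8 * W) + 300 * M * (L ^ 8 / 10 ^ 6 * W)
      = 400 * (L ^ 8 * ?e1) + 400 * (L ^ 8 * ?e2) + 400 * (L ^ 8 * ?e3) + 200 * (L ^ 8 * W) + 3 / 10000 * (M * (L ^ 8 * W))"
      unfolding E_def by (simp add: algebra_simps)
    have c': "3 * L * ?e2 \<le> 3 * (L ^ 8 * ?e2)" using c by simp
    have "3 * x2 + (400 * x1 + 400 * x2 + 400 * x3 + 200 * x4 + 3 / 10000 * x5)
        \<le> 3422000 * x1 + 251000 * x2 + 38000 * x3 + 11000 * x4 + 1000 / 4913 * x5"
      if "x1 \<ge> 0" "x2 \<ge> 0" "x3 \<ge> 0" "x4 \<ge> 0" "x5 \<ge> 0" for x1 x2 x3 x4 x5 :: real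
      using that by linarith
    from order.trans[OF add_mono[OF c' b[unfolded eq]] this[OF nn]] show ?thesis .
  qed
  also have "\<dots> = 10^3 * L^8 * (3422 * real N * of_int q powr (-1/2) + 251 * real N powr (3/4)
       + 38 * (\<delta> * real N * of_int q) powr (1/2) + (11 + 17 powr (-3) * M) * W)"
    unfolding 17 by (simp add: algebra_simps)
  finally show ?thesis using main unfolding W_def Y_def by (simp only: mult.assoc)
qed

section \<open>The trivial bound and the conclusion\<close>

lemma chi_sum_trivial:
  assumes \<delta>: "0 < \<delta>" "\<delta> < 1/2"
  shows "\<bar>\<Sum>n=1..N. mangoldt n * (chi \<delta> (\<alpha> * real n - \<beta>) - 2 * \<delta>)\<bar> \<le> real N * ln (real N)"
proof -
  have "\<bar>\<Sum>n=1..N. mangoldt n * (chi \<delta> (\<alpha> * real n - \<beta>) - 2 * \<delta>)\<bar> \<le> (\<Sum>n=1..N. mangoldt n)"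
  proof (intro order.trans[OF sum_abs] sum_mono)
    fix n
    have "\<bar>chi \<delta> (\<alpha> * real n - \<beta>) - 2 * \<delta>\<bar> \<le> 1"
      using \<delta> by (simp add: chi_def Let_def)
    then have "mangoldt n * \<bar>chi \<delta> (\<alpha> * real n - \<beta>) - 2 * \<delta>\<bar> \<le> mangoldt n * 1"
      by (intro mult_left_mono mangoldt_nonneg)
    then show "\<bar>mangoldt n * (chi \<delta> (\<alpha> * real n - \<beta>) - 2 * \<delta>)\<bar> \<le> mangoldt n" by (simp add: abs_mult)
  qed
  then show ?thesis using sum_mangoldt_le[of N] by linarith
qed

theorem theorem3:
  fixes \<alpha> \<beta> \<delta> \<epsilon> M L :: real and a q :: int and N :: nat
  assumes "q \<ge> 1"
    and "coprime a q"
    and "\<bar>\<alpha> - of_int a / of_int q\<bar> < 1 / (of_int q)^2"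
    and "0 < \<delta>" and "\<delta> < 1/2"
    and "N \<ge> 1"
    and "L = ln (real N * of_int q / \<delta>)"
    and "\<epsilon> > 0"
    and "M > 0"
    and "\<And>x::nat. x \<ge> 1 \<Longrightarrow> real (num_divisors x) \<le> M * real x powr (5/4 * \<epsilon>)"
  shows "\<bar>\<Sum>n=1..N. mangoldt n * (chi \<delta> (\<alpha> * real n - \<beta>) - 2 * \<delta>)\<bar>
    \<le> 10^3 * L^8 *
      (3422 * real N * of_int q powr (-1/2)
       + 251 * real N powr (3/4)
       + 38 * (\<delta> * real N * of_int q) powr (1/2)
       + (11 + 17 powr (-3) * M) * (real N * of_int q / \<delta>) powr (3/4 * \<epsilon>)
           * \<delta> powr (2/5) * real N powr (4/5 + \<epsilon>))"
proof (cases "L \<ge> 36")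
  case True
  interpret rational_approx \<alpha> a q by unfold_locales fact+
  show ?thesis by (rule chi_sum_bound) (use assms True in auto)
next
  case False
  have N0: "real N > 0" "real N \<ge> 1" and q0: "real_of_int q \<ge> 1" using assms by auto
  have L_eq: "L = ln (real N) + ln (of_int q) - ln \<delta>"
    unfolding assms(7) using N0 q0 assms by (simp add: ln_mult ln_div)
  have ln0: "ln (real N) \<ge> 0" "ln (real_of_int q) \<ge> 0" using N0 q0 by auto
  \<comment> \<open>\<open>\<delta> < 1/2\<close> keeps \<open>L\<close> away from 0, so that the
    factor \<open>L ^ 8\<close> on the right cannot make the bound too small.\<close>
  have "ln \<delta> \<le> ln (1/2)" using assms by (intro ln_mono) auto
  then have "- ln \<delta> \<ge> ln 2" by (simp add: ln_div)
  then have L: "L \<ge> 2/3" "ln (real N) \<le> L" using L_eq ln0 ln2_ge_two_thirds by linarith+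
  \<comment> \<open>\<open>N * L\<close> is N^(1/4) times \<open>N powr (3/4) * L\<close>, so the
    term with 251 suffices if this holds. As \<open>ln N \<le> L < 36\<close>, the left side is at
    most e^9 < 8200, while \<open>251000 * (2/3) ^ 7 > 14000\<close>.\<close>
  have "real N powr (1/4) \<le> 251000 * L ^ 7"
  proof -
    have "real N powr (1/4) = exp (ln (real N) / 4)" using N0 by (simp add: powr_def)
    also have "\<dots> \<le> exp (9 * 1)" using False L by simp
    also have "\<dots> = exp 1 ^ 9" using exp_of_nat_mult[of 9 "1::real"] by simp
    also have "\<dots> \<le> (272 / 100) ^ 9" using e_less_272 by (intro power_mono) auto
    also have "\<dots> \<le> 251000 * (2/3) ^ 7" by (simp add: power_divide)
    also have "\<dots> \<le> 251000 * L ^ 7" using L by (intro mult_left_mono power_mono) auto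
    finally show ?thesis .
  qed
  then have "real N powr (1/4) * (real N powr (3/4) * L) \<le> 251000 * L ^ 7 * (real N powr (3/4) * L)"
    using L by (intro mult_right_mono) auto
  moreover have "real N powr (1/4) * (real N powr (3/4) * L) = real N * L"
    using N0 by (simp add: powr_add[symmetric] flip: mult.assoc)
  moreover have "real N * ln (real N) \<le> real N * L" using L by (intro mult_left_mono) auto
  moreover have "251000 * L ^ 7 * (real N powr (3/4) * L) = 10 ^ 3 * L ^ 8 * (251 * real N powr (3/4))"
    by (simp add: eval_nat_numeral)
  ultimately have "real N * ln (real N) \<le> 10 ^ 3 * L ^ 8 * (251 * real N powr (3/4))" by linarith
  also have "\<dots> \<le> 10^3 * L^8 *
      (3422 * real N * of_int q powr (-1/2)
       + 251 * real N powr (3/4)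
       + 38 * (\<delta> * real N * of_int q) powr (1/2)
       + (11 + 17 powr (-3) * M) * (real N * of_int q / \<delta>) powr (3/4 * \<epsilon>)
           * \<delta> powr (2/5) * real N powr (4/5 + \<epsilon>))"
  proof (rule mult_left_mono)
    have "0 \<le> 3422 * real N * of_int q powr (-1/2)" "0 \<le> 38 * (\<delta> * real N * of_int q) powr (1/2)"
      "0 \<le> (11 + 17 powr (-3) * M) * (real N * of_int q / \<delta>) powr (3/4 * \<epsilon>) * \<delta> powr (2/5) * real N powr (4/5 + \<epsilon>)"
      using assms(9) by auto
    then show "251 * real N powr (3/4) \<le> 3422 * real N * of_int q powr (-1/2)
       + 251 * real N powr (3/4)
       + 38 * (\<delta> * real N * of_int q) powr (1/2)
       + (11 + 17 powr (-3) * M) * (real N * of_int q / \<delta>) powr (3/4 * \<epsilon>)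
           * \<delta> powr (2/5) * real N powr (4/5 + \<epsilon>)" by linarith
  qed (use L in auto)
  finally show ?thesis using chi_sum_trivial[OF assms(4,5), where N = N and \<alpha> = \<alpha> and \<beta> = \<beta>] by linarith
qed

end
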